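(* Let $n\geq 3$ be even. In $\mathbb S_{2n}$ let $t_i=(2i-1,\,2i)$ for $1\leq i\leq n$ and $H=\langle t_1,\dots,t_n\rangle\cong(\mathbb Z_2)^n$. Let $a_1,\dots,a_n\in\widehat H$ be defined by $a_i(t_j)=1$ for $i\neq j$ and $a_i(t_i)=-1$, and let $\omega:\widehat H\times\widehat H\to k^*$ be the bicharacter with $\omega(a_i,a_j)=-1$ if $i<j$ and $\omega(a_i,a_j)=1$ if $i\geq j$. Let $J=\sum_{\alpha,\beta\in\widehat H}\omega(\alpha,\beta)e_\alpha\otimes e_\beta$. Then $(k\mathbb S_{2n})^J$ is simple as a Hopf algebra.
   Context: $k$ is an algebraically closed field of characteristic zero. For a twist $J$ in a Hopf algebra $A$, $A^J$ is the Hopf algebra with the same algebra and counit, comultiplication $\Delta^J(h)=J^{-1}\Delta(h)J$ and twisted antipode. For an abelian subgroup $H$ of a finite group $G$, $\widehat H$ is its character group and $e_\chi=\frac{1}{|H|}\sum_{h\in H}\chi(h^{-1})h$; for a 2-cocycle $\omega$ on $\widehat H$, $J=\sum\omega(\alpha,\beta)e_\alpha\otimes e_\beta$ is a twist in $kG$. A Hopf algebra is simple if it has no normal Hopf subalgebras (stable under ${}^hx=\sum h_1xS(h_2)$) other than $k$ and itself. *)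

theory Defs
  imports "HOL-Combinatorics.Combinatorics" "HOL-Computational_Algebra.Polynomial"
begin

text \<open>Group algebra k G of a finite group G of permutations (elements of type nat => nat,
  product = composition).  An element of k G is a function x : G -> k, extended by 0
  outside G; the basis element g is gdelta g.  Elements of kG (x) kG are functions
  on G x G (extended by 0).\<close>

type_synonym perm = "nat \<Rightarrow> nat"

definition ga_carrier :: "perm set \<Rightarrow> (perm \<Rightarrow> 'k::field) set" where
  "ga_carrier G = {x. \<forall>g. g \<notin> G \<longrightarrow> x g = 0}"

definition gdelta :: "perm \<Rightarrow> perm \<Rightarrow> 'k::field" where
  "gdelta g = (\<lambda>h. if h = g then 1 else 0)"

definition ga_one :: "perm \<Rightarrow> 'k::field" where
  "ga_one = gdelta id"

definition ga_smult :: "'k::field \<Rightarrow> (perm \<Rightarrow> 'k) \<Rightarrow> perm \<Rightarrow> 'k" where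
  "ga_smult c x = (\<lambda>g. c * x g)"

definition ga_mult :: "perm set \<Rightarrow> (perm \<Rightarrow> 'k::field) \<Rightarrow> (perm \<Rightarrow> 'k) \<Rightarrow> perm \<Rightarrow> 'k" where
  "ga_mult G x y = (\<lambda>g. if g \<in> G then (\<Sum>h\<in>G. x h * y (inv h \<circ> g)) else 0)"

definition ga_inv :: "perm set \<Rightarrow> (perm \<Rightarrow> 'k::field) \<Rightarrow> perm \<Rightarrow> 'k" where
  "ga_inv G x = (SOME y. y \<in> ga_carrier G \<and> ga_mult G x y = ga_one \<and> ga_mult G y x = ga_one)"

definition ga_S :: "perm set \<Rightarrow> (perm \<Rightarrow> 'k::field) \<Rightarrow> perm \<Rightarrow> 'k" where
  "ga_S G x = (\<lambda>g. if g \<in> G then x (inv g) else 0)"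

definition ga2_carrier :: "perm set \<Rightarrow> (perm \<times> perm \<Rightarrow> 'k::field) set" where
  "ga2_carrier G = {F. \<forall>p. p \<notin> G \<times> G \<longrightarrow> F p = 0}"

definition tensor :: "(perm \<Rightarrow> 'k::field) \<Rightarrow> (perm \<Rightarrow> 'k) \<Rightarrow> perm \<times> perm \<Rightarrow> 'k" where
  "tensor x y = (\<lambda>(g, h). x g * y h)"

definition ga2_one :: "perm \<times> perm \<Rightarrow> 'k::field" where
  "ga2_one = tensor ga_one ga_one"

definition ga2_mult :: "perm set \<Rightarrow> (perm \<times> perm \<Rightarrow> 'k::field) \<Rightarrow> (perm \<times> perm \<Rightarrow> 'k)
    \<Rightarrow> perm \<times> perm \<Rightarrow> 'k" where
  "ga2_mult G F F' = (\<lambda>(g, h). if g \<in> G \<and> h \<in> G then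
      (\<Sum>(a, b)\<in>G \<times> G. F (a, b) * F' (inv a \<circ> g, inv b \<circ> h)) else 0)"

definition ga2_inv :: "perm set \<Rightarrow> (perm \<times> perm \<Rightarrow> 'k::field) \<Rightarrow> perm \<times> perm \<Rightarrow> 'k" where
  "ga2_inv G F = (SOME F'. F' \<in> ga2_carrier G \<and> ga2_mult G F F' = ga2_one \<and> ga2_mult G F' F = ga2_one)"

definition ga_Delta :: "(perm \<Rightarrow> 'k::field) \<Rightarrow> perm \<times> perm \<Rightarrow> 'k" where
  "ga_Delta x = (\<lambda>(g, h). if g = h then x g else 0)"

definition Delta_tw :: "perm set \<Rightarrow> (perm \<times> perm \<Rightarrow> 'k::field) \<Rightarrow> (perm \<Rightarrow> 'k) \<Rightarrow> perm \<times> perm \<Rightarrow> 'k" where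
  "Delta_tw G J x = ga2_mult G (ga2_mult G (ga2_inv G J) (ga_Delta x)) J"

text \<open>Twisted antipode S^J(x) = U S(x) U^{-1}, where U = m(id (x) S)(J^{-1}).\<close>
definition U_tw :: "perm set \<Rightarrow> (perm \<times> perm \<Rightarrow> 'k::field) \<Rightarrow> perm \<Rightarrow> 'k" where
  "U_tw G J = (\<lambda>g. if g \<in> G then
      (\<Sum>p\<in>{(a, b). a \<in> G \<and> b \<in> G \<and> a \<circ> inv b = g}. ga2_inv G J p) else 0)"

definition S_tw :: "perm set \<Rightarrow> (perm \<times> perm \<Rightarrow> 'k::field) \<Rightarrow> (perm \<Rightarrow> 'k) \<Rightarrow> perm \<Rightarrow> 'k" where
  "S_tw G J x = ga_mult G (ga_mult G (U_tw G J) (ga_S G x)) (ga_inv G (U_tw G J))"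

definition ad_tw :: "perm set \<Rightarrow> (perm \<times> perm \<Rightarrow> 'k::field) \<Rightarrow> (perm \<Rightarrow> 'k) \<Rightarrow> (perm \<Rightarrow> 'k) \<Rightarrow> perm \<Rightarrow> 'k" where
  "ad_tw G J h x = (\<lambda>g. \<Sum>(a, b)\<in>G \<times> G. Delta_tw G J h (a, b) *
      ga_mult G (ga_mult G (gdelta a) x) (S_tw G J (gdelta b)) g)"

definition ga_subspace :: "perm set \<Rightarrow> (perm \<Rightarrow> 'k::field) set \<Rightarrow> bool" where
  "ga_subspace G K \<longleftrightarrow> K \<subseteq> ga_carrier G \<and> (\<lambda>_. 0) \<in> K \<and>
     (\<forall>x\<in>K. \<forall>y\<in>K. (\<lambda>g. x g + y g) \<in> K) \<and> (\<forall>c. \<forall>x\<in>K. ga_smult c x \<in> K)"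

definition tensor_span :: "(perm \<Rightarrow> 'k::field) set \<Rightarrow> (perm \<times> perm \<Rightarrow> 'k) set" where
  "tensor_span K = {F. \<exists>(m::nat) c x y. (\<forall>i<m. x i \<in> K \<and> y i \<in> K) \<and>
      F = (\<lambda>p. \<Sum>i<m. c i * tensor (x i) (y i) p)}"

definition hopf_subalg_tw :: "perm set \<Rightarrow> (perm \<times> perm \<Rightarrow> 'k::field) \<Rightarrow> (perm \<Rightarrow> 'k) set \<Rightarrow> bool" where
  "hopf_subalg_tw G J K \<longleftrightarrow> ga_subspace G K \<and> ga_one \<in> K \<and>
     (\<forall>x\<in>K. \<forall>y\<in>K. ga_mult G x y \<in> K) \<and>
     (\<forall>x\<in>K. Delta_tw G J x \<in> tensor_span K) \<and>
     (\<forall>x\<in>K. S_tw G J x \<in> K)"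

definition normal_hopf_subalg_tw :: "perm set \<Rightarrow> (perm \<times> perm \<Rightarrow> 'k::field) \<Rightarrow> (perm \<Rightarrow> 'k) set \<Rightarrow> bool" where
  "normal_hopf_subalg_tw G J K \<longleftrightarrow> hopf_subalg_tw G J K \<and>
     (\<forall>h\<in>ga_carrier G. \<forall>x\<in>K. ad_tw G J h x \<in> K)"

definition simple_twisted :: "perm set \<Rightarrow> (perm \<times> perm \<Rightarrow> 'k::field) \<Rightarrow> bool" where
  "simple_twisted G J \<longleftrightarrow> (\<forall>K. normal_hopf_subalg_tw G J K \<longrightarrow>
      K = {ga_smult c ga_one | c. True} \<or> K = ga_carrier G)"

definition sym_group :: "nat \<Rightarrow> perm set" where
  "sym_group m = {p. p permutes {1..m}}"

definition gen_subgroup :: "perm set \<Rightarrow> perm set" where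
  "gen_subgroup T = \<Inter>{K. id \<in> K \<and> T \<subseteq> K \<and> (\<forall>x\<in>K. \<forall>y\<in>K. x \<circ> y \<in> K) \<and> (\<forall>x\<in>K. inv x \<in> K)}"

definition tt :: "nat \<Rightarrow> perm" where
  "tt i = transpose (2 * i - 1) (2 * i)"

definition H_n :: "nat \<Rightarrow> perm set" where
  "H_n n = gen_subgroup (tt ` {1..n})"

definition characters :: "perm set \<Rightarrow> (perm \<Rightarrow> 'k::field) set" where
  "characters H = {\<chi>. \<chi> id = 1 \<and> (\<forall>g\<in>H. \<forall>h\<in>H. \<chi> (g \<circ> h) = \<chi> g * \<chi> h) \<and>
      (\<forall>g. g \<notin> H \<longrightarrow> \<chi> g = 0)}"

definition char_mult :: "(perm \<Rightarrow> 'k::field) \<Rightarrow> (perm \<Rightarrow> 'k) \<Rightarrow> perm \<Rightarrow> 'k" where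
  "char_mult \<alpha> \<beta> = (\<lambda>g. \<alpha> g * \<beta> g)"

definition bicharacter :: "perm set \<Rightarrow> ((perm \<Rightarrow> 'k::field) \<Rightarrow> (perm \<Rightarrow> 'k) \<Rightarrow> 'k) \<Rightarrow> bool" where
  "bicharacter H \<omega> \<longleftrightarrow> (\<forall>\<alpha>\<in>characters H. \<forall>\<beta>\<in>characters H. \<omega> \<alpha> \<beta> \<noteq> 0) \<and>
     (\<forall>\<alpha>\<in>characters H. \<forall>\<beta>\<in>characters H. \<forall>\<gamma>\<in>characters H.
        \<omega> (char_mult \<alpha> \<beta>) \<gamma> = \<omega> \<alpha> \<gamma> * \<omega> \<beta> \<gamma> \<and>
        \<omega> \<alpha> (char_mult \<beta> \<gamma>) = \<omega> \<alpha> \<beta> * \<omega> \<alpha> \<gamma>)"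

definition idem :: "perm set \<Rightarrow> (perm \<Rightarrow> 'k::field) \<Rightarrow> perm \<Rightarrow> 'k" where
  "idem H \<chi> = (\<lambda>g. if g \<in> H then \<chi> (inv g) / of_nat (card H) else 0)"

definition twist_J :: "perm set \<Rightarrow> ((perm \<Rightarrow> 'k::field) \<Rightarrow> (perm \<Rightarrow> 'k) \<Rightarrow> 'k) \<Rightarrow> perm \<times> perm \<Rightarrow> 'k" where
  "twist_J H \<omega> = (\<lambda>p. \<Sum>\<alpha>\<in>characters H. \<Sum>\<beta>\<in>characters H.
      \<omega> \<alpha> \<beta> * tensor (idem H \<alpha>) (idem H \<beta>) p)"

definition alg_closed :: "'k::field itself \<Rightarrow> bool" where
  "alg_closed _ \<longleftrightarrow> (\<forall>p :: 'k poly. degree p > 0 \<longrightarrow> (\<exists>x. poly p x = 0))"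

end

theory Submission
  imports Defs
begin

text \<open>
  H is an elementary abelian 2-group, so J is its own inverse and the antipode is trivial on the group algebra of H.
  Let K be a normal Hopf subalgebra and let F be the set of functions f on G with
  \<open>\<langle>xa, f\<rangle> = \<epsilon>(x) \<langle>a, f\<rangle>\<close> for x in K and a in the group algebra, i.e. the annihilator of the ideal \<open>K\<^sup>+ kG\<close>.
  Normality makes F stable under left translations, and because a Hopf ideal of the twisted algebra
  is one of kG, F is closed under products; hence F consists of the functions that are constant on the cosets of
  a normal subgroup N.  If N is trivial, K consists of scalars.  Otherwise N contains the alternating group.

  The form \<open>(x, y) \<mapsto> (xy)(1)\<close> is the Haar integral of the twisted algebra too, so it is
  nondegenerate on K and K contains an integral e normalised by \<open>e(1) = 1\<close>; the function
  \<open>g \<mapsto> e(g\<^sup>-\<^sup>1)\<close> lies in F, so e is constant on even and on odd permutations.  If it is constant, the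
  legs of its coproduct span kG and K is everything.  If not, the sign character lies in F.  Then every x in K
  is coinvariant on both sides for the sign character, i.e. \<open>x = u \<tau>(x) u = v \<tau>(x) v\<close> with
  \<open>u = (id \<otimes> sgn)(J)\<close>, \<open>v = (sgn \<otimes> id)(J)\<close> and \<open>\<tau>(g) = sgn(g) g\<close>, so x commutes with uv.
  Applied to the legs of the coproduct of e this forces uv to commute with all even permutations, hence to be a scalar,
  whereas \<open>a\<^sub>1(uv) = \<omega>(a\<^sub>1, sgn) \<omega>(sgn, a\<^sub>1) = -1\<close> for even n.
\<close>

section \<open>Weighted sums and the group algebra\<close>

text \<open>A Hopf subalgebra of the twisted algebra need not be spanned by permutations, so K
  cannot be read as a subgroup; its invariant functions form an ordinary translation-stable algebra
  of functions on G and can be. In the untwisted algebra the alternating group spans a normal Hopf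
  subalgebra, the only proper nontrivial one as 2n >= 6. The twist has to destroy exactly this one,
  which is why everything ends at the sign character. Every t_i is odd, so sgn restricts to a_1 ...
  a_n on H. Hence \<omega>(a_1, sgn) = (-1)^(n-1) while \<omega>(sgn, a_1) = 1, and their product is
  -1 exactly when n is even. At the trivial character the same product is 1, whereas a scalar uv
  would take one value at all characters.

  Elements of kG are treated as functionals, \<open>wsum x G f\<close> being the pairing of x with
  f. A product becomes a nested sum over composites of permutations, and the legs of J and U, which
  lie in the commutative algebra kH, can be moved past each other inside the argument of f.\<close>

definition wsum :: "('i \<Rightarrow> 'k::field) \<Rightarrow> 'i set \<Rightarrow> ('i \<Rightarrow> 'k) \<Rightarrow> 'k" where
  "wsum w I f = (\<Sum>i\<in>I. w i * f i)"

lemma wsum_cong: "(\<And>i. i \<in> I \<Longrightarrow> f i = g i) \<Longrightarrow> wsum w I f = wsum w I g"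
  by (simp add: wsum_def)

lemma wsum_swap: "wsum w I (\<lambda>i. wsum v L (f i)) = wsum v L (\<lambda>j. wsum w I (\<lambda>i. f i j))"
  unfolding wsum_def sum_distrib_left by (subst sum.swap) (simp add: mult.left_commute)

lemma wsum_sum: "wsum w I (\<lambda>i. \<Sum>k\<in>L. c k * f k i) = (\<Sum>k\<in>L. c k * wsum w I (f k))"
  unfolding wsum_def sum_distrib_left by (subst sum.swap) (simp add: mult.left_commute)

lemma wsum_sum1: "wsum w I (\<lambda>i. \<Sum>k\<in>L. f k i) = (\<Sum>k\<in>L. wsum w I (f k))"
  using wsum_sum[of w I "\<lambda>_. 1" f L] by simp

lemma wsum_cmult: "wsum w I (\<lambda>i. c * f i) = c * wsum w I f"
  by (simp add: wsum_def sum_distrib_left mult.left_commute)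

lemma wsum_multc: "wsum w I (\<lambda>i. f i * c) = wsum w I f * c"
  by (simp add: wsum_def sum_distrib_right mult.assoc)

lemma wsum_add: "wsum w I (\<lambda>i. f i + g i) = wsum w I f + wsum w I g"
  by (simp add: wsum_def sum.distrib distrib_left)

lemma wsum_lin: "wsum (\<lambda>i. x i + c * y i) I f = wsum x I f + c * wsum y I f"
  by (simp add: wsum_def distrib_right sum.distrib sum_distrib_left mult.assoc)

lemma wsum_const: "wsum x A (\<lambda>_. c) = wsum x A (\<lambda>_. 1) * c"
  by (simp add: wsum_def sum_distrib_right)

lemma wsum_indicator: "finite I \<Longrightarrow> wsum w I (\<lambda>i. if i = j then 1 else 0) = (if j \<in> I then w j else 0)"
  by (simp add: wsum_def if_distrib cong: if_cong)

lemma wsum_delta: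
  assumes "finite I" "j \<in> I" shows "wsum (\<lambda>i. if i = j then c else 0) I f = c * f j"
proof -
  have "wsum (\<lambda>i. if i = j then c else 0) I f = (\<Sum>i\<in>I. if i = j then c * f j else 0)"
    unfolding wsum_def by (rule sum.cong) auto
  then show ?thesis using assms by simp
qed

text \<open>Pairing with the indicator of a point recovers the coefficient there, so an equation
  between elements may be checked against all test functions.\<close>

lemma wsum_ext:
  assumes "finite I" "\<And>i. i \<notin> I \<Longrightarrow> v i = 0" "\<And>i. i \<notin> I \<Longrightarrow> w i = 0"
    and "\<And>f. wsum v I f = wsum w I f"
  shows "v = w"
proof
  fix j show "v j = w j"
    using assms(4)[of "\<lambda>i. if i = j then 1 else 0"] assms(2,3)[of j]
    by (cases "j \<in> I") (auto simp: wsum_indicator[OF assms(1)])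
qed

lemma wsum_mono_neutral:
  assumes "finite I" "L \<subseteq> I" "\<And>i. i \<in> I - L \<Longrightarrow> w i = 0"
  shows "wsum w I f = wsum w L f"
  unfolding wsum_def by (rule sum.mono_neutral_right) (use assms in auto)

lemma wsum_Times:
  "wsum w (A \<times> B) f = (\<Sum>a\<in>A. wsum (\<lambda>b. w (a, b)) B (\<lambda>b. f (a, b)))"
  "wsum w (A \<times> B) f = (\<Sum>b\<in>B. wsum (\<lambda>a. w (a, b)) A (\<lambda>a. f (a, b)))"
proof -
  show 1: "wsum w (A \<times> B) f = (\<Sum>a\<in>A. wsum (\<lambda>b. w (a, b)) B (\<lambda>b. f (a, b)))"
    by (simp add: wsum_def sum.cartesian_product case_prod_unfold)
  show "wsum w (A \<times> B) f = (\<Sum>b\<in>B. wsum (\<lambda>a. w (a, b)) A (\<lambda>a. f (a, b)))"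
    unfolding 1 unfolding wsum_def by (rule sum.swap)
qed

section \<open>Group algebra operations in dual form\<close>

locale finite_perm_group =
  fixes G :: "perm set"
  assumes finite_G: "finite G" and id_in: "id \<in> G"
    and comp_in: "g \<in> G \<Longrightarrow> h \<in> G \<Longrightarrow> g \<circ> h \<in> G"
    and inv_in: "g \<in> G \<Longrightarrow> inv g \<in> G"
    and bij_in: "g \<in> G \<Longrightarrow> bij g"
begin

lemma inv_cancel [simp]:
  assumes "g \<in> G"
  shows "inv g \<circ> g = id" "g \<circ> inv g = id" "inv g \<circ> (g \<circ> x) = x" "g \<circ> (inv g \<circ> x) = x"
    "inv (inv g) = g"
  using bij_in[OF assms] by (simp_all add: bij_is_inj bij_is_surj surj_iff inv_inv_eq flip: comp_assoc)
    (simp_all add: surj_iff[THEN iffD1, OF bij_is_surj])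

lemma inv_comp: "g \<in> G \<Longrightarrow> h \<in> G \<Longrightarrow> inv (g \<circ> h) = inv h \<circ> inv g"
  by (simp add: o_inv_distrib bij_in)

lemma sum_left_translate: "a \<in> G \<Longrightarrow> (\<Sum>g\<in>G. f (a \<circ> g)) = (\<Sum>g\<in>G. f g)"
  by (rule sum.reindex_bij_witness[of _ "\<lambda>g. inv a \<circ> g" "\<lambda>g. a \<circ> g"]) (auto simp: comp_in inv_in)

lemma sum_inv: "(\<Sum>g\<in>G. f (inv g)) = (\<Sum>g\<in>G. f g)"
  by (rule sum.reindex_bij_witness[of _ "\<lambda>g. inv g" "\<lambda>g. inv g"]) (auto simp: inv_in)

text \<open>Substituting the second factor as summation variable removes \<open>inv\<close> from the
  convolution: the pairing sees only the composites, weighted by x and y.\<close>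

lemma wsum_ga_mult: "wsum (ga_mult G x y) G f = wsum x G (\<lambda>g. wsum y G (\<lambda>h. f (g \<circ> h)))"
proof -
  have "wsum (ga_mult G x y) G f = (\<Sum>h\<in>G. \<Sum>g\<in>G. x h * y (inv h \<circ> g) * f g)"
    unfolding wsum_def by (subst sum.swap) (simp add: ga_mult_def sum_distrib_right)
  also have "\<dots> = (\<Sum>h\<in>G. \<Sum>g\<in>G. x h * y g * f (h \<circ> g))"
  proof (rule sum.cong[OF refl])
    fix h assume h: "h \<in> G"
    show "(\<Sum>g\<in>G. x h * y (inv h \<circ> g) * f g) = (\<Sum>g\<in>G. x h * y g * f (h \<circ> g))"
      using h by (subst sum_left_translate[OF h, symmetric]) simp
  qed
  finally show ?thesis by (simp add: wsum_def sum_distrib_left mult.assoc)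
qed

lemma wsum_ga2_mult:
  "wsum (ga2_mult G E F) (G \<times> G) f =
    wsum E (G \<times> G) (\<lambda>a. wsum F (G \<times> G) (\<lambda>b. f (fst a \<circ> fst b, snd a \<circ> snd b)))"
proof -
  have "wsum (ga2_mult G E F) (G \<times> G) f =
     (\<Sum>b\<in>G \<times> G. \<Sum>a\<in>G \<times> G. E a * F (inv (fst a) \<circ> fst b, inv (snd a) \<circ> snd b) * f b)"
    by (auto simp: wsum_def ga2_mult_def sum_distrib_right case_prod_unfold intro!: sum.cong)
  also have "\<dots> = (\<Sum>a\<in>G \<times> G. \<Sum>b\<in>G \<times> G. E a * F (inv (fst a) \<circ> fst b, inv (snd a) \<circ> snd b) * f b)"
    by (rule sum.swap)
  also have "\<dots> = (\<Sum>a\<in>G \<times> G. \<Sum>b\<in>G \<times> G. E a * F b * f (fst a \<circ> fst b, snd a \<circ> snd b))"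
  proof (rule sum.cong[OF refl])
    fix a assume a: "a \<in> G \<times> G"
    show "(\<Sum>b\<in>G \<times> G. E a * F (inv (fst a) \<circ> fst b, inv (snd a) \<circ> snd b) * f b) =
       (\<Sum>b\<in>G \<times> G. E a * F b * f (fst a \<circ> fst b, snd a \<circ> snd b))"
      by (rule sum.reindex_bij_witness[of _ "\<lambda>b. (fst a \<circ> fst b, snd a \<circ> snd b)"
            "\<lambda>b. (inv (fst a) \<circ> fst b, inv (snd a) \<circ> snd b)"])
        (use a in \<open>auto simp: comp_in inv_in\<close>)
  qed
  finally show ?thesis by (simp add: wsum_def sum_distrib_left mult.assoc)
qed

lemma wsum_ga_Delta: "wsum (ga_Delta x) (G \<times> G) f = wsum x G (\<lambda>g. f (g, g))"
proof -
  have "wsum (ga_Delta x) (G \<times> G) f =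
    (\<Sum>h\<in>G. wsum (\<lambda>g. if g = h then x h else 0) G (\<lambda>g. f (g, h)))"
    unfolding wsum_Times(2) by (intro sum.cong refl) (auto simp: wsum_def ga_Delta_def intro!: sum.cong)
  then show ?thesis by (simp add: wsum_delta finite_G) (simp add: wsum_def)
qed

lemma wsum_gdelta: "g \<in> G \<Longrightarrow> wsum (gdelta g) G f = f g"
  by (simp add: gdelta_def wsum_delta finite_G)

lemma wsum_ga_S: "wsum (ga_S G x) G f = wsum x G (\<lambda>g. f (inv g))"
  unfolding wsum_def by (subst sum_inv[symmetric]) (simp add: ga_S_def inv_in)

lemma wsum_translate:
  assumes "a \<in> G" "b \<in> G"
  shows "wsum (\<lambda>g. x (a \<circ> g \<circ> b)) G f = wsum x G (\<lambda>g. f (inv a \<circ> g \<circ> inv b))"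
  unfolding wsum_def
  by (rule sum.reindex_bij_witness[of _ "\<lambda>g. inv a \<circ> g \<circ> inv b" "\<lambda>g. a \<circ> g \<circ> b"])
     (use assms in \<open>auto simp: comp_in inv_in comp_assoc\<close>)

lemma carrier_ext:
  assumes "x \<in> ga_carrier G" "y \<in> ga_carrier G" "\<And>f. wsum x G f = wsum y G f"
  shows "x = y"
  using assms by (intro wsum_ext[OF finite_G]) (auto simp: ga_carrier_def)

lemma carrier2_ext:
  assumes "x \<in> ga2_carrier G" "y \<in> ga2_carrier G" "\<And>f. wsum x (G \<times> G) f = wsum y (G \<times> G) f"
  shows "x = y"
  using assms finite_G by (intro wsum_ext[of "G \<times> G"]) (auto simp: ga2_carrier_def)

lemma ga_mult_carrier [simp]: "ga_mult G x y \<in> ga_carrier G"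
  by (simp add: ga_mult_def ga_carrier_def)

lemma ga2_mult_carrier [simp]: "ga2_mult G x y \<in> ga2_carrier G"
  by (auto simp add: ga2_mult_def ga2_carrier_def)

lemma ga_one_carrier [simp]: "ga_one \<in> ga_carrier G"
  using id_in by (auto simp: ga_one_def gdelta_def ga_carrier_def)

lemma ga2_one_carrier [simp]: "ga2_one \<in> ga2_carrier G"
  using id_in by (auto simp: ga2_one_def tensor_def ga_one_def gdelta_def ga2_carrier_def)

lemma wsum_ga_one: "wsum ga_one G f = f id"
  by (simp add: ga_one_def wsum_gdelta id_in)

lemma wsum_ga2_one:
  fixes f :: "perm \<times> perm \<Rightarrow> 'a::field"
  shows "wsum ga2_one (G \<times> G) f = f (id, id)"
proof -
  have *: "ga2_one = (\<lambda>z. if z = (id, id) then 1 else (0::'a))"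
    by (auto simp: ga2_one_def tensor_def ga_one_def gdelta_def fun_eq_iff)
  show ?thesis unfolding * using finite_G id_in
    by (simp add: wsum_delta)
qed

end

text \<open>Identities in \<open>kG \<otimes> kG\<close> are stated by pairing both sides with an arbitrary function:
  \<open>J_square\<close> says \<open>J\<^sup>2 = 1\<close>, and \<open>J_absorb\<close> says \<open>(1 \<otimes> U) J = \<Sum> J(p, q) p \<otimes> pq\<close>, where
  \<open>U = m(id \<otimes> S)(J)\<close>.\<close>

locale involutive_twist = finite_perm_group G for G +
  fixes H :: "perm set" and J :: "perm \<times> perm \<Rightarrow> 'k::field_char_0"
  assumes H_sub: "H \<subseteq> G" and id_H: "id \<in> H"
    and comp_H: "g \<in> H \<Longrightarrow> h \<in> H \<Longrightarrow> g \<circ> h \<in> H"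
    and invol: "h \<in> H \<Longrightarrow> h \<circ> h = id"
    and J_supp: "z \<notin> H \<times> H \<Longrightarrow> J z = 0"
    and J_square: "wsum J (H \<times> H) (\<lambda>a. wsum J (H \<times> H) (\<lambda>b. f (fst a \<circ> fst b) (snd a \<circ> snd b))) = f id id"
    and J_counit: "wsum J (H \<times> H) (\<lambda>a. f1 (fst a)) = f1 id" "wsum J (H \<times> H) (\<lambda>a. f1 (snd a)) = f1 id"
    and J_absorb: "wsum J (H \<times> H) (\<lambda>a. wsum J (H \<times> H) (\<lambda>b. f (fst a) (fst b \<circ> snd b \<circ> snd a))) =
       wsum J (H \<times> H) (\<lambda>a. f (fst a) (fst a \<circ> snd a))"
begin

section \<open>The element U and the inverse of the twist\<close>

definition U :: "perm \<Rightarrow> 'k" where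
  "U h = (if h \<in> H then \<Sum>q\<in>H. J (h \<circ> q, q) else 0)"

abbreviation "HH \<equiv> H \<times> H"

lemma finite_H: "finite H" using H_sub finite_G finite_subset by blast

lemma H_in_G [simp]: "h \<in> H \<Longrightarrow> h \<in> G" using H_sub by blast

lemma inv_H [simp]: "h \<in> H \<Longrightarrow> inv h = h"
  using invol by (intro inv_unique_comp) auto

lemma comm_H: "g \<in> H \<Longrightarrow> h \<in> H \<Longrightarrow> g \<circ> h = h \<circ> g"
  using inv_comp[of g h] comp_H[of g h] by simp

lemma left_comm_H: "g \<in> H \<Longrightarrow> h \<in> H \<Longrightarrow> g \<circ> (h \<circ> x) = h \<circ> (g \<circ> x)"
  using comm_H by (simp flip: comp_assoc)

lemma invol_left: "h \<in> H \<Longrightarrow> h \<circ> (h \<circ> x) = x"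
  using invol by (simp flip: comp_assoc)

lemma J_zero_outside: "wsum J (G \<times> G) f = wsum J HH f"
  by (rule wsum_mono_neutral) (use finite_G J_supp H_sub in auto)

lemma U_zero_outside: "wsum U G f = wsum U H f"
  by (rule wsum_mono_neutral) (use finite_G U_def H_sub in auto)

lemma U_carrier: "U \<in> ga_carrier G"
  by (auto simp: ga_carrier_def U_def)

text \<open>Elements of H are their own inverses, so the antipode in U disappears and U is simply
  the product of the two legs of J.\<close>

lemma wsum_U: "wsum U H f = wsum J HH (\<lambda>a. f (fst a \<circ> snd a))"
proof -
  have "wsum U H f = (\<Sum>h\<in>H. \<Sum>q\<in>H. J (h \<circ> q, q) * f h)"
    by (simp add: wsum_def U_def sum_distrib_right)
  also have "\<dots> = (\<Sum>q\<in>H. \<Sum>h\<in>H. J (h \<circ> q, q) * f h)" by (rule sum.swap)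
  also have "\<dots> = (\<Sum>q\<in>H. \<Sum>h\<in>H. J (h, q) * f (h \<circ> q))"
  proof (rule sum.cong[OF refl])
    fix q assume q: "q \<in> H"
    show "(\<Sum>h\<in>H. J (h \<circ> q, q) * f h) = (\<Sum>h\<in>H. J (h, q) * f (h \<circ> q))"
      by (rule sum.reindex_bij_witness[of _ "\<lambda>h. h \<circ> q" "\<lambda>h. h \<circ> q"])
        (use q in \<open>auto simp: comp_H comp_assoc invol\<close>)
  qed
  finally show ?thesis by (simp add: wsum_Times(2)) (simp add: wsum_def)
qed

lemma U_absorb: "wsum J HH (\<lambda>a. wsum U H (\<lambda>u. f (fst a) (u \<circ> snd a))) =
    wsum J HH (\<lambda>a. f (fst a) (fst a \<circ> snd a))"
  using J_absorb[of f] by (simp add: wsum_U)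

text \<open>Multiplication is an algebra map from kH (x) kH to the commutative algebra kH, and it
  sends J to U; so J^2 = 1 gives U^2 = 1.\<close>

lemma U_square: "wsum U H (\<lambda>u. wsum U H (\<lambda>v. f (u \<circ> v))) = f id"
proof -
  have "wsum U H (\<lambda>u. wsum U H (\<lambda>v. f (u \<circ> v))) =
    wsum J HH (\<lambda>a. wsum J HH (\<lambda>b. f (fst a \<circ> snd a \<circ> (fst b \<circ> snd b))))"
    by (simp add: wsum_U)
  also have "\<dots> = wsum J HH (\<lambda>a. wsum J HH (\<lambda>b. f ((fst a \<circ> fst b) \<circ> (snd a \<circ> snd b))))"
    by (intro wsum_cong arg_cong[of _ _ f]) (auto simp: comp_assoc left_comm_H)
  finally show ?thesis by (simp add: J_square[of "\<lambda>p q. f (p \<circ> q)"])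
qed

lemma ga2_inv_J: "ga2_inv G J = J"
proof -
  have car: "J \<in> ga2_carrier G" using J_supp H_sub by (auto simp: ga2_carrier_def)
  have JJ: "ga2_mult G J J = ga2_one"
    by (rule carrier2_ext) (simp_all add: wsum_ga2_mult wsum_ga2_one J_zero_outside J_square[of "\<lambda>p q. f (p, q)" for f])
  \<comment> \<open>\<open>ga2_inv\<close> is a choice operator, so uniqueness has to be supplied as
    well: F = J J F = J.\<close>
  have uniq: "F = J" if F: "F \<in> ga2_carrier G" "ga2_mult G J F = ga2_one" for F
  proof (rule carrier2_ext[OF F(1) car])
    fix f
    have *: "wsum J HH (\<lambda>b. wsum F (G \<times> G) (\<lambda>c. f (fst b \<circ> fst c, snd b \<circ> snd c))) = f (id, id)" for f
      using wsum_ga2_mult[of J F f] by (simp add: F(2) wsum_ga2_one J_zero_outside)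
    have "wsum F (G \<times> G) f = wsum F (G \<times> G)
        (\<lambda>c. wsum J HH (\<lambda>a. wsum J HH (\<lambda>b. f (fst a \<circ> fst b \<circ> fst c, snd a \<circ> snd b \<circ> snd c))))"
      by (rule wsum_cong) (use J_square[of "\<lambda>p q. f (p \<circ> fst c, q \<circ> snd c)" for c] in simp)
    also have "\<dots> = wsum J HH (\<lambda>a. wsum J HH (\<lambda>b. wsum F (G \<times> G)
         (\<lambda>c. f (fst a \<circ> fst b \<circ> fst c, snd a \<circ> snd b \<circ> snd c))))"
      by (subst wsum_swap) (intro wsum_cong wsum_swap)
    also have "\<dots> = wsum J HH f"
      by (rule wsum_cong) (use *[of "\<lambda>z. f (fst a \<circ> fst z, snd a \<circ> snd z)" for a] in \<open>simp add: comp_assoc\<close>)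
    finally show "wsum F (G \<times> G) f = wsum J (G \<times> G) f" by (simp add: J_zero_outside)
  qed
  show ?thesis
    unfolding ga2_inv_def by (rule some_equality) (use car JJ uniq in auto)
qed

lemma U_tw_eq: "U_tw G J = U"
proof (rule carrier_ext)
  show "U_tw G J \<in> ga_carrier G" by (auto simp: U_tw_def ga_carrier_def)
  fix f
  have "wsum (U_tw G J) G f = (\<Sum>g\<in>G. \<Sum>p\<in>{p \<in> G \<times> G. fst p \<circ> inv (snd p) = g}. J p * f (fst p \<circ> inv (snd p)))"
    by (auto simp: wsum_def U_tw_def ga2_inv_J sum_distrib_right intro!: sum.cong)
  also have "\<dots> = wsum J (G \<times> G) (\<lambda>p. f (fst p \<circ> inv (snd p)))"
    unfolding wsum_def by (rule sum.group) (use finite_G comp_in inv_in in auto)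
  also have "\<dots> = wsum U H f"
    unfolding J_zero_outside wsum_U by (intro wsum_cong) auto
  finally show "wsum (U_tw G J) G f = wsum U G f" by (simp add: U_zero_outside)
qed (rule U_carrier)

lemma ga_inv_U: "ga_inv G U = U"
proof -
  have UU: "ga_mult G U U = ga_one"
    by (rule carrier_ext) (simp_all add: wsum_ga_mult wsum_ga_one U_zero_outside U_square)
  have uniq: "F = U" if F: "F \<in> ga_carrier G" "ga_mult G U F = ga_one" for F
  proof (rule carrier_ext[OF F(1) U_carrier])
    fix f
    have *: "wsum U H (\<lambda>b. wsum F G (\<lambda>c. f (b \<circ> c))) = f id" for f
      using wsum_ga_mult[of U F f] by (simp add: F(2) wsum_ga_one U_zero_outside)
    have "wsum F G f = wsum F G (\<lambda>c. wsum U H (\<lambda>a. wsum U H (\<lambda>b. f (a \<circ> b \<circ> c))))"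
      by (rule wsum_cong) (use U_square[of "\<lambda>p. f (p \<circ> c)" for c] in simp)
    also have "\<dots> = wsum U H (\<lambda>a. wsum U H (\<lambda>b. wsum F G (\<lambda>c. f (a \<circ> b \<circ> c))))"
      by (subst wsum_swap) (intro wsum_cong wsum_swap)
    also have "\<dots> = wsum U H f"
      by (rule wsum_cong) (use *[of "\<lambda>z. f (a \<circ> z)" for a] in \<open>simp add: comp_assoc\<close>)
    finally show "wsum F G f = wsum U G f" by (simp add: U_zero_outside)
  qed
  show ?thesis
    unfolding ga_inv_def by (rule some_equality) (use U_carrier UU uniq in auto)
qed

section \<open>The twisted structure maps as nested sums\<close>

lemma wsum_Delta_tw:
  "wsum (Delta_tw G J x) (G \<times> G) f =
    wsum J HH (\<lambda>a. wsum x G (\<lambda>g. wsum J HH (\<lambda>b.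
      f (fst a \<circ> g \<circ> fst b, snd a \<circ> g \<circ> snd b))))"
  by (simp add: Delta_tw_def ga2_inv_J wsum_ga2_mult wsum_ga_Delta J_zero_outside)

lemma wsum_S_tw:
  "wsum (S_tw G J x) G f = wsum U H (\<lambda>u. wsum x G (\<lambda>t. wsum U H (\<lambda>v. f (u \<circ> inv t \<circ> v))))"
  by (simp add: S_tw_def U_tw_eq ga_inv_U wsum_ga_mult U_zero_outside wsum_ga_S)

lemma wsum_ad_tw:
  assumes "\<eta> \<in> G"
  shows "wsum (ad_tw G J (gdelta \<eta>) x) G f =
    wsum J HH (\<lambda>a. wsum J HH (\<lambda>b. wsum x G (\<lambda>g. wsum U H (\<lambda>u. wsum U H (\<lambda>v.
       f (fst a \<circ> \<eta> \<circ> fst b \<circ> g \<circ> (u \<circ> inv (snd a \<circ> \<eta> \<circ> snd b) \<circ> v)))))))"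
proof -
  have "wsum (ad_tw G J (gdelta \<eta>) x) G f =
    wsum (Delta_tw G J (gdelta \<eta>)) (G \<times> G)
      (\<lambda>z. wsum (ga_mult G (ga_mult G (gdelta (fst z)) x) (S_tw G J (gdelta (snd z)))) G f)"
  proof -
    have "wsum (ad_tw G J (gdelta \<eta>) x) G f = (\<Sum>g\<in>G. \<Sum>z\<in>G \<times> G. Delta_tw G J (gdelta \<eta>) z *
        (ga_mult G (ga_mult G (gdelta (fst z)) x) (S_tw G J (gdelta (snd z))) g * f g))"
      by (simp add: wsum_def ad_tw_def sum_distrib_right case_prod_unfold mult.assoc)
    also have "\<dots> = (\<Sum>z\<in>G \<times> G. \<Sum>g\<in>G. Delta_tw G J (gdelta \<eta>) z *
        (ga_mult G (ga_mult G (gdelta (fst z)) x) (S_tw G J (gdelta (snd z))) g * f g))"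
      by (rule sum.swap)
    finally show ?thesis by (simp add: wsum_def sum_distrib_left)
  qed
  also have "\<dots> = wsum (Delta_tw G J (gdelta \<eta>)) (G \<times> G) (\<lambda>z. wsum x G (\<lambda>g. wsum U H (\<lambda>u. wsum U H (\<lambda>v.
       f (fst z \<circ> g \<circ> (u \<circ> inv (snd z) \<circ> v))))))"
    by (intro wsum_cong) (auto simp: wsum_ga_mult wsum_gdelta wsum_S_tw)
  also have "\<dots> = wsum J HH (\<lambda>a. wsum J HH (\<lambda>b. wsum x G (\<lambda>g. wsum U H (\<lambda>u. wsum U H (\<lambda>v.
       f (fst a \<circ> \<eta> \<circ> fst b \<circ> g \<circ> (u \<circ> inv (snd a \<circ> \<eta> \<circ> snd b) \<circ> v)))))))"
    by (simp add: wsum_Delta_tw wsum_gdelta[OF assms])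
  finally show ?thesis .
qed

end

section \<open>The twisted Hopf algebra\<close>

text \<open>The vectors \<open>b s\<close> are the images of the coordinate vectors under a linear
  projection onto V. They span V and reproduce its members from their own coordinates, which
  replaces any choice of basis.\<close>

lemma coordinate_projection:
  fixes V :: "('i \<Rightarrow> 'k::field) set"
  assumes "finite S"
    and "(\<lambda>_. 0) \<in> V" "\<And>x y. x \<in> V \<Longrightarrow> y \<in> V \<Longrightarrow> (\<lambda>i. x i + y i) \<in> V"
    and "\<And>c x. x \<in> V \<Longrightarrow> (\<lambda>i. c * x i) \<in> V"
    and "\<And>x i. x \<in> V \<Longrightarrow> i \<notin> S \<Longrightarrow> x i = 0"
  shows "\<exists>b. (\<forall>s. b s \<in> V) \<and> (\<forall>x\<in>V. \<forall>i. x i = (\<Sum>s\<in>S. x s * b s i))"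
  using assms
proof (induction S arbitrary: V rule: finite_induct)
  case empty
  then have "\<forall>x\<in>V. \<forall>i. x i = 0" by auto
  then show ?case using empty.prems(1) by (intro exI[of _ "\<lambda>_ _. 0"]) auto
next
  case (insert s S)
  define V0 where "V0 = {x \<in> V. x s = 0}"
  have "\<exists>b. (\<forall>s. b s \<in> V0) \<and> (\<forall>x\<in>V0. \<forall>i. x i = (\<Sum>s\<in>S. x s * b s i))"
  proof (rule insert.IH)
    show "x i = 0" if "x \<in> V0" "i \<notin> S" for x i
      using that insert.prems(4)[of x i] by (cases "i = s") (auto simp: V0_def)
  qed (use insert.prems in \<open>auto simp: V0_def\<close>)
  then obtain b where bV: "\<And>t. b t \<in> V0" and b: "\<And>x i. x \<in> V0 \<Longrightarrow> x i = (\<Sum>t\<in>S. x t * b t i)" by blast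
  have sumV: "(\<lambda>i. \<Sum>t\<in>T. c t * b t i) \<in> V" if "finite T" for T c
    using that
  proof induction
    case (insert t T)
    then show ?case using insert.prems assms bV
        insert.IH \<open>\<And>x y. x \<in> V \<Longrightarrow> y \<in> V \<Longrightarrow> (\<lambda>i. x i + y i) \<in> V\<close>[of "\<lambda>i. c t * b t i" "\<lambda>i. \<Sum>t\<in>T. c t * b t i"]
        \<open>\<And>c x. x \<in> V \<Longrightarrow> (\<lambda>i. c * x i) \<in> V\<close>[of "b t" "c t"] by (simp add: V0_def)
  qed (use insert.prems in simp)
  show ?case
  proof (cases "V0 = V")
    case True
    \<comment> \<open>All members of V vanish at s here, so the vector attached to s may be anything
      in V; zero is taken.\<close>
    define b' where "b' = b(s := \<lambda>_. 0)"
    have "x i = (\<Sum>t\<in>insert s S. x t * b' t i)" if "x \<in> V" for x i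
    proof -
      have "(\<Sum>t\<in>S. x t * b' t i) = (\<Sum>t\<in>S. x t * b t i)"
        by (rule sum.cong) (use insert.hyps in \<open>auto simp: b'_def\<close>)
      then show ?thesis using b[of x i] that True insert.hyps by (simp add: b'_def)
    qed
    then show ?thesis using bV insert.prems(1) by (intro exI[of _ b']) (auto simp: b'_def V0_def)
  next
    case False
    then obtain y where y: "y \<in> V" "y s \<noteq> 0" by (auto simp: V0_def)
    define x0 where "x0 = (\<lambda>i. inverse (y s) * y i)"
    have x0: "x0 \<in> V" "x0 s = 1" using y insert.prems(3) by (auto simp: x0_def)
    \<comment> \<open>For x in V the vector x - x(s) \<open>x0\<close> lies in \<open>V0\<close> and
      is reproduced by b. Collecting the coefficient of x(s) leaves \<open>x0\<close> minus its own
      expansion.\<close>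
    define b' where "b' = b(s := \<lambda>i. x0 i + (- 1) * (\<Sum>t\<in>S. x0 t * b t i))"
    have "b' t \<in> V" for t
      using bV insert.prems(2)[OF x0(1) insert.prems(3)[OF sumV[OF insert.hyps(1)], of "-1" x0]]
      by (auto simp: b'_def V0_def)
    moreover have "x i = (\<Sum>t\<in>insert s S. x t * b' t i)" if x: "x \<in> V" for x i
    proof -
      let ?y = "\<lambda>i. x i + (- x s) * x0 i"
      have "?y \<in> V" by (intro insert.prems x x0)
      then have "?y \<in> V0" using x0 by (simp add: V0_def)
      then have "?y i = (\<Sum>t\<in>S. ?y t * b t i)" by (rule b)
      then have "x i = x s * (x0 i - (\<Sum>t\<in>S. x0 t * b t i)) + (\<Sum>t\<in>S. x t * b t i)"
        by (simp add: algebra_simps sum.distrib sum_distrib_left sum_subtractf sum_negf)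
      also have "(\<Sum>t\<in>S. x t * b t i) = (\<Sum>t\<in>S. x t * b' t i)"
        by (rule sum.cong) (use insert.hyps in \<open>auto simp: b'_def\<close>)
      finally show ?thesis using insert.hyps by (simp add: b'_def)
    qed
    ultimately show ?thesis by blast
  qed
qed

context involutive_twist
begin

text \<open>Conjugating by this involution turns the twisted adjoint action into ordinary conjugation.\<close>

definition straighten :: "(perm \<Rightarrow> 'k) \<Rightarrow> perm \<Rightarrow> 'k" where
  "straighten x = (\<lambda>g. wsum J HH (\<lambda>a. wsum U H (\<lambda>u. x (fst a \<circ> g \<circ> (snd a \<circ> u)))))"

definition conj_by :: "perm \<Rightarrow> (perm \<Rightarrow> 'k) \<Rightarrow> perm \<Rightarrow> 'k" where
  "conj_by \<eta> x = (\<lambda>g. x (inv \<eta> \<circ> g \<circ> \<eta>))"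

lemma translate_in_G: "a \<in> G \<Longrightarrow> b \<in> G \<Longrightarrow> a \<circ> g \<circ> b \<in> G \<longleftrightarrow> g \<in> G"
proof
  assume ab: "a \<in> G" "b \<in> G" "a \<circ> g \<circ> b \<in> G"
  then have "inv a \<circ> (a \<circ> g \<circ> b) \<circ> inv b \<in> G" by (simp add: comp_in inv_in)
  then show "g \<in> G" using ab by (simp add: comp_assoc)
qed (simp add: comp_in)

lemma straighten_carrier [simp]: "x \<in> ga_carrier G \<Longrightarrow> straighten x \<in> ga_carrier G"
  unfolding ga_carrier_def straighten_def wsum_def
  by (auto simp: translate_in_G comp_in intro!: sum.neutral)

lemma conj_by_carrier [simp]: "x \<in> ga_carrier G \<Longrightarrow> \<eta> \<in> G \<Longrightarrow> conj_by \<eta> x \<in> ga_carrier G"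
  by (auto simp: ga_carrier_def conj_by_def translate_in_G inv_in)

lemma wsum_conj_by: "\<eta> \<in> G \<Longrightarrow> wsum (conj_by \<eta> x) G f = wsum x G (\<lambda>g. f (\<eta> \<circ> g \<circ> inv \<eta>))"
  using wsum_translate[of "inv \<eta>" \<eta> x f] by (simp add: conj_by_def inv_in)

lemma wsum_straighten: "wsum (straighten x) G f = wsum J HH (\<lambda>a. wsum U H (\<lambda>u. wsum x G (\<lambda>g. f (fst a \<circ> g \<circ> (snd a \<circ> u)))))"
proof -
  have "wsum (straighten x) G f = wsum J HH (\<lambda>a. wsum U H (\<lambda>u. wsum (\<lambda>g. x (fst a \<circ> g \<circ> (snd a \<circ> u))) G f))"
  proof -
    have "wsum (straighten x) G f = wsum f G (\<lambda>g. wsum J HH (\<lambda>a. wsum U H (\<lambda>u. x (fst a \<circ> g \<circ> (snd a \<circ> u)))))"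
      by (simp add: wsum_def straighten_def mult.commute)
    also have "\<dots> = wsum J HH (\<lambda>a. wsum U H (\<lambda>u. wsum f G (\<lambda>g. x (fst a \<circ> g \<circ> (snd a \<circ> u)))))"
      by (subst wsum_swap) (intro wsum_cong wsum_swap)
    finally show ?thesis by (simp add: wsum_def mult.commute)
  qed
  also have "\<dots> = wsum J HH (\<lambda>a. wsum U H (\<lambda>u. wsum x G (\<lambda>g. f (fst a \<circ> g \<circ> (snd a \<circ> u)))))"
    by (intro wsum_cong) (auto simp: wsum_translate comp_H)
  finally show ?thesis .
qed

text \<open>\<open>straighten x\<close> is J1 x J2 U, where J1 and J2 are the legs of J. Doing it
  twice yields J J and U U once the factors from H are commuted, and both squares are 1.\<close>

lemma straighten_straighten:
  assumes "x \<in> ga_carrier G" shows "straighten (straighten x) = x"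
proof (rule carrier_ext)
  fix f
  have "wsum (straighten (straighten x)) G f = wsum J HH (\<lambda>a. wsum U H (\<lambda>u. wsum J HH (\<lambda>b. wsum U H (\<lambda>v. wsum x G
     (\<lambda>g. f (fst a \<circ> (fst b \<circ> g \<circ> (snd b \<circ> v)) \<circ> (snd a \<circ> u)))))))"
    by (simp add: wsum_straighten)
  also have "\<dots> = wsum J HH (\<lambda>a. wsum J HH (\<lambda>b. wsum U H (\<lambda>u. wsum U H (\<lambda>v. wsum x G
     (\<lambda>g. f (fst a \<circ> (fst b \<circ> g \<circ> (snd b \<circ> v)) \<circ> (snd a \<circ> u)))))))"
    by (intro wsum_cong wsum_swap)
  also have "\<dots> = wsum J HH (\<lambda>a. wsum J HH (\<lambda>b. wsum U H (\<lambda>u. wsum U H (\<lambda>v. wsum x G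
     (\<lambda>g. f ((fst a \<circ> fst b) \<circ> g \<circ> (snd a \<circ> snd b) \<circ> (u \<circ> v)))))))"
    by (intro wsum_cong arg_cong[of _ _ f]) (auto simp: comp_assoc left_comm_H comm_H)
  also have "\<dots> = wsum J HH (\<lambda>a. wsum J HH (\<lambda>b. wsum x G
     (\<lambda>g. f ((fst a \<circ> fst b) \<circ> g \<circ> (snd a \<circ> snd b)))))"
    by (intro wsum_cong) (use U_square[of "\<lambda>w. wsum x G (\<lambda>g. f (p \<circ> g \<circ> q \<circ> w))" for p q] in simp)
  also have "\<dots> = wsum x G f"
    using J_square[of "\<lambda>p q. wsum x G (\<lambda>g. f (p \<circ> g \<circ> q))"] by simp
  finally show "wsum (straighten (straighten x)) G f = wsum x G f" .
qed (use assms in simp_all)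

text \<open>An element of H commutes with the legs of J and with U. This later yields stability of K
  itself under conjugation by H.\<close>

lemma straighten_conj_by_H:
  assumes "x \<in> ga_carrier G" "h \<in> H" shows "straighten (conj_by h x) = conj_by h (straighten x)"
  unfolding straighten_def conj_by_def
  by (rule ext, intro wsum_cong arg_cong[of _ _ x]) (use assms in \<open>auto simp: comp_assoc left_comm_H comm_H\<close>)

text \<open>Written out as words, with J from the coproduct and U from the antipode, the two sides
  differ only in the order of two neighbouring elements of H.\<close>

lemma ad_tw_eq:
  assumes "x \<in> ga_carrier G" "\<eta> \<in> G"
  shows "ad_tw G J (gdelta \<eta>) x = straighten (conj_by \<eta> (straighten x))"
proof (rule carrier_ext)
  show "ad_tw G J (gdelta \<eta>) x \<in> ga_carrier G"
    by (auto simp: ga_carrier_def ad_tw_def ga_mult_def)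
  fix f
  have "wsum (straighten (conj_by \<eta> (straighten x))) G f = wsum J HH (\<lambda>a. wsum U H (\<lambda>v. wsum J HH (\<lambda>b. wsum U H (\<lambda>u. wsum x G
     (\<lambda>g. f (fst a \<circ> (\<eta> \<circ> (fst b \<circ> g \<circ> (snd b \<circ> u)) \<circ> inv \<eta>) \<circ> (snd a \<circ> v)))))))"
    by (simp add: wsum_straighten wsum_conj_by assms)
  also have "\<dots> = wsum J HH (\<lambda>a. wsum J HH (\<lambda>b. wsum U H (\<lambda>v. wsum U H (\<lambda>u. wsum x G
     (\<lambda>g. f (fst a \<circ> (\<eta> \<circ> (fst b \<circ> g \<circ> (snd b \<circ> u)) \<circ> inv \<eta>) \<circ> (snd a \<circ> v)))))))"
    by (intro wsum_cong wsum_swap)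
  also have "\<dots> = wsum J HH (\<lambda>a. wsum J HH (\<lambda>b. wsum x G (\<lambda>g. wsum U H (\<lambda>u. wsum U H (\<lambda>v.
     f (fst a \<circ> (\<eta> \<circ> (fst b \<circ> g \<circ> (snd b \<circ> u)) \<circ> inv \<eta>) \<circ> (snd a \<circ> v)))))))"
    by (intro wsum_cong, subst wsum_swap, subst (2) wsum_swap, subst wsum_swap) (rule refl)
  also have "\<dots> = wsum (ad_tw G J (gdelta \<eta>) x) G f"
    unfolding wsum_ad_tw[OF assms(2)]
    by (intro wsum_cong arg_cong[of _ _ f])
      (use assms in \<open>auto simp: comp_assoc left_comm_H comm_H inv_comp comp_in inv_in\<close>)
  finally show "wsum (ad_tw G J (gdelta \<eta>) x) G f = wsum (straighten (conj_by \<eta> (straighten x))) G f" by simp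
qed (use assms in simp)

text \<open>The counit is unchanged by the twist, because applying it to one leg of J leaves
  1.\<close>

lemma wsum_Delta_tw_counit:
  "wsum (Delta_tw G J x) (G \<times> G) (\<lambda>z. f (fst z)) = wsum x G f"
  "wsum (Delta_tw G J x) (G \<times> G) (\<lambda>z. f (snd z)) = wsum x G f"
  unfolding wsum_Delta_tw
  by (simp_all add: J_counit[of "\<lambda>p. f (g \<circ> p)" for g] J_counit[of "\<lambda>p. wsum x G (\<lambda>g. f (p \<circ> g))"])

text \<open>Undoing the twist: \<open>\<Delta>(x) = J \<Delta>\<^sup>J(x) J\<close>.\<close>

lemma untwist_Delta:
  "wsum J HH (\<lambda>a. wsum (Delta_tw G J x) (G \<times> G) (\<lambda>z. wsum J HH (\<lambda>b.
     f (fst a \<circ> fst z \<circ> fst b) (snd a \<circ> snd z \<circ> snd b)))) = wsum x G (\<lambda>g. f g g)"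
proof -
  have "wsum J HH (\<lambda>a. wsum (Delta_tw G J x) (G \<times> G) (\<lambda>z. wsum J HH (\<lambda>b.
     f (fst a \<circ> fst z \<circ> fst b) (snd a \<circ> snd z \<circ> snd b)))) =
     wsum J HH (\<lambda>a. wsum J HH (\<lambda>a'. wsum x G (\<lambda>g. wsum J HH (\<lambda>b'. wsum J HH (\<lambda>b.
       f ((fst a \<circ> fst a') \<circ> g \<circ> (fst b' \<circ> fst b)) ((snd a \<circ> snd a') \<circ> g \<circ> (snd b' \<circ> snd b)))))))"
    by (simp add: wsum_Delta_tw comp_assoc)
  also have "\<dots> = wsum J HH (\<lambda>a. wsum J HH (\<lambda>a'. wsum x G (\<lambda>g.
       f ((fst a \<circ> fst a') \<circ> g) ((snd a \<circ> snd a') \<circ> g))))"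
    by (intro wsum_cong) (use J_square[of "\<lambda>p q. f (p' \<circ> p) (q' \<circ> q)" for p' q'] in simp)
  also have "\<dots> = wsum x G (\<lambda>g. f g g)"
    using J_square[of "\<lambda>p q. wsum x G (\<lambda>g. f (p \<circ> g) (q \<circ> g))"] by simp
  finally show ?thesis .
qed

text \<open>\<open>U_absorb\<close> with an extra first leg multiplied onto the second: on its
  right-hand side that leg then occurs twice and cancels. The identity removes the U factors of the
  twisted antipode.\<close>

lemma U_absorb_left: "wsum J HH (\<lambda>a. wsum U H (\<lambda>u. f (fst a) (u \<circ> snd a \<circ> fst a))) =
       wsum J HH (\<lambda>a. f (fst a) (snd a))"
proof -
  have "wsum J HH (\<lambda>a. wsum U H (\<lambda>u. f (fst a) (u \<circ> snd a \<circ> fst a))) =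
    wsum J HH (\<lambda>a. f (fst a) (fst a \<circ> snd a \<circ> fst a))"
    by (rule U_absorb[of "\<lambda>p q. f p (q \<circ> p)"])
  also have "\<dots> = wsum J HH (\<lambda>a. f (fst a) (snd a))"
    by (intro wsum_cong arg_cong[of _ _ "f _"]) (auto simp: comp_assoc comm_H invol_left)
  finally show ?thesis .
qed

text \<open>The coefficient \<open>\<lambda>(x) = x(id)\<close> is the Haar integral of the twisted Hopf algebra as well:
  \<open>\<lambda>(x\<^sub>1y) x\<^sub>2 = \<lambda>(x y\<^sub>1) S(y\<^sub>2)\<close>.\<close>

lemma haar_exchange:
  "wsum (Delta_tw G J x) (G \<times> G) (\<lambda>z. y (inv (fst z)) * f (snd z)) =
   wsum (Delta_tw G J y) (G \<times> G) (\<lambda>z. x (inv (fst z)) *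
      wsum U H (\<lambda>u. wsum U H (\<lambda>v. f (u \<circ> inv (snd z) \<circ> v))))"
proof -
  \<comment> \<open>The summand on the right-hand side after substituting g for the inverse of
    \<open>fst a \<circ> g \<circ> fst b\<close>, so that x instead of y carries the summation
    variable.\<close>
  let ?R = "\<lambda>a b g. x g * (y (inv (fst b \<circ> g \<circ> fst a)) * wsum U H (\<lambda>u. wsum U H (\<lambda>v. f (u \<circ> (snd b \<circ> fst b) \<circ> g \<circ> (fst a \<circ> snd a \<circ> v)))))"
  have "wsum (Delta_tw G J y) (G \<times> G) (\<lambda>z. x (inv (fst z)) *
      wsum U H (\<lambda>u. wsum U H (\<lambda>v. f (u \<circ> inv (snd z) \<circ> v)))) =
    wsum J HH (\<lambda>a. wsum J HH (\<lambda>b. wsum y G (\<lambda>g. x (inv (fst a \<circ> g \<circ> fst b)) *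
      wsum U H (\<lambda>u. wsum U H (\<lambda>v. f (u \<circ> inv (snd a \<circ> g \<circ> snd b) \<circ> v))))))"
    unfolding wsum_Delta_tw fst_conv snd_conv by (intro wsum_cong wsum_swap)
  also have "\<dots> = wsum J HH (\<lambda>a. wsum J HH (\<lambda>b. \<Sum>g\<in>G. ?R a b g))"
  proof (intro wsum_cong)
    fix a b assume ab: "a \<in> HH" "b \<in> HH"
    then have h: "fst a \<in> H" "snd a \<in> H" "fst b \<in> H" "snd b \<in> H" by auto
    show "wsum y G (\<lambda>g. x (inv (fst a \<circ> g \<circ> fst b)) *
      wsum U H (\<lambda>u. wsum U H (\<lambda>v. f (u \<circ> inv (snd a \<circ> g \<circ> snd b) \<circ> v)))) = (\<Sum>g\<in>G. ?R a b g)"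
      unfolding wsum_def[of y]
      by (rule sum.reindex_bij_witness[of _ "\<lambda>g. inv (fst b \<circ> g \<circ> fst a)" "\<lambda>g. inv (fst a \<circ> g \<circ> fst b)"])
        (use h in \<open>auto simp: comp_in inv_in inv_comp comp_assoc invol invol_left comm_H left_comm_H mult.left_commute\<close>)
  qed
  also have "\<dots> = wsum J HH (\<lambda>b. wsum x G (\<lambda>g. wsum J HH (\<lambda>a. y (inv (fst b \<circ> g \<circ> fst a)) * wsum U H (\<lambda>u. wsum U H (\<lambda>v. f (u \<circ> (snd b \<circ> fst b) \<circ> g \<circ> (fst a \<circ> snd a \<circ> v)))))))"
    unfolding wsum_def[of x, symmetric] by (subst wsum_swap) (intro wsum_cong wsum_swap)
  also have "\<dots> = wsum J HH (\<lambda>b. wsum x G (\<lambda>g. wsum U H (\<lambda>u. wsum J HH (\<lambda>a. wsum U H (\<lambda>v. y (inv (fst b \<circ> g \<circ> fst a)) * f (u \<circ> (snd b \<circ> fst b) \<circ> g \<circ> (v \<circ> snd a \<circ> fst a)))))))"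
    unfolding wsum_cmult[symmetric]
    by (intro wsum_cong, subst wsum_swap, intro wsum_cong arg_cong2[of _ _ _ _ "(*)"] refl arg_cong[of _ _ f])
      (auto simp: comp_assoc left_comm_H comm_H)
  \<comment> \<open>Each U of the antipode is absorbed by one copy of J: v by the copy indexed by a
    here, u by the copy indexed by b at the end.\<close>
  also have "\<dots> = wsum J HH (\<lambda>b. wsum x G (\<lambda>g. wsum U H (\<lambda>u. wsum J HH (\<lambda>a. y (inv (fst b \<circ> g \<circ> fst a)) * f (u \<circ> (snd b \<circ> fst b) \<circ> g \<circ> snd a)))))"
    by (intro wsum_cong U_absorb_left)
  also have "\<dots> = wsum J HH (\<lambda>b. wsum U H (\<lambda>u. wsum x G (\<lambda>g. wsum J HH (\<lambda>a. y (inv (fst b \<circ> g \<circ> fst a)) * f ((u \<circ> snd b \<circ> fst b) \<circ> g \<circ> snd a)))))"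
    by (subst (2) wsum_swap) (simp add: comp_assoc)
  also have "\<dots> = wsum J HH (\<lambda>b. wsum x G (\<lambda>g. wsum J HH (\<lambda>a. y (inv (fst b \<circ> g \<circ> fst a)) * f (snd b \<circ> g \<circ> snd a))))"
    by (rule U_absorb_left)
  finally show ?thesis by (simp add: wsum_Delta_tw)
qed

text \<open>This is x1 S(x2) = \<epsilon>(x) 1. Around g the inner legs of J multiply to U and
  cancel the U to their left; then g meets its inverse, and the outer legs cancel the remaining U in
  the same way.\<close>

lemma antipode_tw:
  "wsum (Delta_tw G J x) (G \<times> G) (\<lambda>z. wsum U H (\<lambda>u. wsum U H (\<lambda>v. f (fst z \<circ> (u \<circ> inv (snd z) \<circ> v)))))
    = wsum x G (\<lambda>_. f id)"
proof -
  have "wsum (Delta_tw G J x) (G \<times> G) (\<lambda>z. wsum U H (\<lambda>u. wsum U H (\<lambda>v. f (fst z \<circ> (u \<circ> inv (snd z) \<circ> v))))) =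
    wsum J HH (\<lambda>a. wsum x G (\<lambda>g. wsum U H (\<lambda>u. wsum J HH (\<lambda>b. wsum U H (\<lambda>v.
      f (fst a \<circ> g \<circ> (u \<circ> (fst b \<circ> snd b)) \<circ> inv g \<circ> (snd a \<circ> v)))))))"
    unfolding wsum_Delta_tw fst_conv snd_conv
    by (intro wsum_cong, subst wsum_swap, intro wsum_cong arg_cong[of _ _ f])
      (auto simp: comp_assoc left_comm_H comm_H inv_comp comp_in inv_in)
  also have "\<dots> = wsum J HH (\<lambda>a. wsum x G (\<lambda>g. wsum U H (\<lambda>v. f (fst a \<circ> (snd a \<circ> v)))))"
  proof (rule wsum_cong, rule wsum_cong)
    fix a g assume g: "g \<in> G"
    let ?F = "\<lambda>w. wsum U H (\<lambda>v. f (fst a \<circ> g \<circ> w \<circ> inv g \<circ> (snd a \<circ> v)))"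
    have "wsum U H (\<lambda>u. wsum J HH (\<lambda>b. ?F (u \<circ> (fst b \<circ> snd b)))) = wsum U H (\<lambda>u. wsum U H (\<lambda>w. ?F (u \<circ> w)))"
      by (simp add: wsum_U)
    also have "\<dots> = ?F id" by (rule U_square)
    finally show "wsum U H (\<lambda>u. wsum J HH (\<lambda>b. ?F (u \<circ> (fst b \<circ> snd b)))) = wsum U H (\<lambda>v. f (fst a \<circ> (snd a \<circ> v)))"
      using g by (simp add: comp_assoc)
  qed
  also have "\<dots> = wsum x G (\<lambda>g. wsum J HH (\<lambda>a. wsum U H (\<lambda>v. f (fst a \<circ> snd a \<circ> v))))"
    by (subst wsum_swap) (simp add: comp_assoc)
  also have "\<dots> = wsum x G (\<lambda>g. f id)"
    using U_square by (simp add: wsum_U[of "\<lambda>w. wsum U H (\<lambda>v. f (w \<circ> v))", symmetric])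
  finally show ?thesis .
qed

end

section \<open>Normal Hopf subalgebras and their invariant functions\<close>

definition (in finite_perm_group) invariant :: "(perm \<Rightarrow> 'a::field) set \<Rightarrow> (perm \<Rightarrow> 'a) \<Rightarrow> bool" where
  "invariant L f \<longleftrightarrow> (\<forall>x\<in>L. \<forall>a\<in>G. wsum x G (\<lambda>h. f (h \<circ> a)) = wsum x G (\<lambda>_. 1) * f a)"

lemma (in finite_perm_group) invariantD:
  "invariant L f \<Longrightarrow> x \<in> L \<Longrightarrow> a \<in> G \<Longrightarrow> wsum x G (\<lambda>h. f (h \<circ> a)) = wsum x G (\<lambda>_. 1) * f a"
  by (simp add: invariant_def)

lemma (in involutive_twist) wsum_U_const: "wsum U H (\<lambda>_. c) = c"
  by (simp add: wsum_U J_counit(1)[of "\<lambda>_. c"])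

text \<open>In p x q u a, with p and q the legs of J and u from U, moving p to the right of x costs
  only a conjugation by H, which L tolerates. Invariance then leaves f(p q u a), and p q sums to U,
  so U^2 = 1 finishes. Applied in both directions, K and its straightened copy have the same
  invariant functions.\<close>

lemma (in involutive_twist) invariant_straighten:
  assumes L: "\<And>x h. x \<in> L \<Longrightarrow> h \<in> H \<Longrightarrow> conj_by h x \<in> L" and f: "invariant L f"
  shows "invariant (straighten ` L) f"
  unfolding invariant_def
proof safe
  fix x a assume x: "x \<in> L" and a: "a \<in> G"
  have eps: "wsum (straighten x) G (\<lambda>_. 1) = wsum x G (\<lambda>_. 1)"
    by (simp add: wsum_straighten wsum_U_const) (simp add: J_counit(1)[of "\<lambda>_. wsum x G (\<lambda>_. 1)"])
  have "wsum (straighten x) G (\<lambda>h. f (h \<circ> a)) =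
    wsum J HH (\<lambda>z. wsum U H (\<lambda>u. wsum x G (\<lambda>g. f (fst z \<circ> g \<circ> (snd z \<circ> u) \<circ> a))))"
    by (simp add: wsum_straighten)
  also have "\<dots> = wsum J HH (\<lambda>z. wsum U H (\<lambda>u. wsum x G (\<lambda>_. 1) * f ((fst z \<circ> snd z) \<circ> u \<circ> a)))"
  proof (rule wsum_cong, rule wsum_cong)
    fix z u assume zu: "z \<in> HH" "u \<in> H"
    then have h: "fst z \<in> H" "snd z \<in> H" "u \<in> H" by auto
    have "wsum x G (\<lambda>g. f (fst z \<circ> g \<circ> (snd z \<circ> u) \<circ> a)) =
       wsum (conj_by (fst z) x) G (\<lambda>g. f (g \<circ> ((fst z \<circ> snd z) \<circ> u \<circ> a)))"
      using h by (simp add: wsum_conj_by comp_assoc invol_left)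
    also have "\<dots> = wsum (conj_by (fst z) x) G (\<lambda>_. 1) * f ((fst z \<circ> snd z) \<circ> u \<circ> a)"
      using f L[OF x h(1)] h a by (simp add: invariant_def comp_in)
    finally show "wsum x G (\<lambda>g. f (fst z \<circ> g \<circ> (snd z \<circ> u) \<circ> a)) =
        wsum x G (\<lambda>_. 1) * f ((fst z \<circ> snd z) \<circ> u \<circ> a)"
      using h by (simp add: wsum_conj_by)
  qed
  also have "\<dots> = wsum x G (\<lambda>_. 1) * wsum U H (\<lambda>w. wsum U H (\<lambda>u. f (w \<circ> u \<circ> a)))"
    by (simp add: wsum_cmult) (simp add: wsum_U[of "\<lambda>w. wsum U H (\<lambda>u. f (w \<circ> u \<circ> a))"])
  also have "wsum U H (\<lambda>w. wsum U H (\<lambda>u. f (w \<circ> u \<circ> a))) = f a"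
    using U_square[of "\<lambda>w. f (w \<circ> a)"] by simp
  finally show "wsum (straighten x) G (\<lambda>h. f (h \<circ> a)) = wsum (straighten x) G (\<lambda>_. 1) * f a" unfolding eps .
qed

locale normal_subalgebra = involutive_twist G H J
  for G H and J :: "perm \<times> perm \<Rightarrow> 'k::field_char_0" +
  fixes K :: "(perm \<Rightarrow> 'k) set"
  assumes normal: "normal_hopf_subalg_tw G J K"
begin

lemma K_carrier: "x \<in> K \<Longrightarrow> x \<in> ga_carrier G"
  and K_zero: "(\<lambda>_. 0) \<in> K"
  and K_add: "x \<in> K \<Longrightarrow> y \<in> K \<Longrightarrow> (\<lambda>g. x g + y g) \<in> K"
  and K_smult: "x \<in> K \<Longrightarrow> (\<lambda>g. c * x g) \<in> K"
  and K_one: "ga_one \<in> K"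
  and K_mult: "x \<in> K \<Longrightarrow> y \<in> K \<Longrightarrow> ga_mult G x y \<in> K"
  and K_Delta: "x \<in> K \<Longrightarrow> Delta_tw G J x \<in> tensor_span K"
  and K_S: "x \<in> K \<Longrightarrow> S_tw G J x \<in> K"
  and K_ad: "h \<in> ga_carrier G \<Longrightarrow> x \<in> K \<Longrightarrow> ad_tw G J h x \<in> K"
  using normal unfolding normal_hopf_subalg_tw_def hopf_subalg_tw_def ga_subspace_def ga_smult_def by auto

lemma K_outside: "x \<in> K \<Longrightarrow> g \<notin> G \<Longrightarrow> x g = 0"
  using K_carrier by (auto simp: ga_carrier_def)

lemma K_sum: "(\<And>i. i \<in> I \<Longrightarrow> x i \<in> K) \<Longrightarrow> (\<lambda>g. \<Sum>i\<in>I. c i * x i g) \<in> K"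
proof (induction I rule: infinite_finite_induct)
  case (insert i I)
  then show ?case using K_add[OF K_smult[of "x i" "c i"], of "\<lambda>g. \<Sum>i\<in>I. c i * x i g"] by simp
qed (simp_all add: K_zero)

text \<open>Fixing one argument of an element of K (x) K gives an element of K; these slices stand
  for the Sweedler legs of \<Delta>^J(x) from here on.\<close>

lemma slices_in_K:
  assumes "x \<in> K"
  shows "(\<lambda>s. Delta_tw G J x (s, t)) \<in> K" "(\<lambda>t. Delta_tw G J x (s, t)) \<in> K"
proof -
  obtain m :: nat and c y z where yz: "\<forall>i<m. y i \<in> K \<and> z i \<in> K"
    and F: "Delta_tw G J x = (\<lambda>p. \<Sum>i<m. c i * tensor (y i) (z i) p)"
    using K_Delta[OF assms] unfolding tensor_span_def by blast
  show "(\<lambda>s. Delta_tw G J x (s, t)) \<in> K"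
    using K_sum[of "{..<m}" y "\<lambda>i. c i * z i t"] yz by (simp add: F tensor_def mult_ac)
  show "(\<lambda>t. Delta_tw G J x (s, t)) \<in> K"
    using K_sum[of "{..<m}" z "\<lambda>i. c i * y i s"] yz by (simp add: F tensor_def mult_ac)
qed

text \<open>By \<open>ad_tw_eq\<close>, normality of K becomes stability under ordinary conjugation
  by all of G once K is transported through the involution.\<close>

lemma conj_by_in_straighten_K:
  assumes "y \<in> straighten ` K" "\<eta> \<in> G" shows "conj_by \<eta> y \<in> straighten ` K"
proof -
  obtain x where x: "x \<in> K" "y = straighten x" using assms by blast
  have "gdelta \<eta> \<in> ga_carrier G" using assms by (auto simp: gdelta_def ga_carrier_def)
  then have "straighten (conj_by \<eta> y) \<in> K"
    using ad_tw_eq[OF K_carrier[OF x(1)] assms(2)] K_ad x by metis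
  then have "straighten (straighten (conj_by \<eta> y)) \<in> straighten ` K" by (rule imageI)
  then show ?thesis using x assms by (simp add: straighten_straighten K_carrier)
qed

lemma straighten_straighten_image: "straighten ` straighten ` K = K"
  using straighten_straighten K_carrier by (force simp: image_image)

text \<open>For H the conjugation can be carried back to K, since \<open>straighten\<close> commutes
  with it.\<close>

lemma conj_by_H_in_K:
  assumes "x \<in> K" "h \<in> H" shows "conj_by h x \<in> K"
proof -
  have "conj_by h (straighten x) \<in> straighten ` K" using assms by (intro conj_by_in_straighten_K) auto
  then have "straighten (conj_by h (straighten x)) \<in> straighten ` straighten ` K" by (rule imageI)
  then show ?thesis using assms by (simp add: straighten_straighten_image straighten_conj_by_H straighten_straighten K_carrier)
qed

text \<open>On the straightened copy of K left translation by h is harmless, because y can be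
  replaced by its conjugate under h. The invariant functions of that copy are those of K.\<close>

lemma invariant_left:
  assumes f: "invariant K f" and h: "h \<in> G"
  shows "invariant K (\<lambda>g. f (h \<circ> g))"
proof -
  have 1: "invariant (straighten ` K) f" using f by (intro invariant_straighten conj_by_H_in_K)
  have "invariant (straighten ` K) (\<lambda>g. f (h \<circ> g))"
    unfolding invariant_def
  proof (intro ballI)
    fix y a assume y: "y \<in> straighten ` K" and a: "a \<in> G"
    have "wsum y G (\<lambda>g. f (h \<circ> (g \<circ> a))) = wsum (conj_by h y) G (\<lambda>g. f (g \<circ> (h \<circ> a)))"
      using h by (simp add: wsum_conj_by comp_assoc)
    also have "\<dots> = wsum (conj_by h y) G (\<lambda>_. 1) * f (h \<circ> a)"
      by (intro invariantD[OF 1] conj_by_in_straighten_K y comp_in h a)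
    finally show "wsum y G (\<lambda>g. f (h \<circ> (g \<circ> a))) = wsum y G (\<lambda>_. 1) * f (h \<circ> a)"
      using h by (simp add: wsum_conj_by)
  qed
  moreover have "conj_by p y \<in> straighten ` K" if "y \<in> straighten ` K" "p \<in> H" for y p
    by (rule conj_by_in_straighten_K[OF that(1) H_in_G[OF that(2)]])
  ultimately have "invariant (straighten ` straighten ` K) (\<lambda>g. f (h \<circ> g))"
    by (intro invariant_straighten[of "straighten ` K"])
  then show ?thesis by (simp add: straighten_straighten_image)
qed

lemma invariant_right: "invariant K f \<Longrightarrow> b \<in> G \<Longrightarrow> invariant K (\<lambda>g. f (g \<circ> b))"
  by (simp add: invariant_def comp_assoc comp_in)

lemma invariant_const: "invariant K (\<lambda>_. c)"
  unfolding invariant_def using wsum_const by blast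

lemma invariant_add: "invariant K f \<Longrightarrow> invariant K f' \<Longrightarrow> invariant K (\<lambda>g. f g + f' g)"
  by (simp add: invariant_def wsum_add distrib_left)

text \<open>A product of functions is evaluated through the untwisted coproduct \<Delta>(x) = J
  \<Delta>^J(x) J, whose inner legs lie in K. The factors of J outside them are absorbed into
  translates of f and f', and J^2 = 1 removes them at the end.\<close>

lemma invariant_mult:
  assumes f: "invariant K f" and f': "invariant K f'"
  shows "invariant K (\<lambda>g. f g * f' g)"
  unfolding invariant_def
proof (intro ballI)
  fix x a assume x: "x \<in> K" and a: "a \<in> G"
  let ?D = "Delta_tw G J x"
  \<comment> \<open>The factor p stands to the left of the element of K, so this is where stability
    under left translation is needed.\<close>
  have inv: "wsum y G (\<lambda>g. f0 (p \<circ> g \<circ> q \<circ> a)) = wsum y G (\<lambda>_. 1) * f0 (p \<circ> q \<circ> a)"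
    if "y \<in> K" "p \<in> H" "q \<in> H" "invariant K f0" for y p q f0
    using invariant_left[OF that(4), of p] that a
    unfolding invariant_def by (force simp: comp_assoc comp_in)
  have step: "wsum ?D (G \<times> G) (\<lambda>z. f (p \<circ> fst z \<circ> r \<circ> a) * f' (q \<circ> snd z \<circ> s \<circ> a)) =
      wsum x G (\<lambda>_. 1) * (f (p \<circ> r \<circ> a) * f' (q \<circ> s \<circ> a))"
    if h: "p \<in> H" "q \<in> H" "r \<in> H" "s \<in> H" for p q r s
  proof -
    have "wsum ?D (G \<times> G) (\<lambda>z. f (p \<circ> fst z \<circ> r \<circ> a) * f' (q \<circ> snd z \<circ> s \<circ> a)) =
      (\<Sum>b\<in>G. wsum (\<lambda>c. ?D (b, c)) G (\<lambda>c. f' (q \<circ> c \<circ> s \<circ> a)) * f (p \<circ> b \<circ> r \<circ> a))"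
      by (simp add: wsum_Times(1) wsum_cmult mult.commute)
    also have "\<dots> = (\<Sum>b\<in>G. wsum (\<lambda>c. ?D (b, c)) G (\<lambda>_. 1) * f' (q \<circ> s \<circ> a) * f (p \<circ> b \<circ> r \<circ> a))"
      using inv[OF slices_in_K(2)[OF x] h(2,4) f'] by simp
    also have "\<dots> = wsum ?D (G \<times> G) (\<lambda>z. f (p \<circ> fst z \<circ> r \<circ> a) * f' (q \<circ> s \<circ> a))"
      by (simp add: wsum_Times(1)) (simp add: wsum_def sum_distrib_right sum_distrib_left mult_ac)
    also have "\<dots> = (\<Sum>c\<in>G. wsum (\<lambda>b. ?D (b, c)) G (\<lambda>b. f (p \<circ> b \<circ> r \<circ> a)) * f' (q \<circ> s \<circ> a))"
      by (simp add: wsum_Times(2) wsum_multc sum_distrib_right)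
    also have "\<dots> = (\<Sum>c\<in>G. wsum (\<lambda>b. ?D (b, c)) G (\<lambda>_. 1) * f (p \<circ> r \<circ> a) * f' (q \<circ> s \<circ> a))"
      using inv[OF slices_in_K(1)[OF x] h(1,3) f] by simp
    also have "\<dots> = wsum ?D (G \<times> G) (\<lambda>z. f (p \<circ> r \<circ> a) * f' (q \<circ> s \<circ> a))"
      by (simp add: wsum_Times(2)) (simp add: wsum_def sum_distrib_right sum_distrib_left mult_ac)
    also have "\<dots> = wsum x G (\<lambda>_. 1) * (f (p \<circ> r \<circ> a) * f' (q \<circ> s \<circ> a))"
      by (subst wsum_Delta_tw_counit(1)[of x "\<lambda>_. f (p \<circ> r \<circ> a) * f' (q \<circ> s \<circ> a)"]) (rule wsum_const)
    finally show ?thesis .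
  qed
  have "wsum x G (\<lambda>g. f (g \<circ> a) * f' (g \<circ> a)) =
    wsum J HH (\<lambda>p. wsum ?D (G \<times> G) (\<lambda>z. wsum J HH (\<lambda>q.
     f (fst p \<circ> fst z \<circ> fst q \<circ> a) * f' (snd p \<circ> snd z \<circ> snd q \<circ> a))))"
    using untwist_Delta[of x "\<lambda>b c. f (b \<circ> a) * f' (c \<circ> a)"] by simp
  also have "\<dots> = wsum J HH (\<lambda>p. wsum J HH (\<lambda>q. wsum ?D (G \<times> G) (\<lambda>z.
     f (fst p \<circ> fst z \<circ> fst q \<circ> a) * f' (snd p \<circ> snd z \<circ> snd q \<circ> a))))"
    by (intro wsum_cong wsum_swap)
  also have "\<dots> = wsum J HH (\<lambda>p. wsum J HH (\<lambda>q. wsum x G (\<lambda>_. 1) *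
     (f (fst p \<circ> fst q \<circ> a) * f' (snd p \<circ> snd q \<circ> a))))"
    by (rule wsum_cong, rule wsum_cong, rule step) auto
  also have "\<dots> = wsum x G (\<lambda>_. 1) * (f a * f' a)"
    using J_square[of "\<lambda>p q. wsum x G (\<lambda>_. 1) * (f (p \<circ> a) * f' (q \<circ> a))"] by simp
  finally show "wsum x G (\<lambda>g. f (g \<circ> a) * f' (g \<circ> a)) = wsum x G (\<lambda>_. 1) * (f a * f' a)" .
qed

lemma form_commute: "wsum x G (\<lambda>g. y (inv g)) = wsum y G (\<lambda>g. x (inv g))"
  unfolding wsum_def by (subst sum_inv[symmetric]) (simp add: mult.commute)

section \<open>The Haar form on K and the integral of K\<close>

definition rad :: "(perm \<Rightarrow> 'k) set" where
  "rad = {x \<in> K. \<forall>k\<in>K. wsum x G (\<lambda>g. k (inv g)) = 0}"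

lemma wsum_slice:
  assumes "t \<in> G"
  shows "wsum F (G \<times> G) (\<lambda>z. f (fst z) * (if snd z = t then 1 else 0)) = wsum (\<lambda>s. F (s, t)) G f"
proof -
  have "wsum F (G \<times> G) (\<lambda>z. f (fst z) * (if snd z = t then 1 else 0)) =
    (\<Sum>b\<in>G. if b = t then wsum (\<lambda>s. F (s, t)) G f else 0)"
    unfolding wsum_Times(2) by (intro sum.cong) (auto simp: wsum_def)
  then show ?thesis using assms finite_G by simp
qed

text \<open>By \<open>haar_exchange\<close>, pairing the first leg of \<Delta>^J(x) with y in K can
  be computed by pairing x with the first leg of \<Delta>^J(y). That leg lies in K, so x in the
  radical gives 0.\<close>

lemma rad_slice:
  assumes x: "x \<in> rad" and t: "t \<in> G"
  shows "(\<lambda>s. Delta_tw G J x (s, t)) \<in> rad"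
proof -
  have xK: "x \<in> K" using x by (simp add: rad_def)
  have "wsum (\<lambda>s. Delta_tw G J x (s, t)) G (\<lambda>s. y (inv s)) = 0" if y: "y \<in> K" for y
  proof -
    have "wsum (\<lambda>s. Delta_tw G J x (s, t)) G (\<lambda>s. y (inv s)) =
      wsum (Delta_tw G J y) (G \<times> G) (\<lambda>z. x (inv (fst z)) *
      wsum U H (\<lambda>u. wsum U H (\<lambda>v. if u \<circ> inv (snd z) \<circ> v = t then 1 else 0)))"
      using haar_exchange[of x y "\<lambda>s. if s = t then 1 else 0"] wsum_slice[OF t, of "Delta_tw G J x" "\<lambda>s. y (inv s)"]
      by simp
    also have "\<dots> = (\<Sum>b\<in>G. wsum (\<lambda>s. Delta_tw G J y (s, b)) G (\<lambda>s. x (inv s)) *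
       wsum U H (\<lambda>u. wsum U H (\<lambda>v. if u \<circ> inv b \<circ> v = t then 1 else 0)))"
      by (simp add: wsum_Times(2) wsum_multc)
    also have "\<dots> = 0"
      using x slices_in_K(1)[OF y] unfolding form_commute[of _ x]
      by (auto simp: rad_def intro!: sum.neutral)
    finally show ?thesis .
  qed
  then show ?thesis using slices_in_K(1)[OF xK] by (simp add: rad_def)
qed

lemma K_coordinates:
  "\<exists>b. (\<forall>t. b t \<in> K) \<and> (\<forall>x\<in>K. \<forall>i. x i = (\<Sum>t\<in>G. x t * b t i))"
  by (rule coordinate_projection[where S = G and V = K])
    (simp_all add: finite_G K_zero K_add K_smult K_outside)

text \<open>\<epsilon>(x) is the coefficient of x1 S(x2) at the identity, that is, the form applied
  to x1 and S(x2). The first legs are in the radical and S maps K to K.\<close>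

lemma rad_eps:
  assumes x: "x \<in> rad" shows "wsum x G (\<lambda>_. 1) = 0"
proof -
  obtain b where b: "\<And>t. b t \<in> K" "\<And>x i. x \<in> K \<Longrightarrow> x i = (\<Sum>t\<in>G. x t * b t i)"
    using K_coordinates by blast
  have xK: "x \<in> K" using x by (simp add: rad_def)
  let ?D = "Delta_tw G J x"
  let ?P = "\<lambda>s t. wsum U H (\<lambda>u. wsum U H (\<lambda>v. if s \<circ> (u \<circ> inv t \<circ> v) = id then 1 else 0))"
  have "wsum x G (\<lambda>_. 1) = wsum ?D (G \<times> G) (\<lambda>z. ?P (fst z) (snd z))"
    using antipode_tw[of x "\<lambda>g. if g = id then 1 else 0"] by simp
  \<comment> \<open>Second legs lie in K and are expanded in the vectors b, which writes
    \<Delta>^J(x) as the sum over t' of the first-leg slice at t' tensored with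
    \<open>b t'\<close>.\<close>
  also have "\<dots> = (\<Sum>s\<in>G. \<Sum>t\<in>G. \<Sum>t'\<in>G. ?D (s, t') * b t' t * ?P s t)"
    unfolding wsum_Times(1) wsum_def[of _ G]
    by (intro sum.cong refl, subst b(2)[OF slices_in_K(2)[OF xK]])
      (simp only: sum_distrib_right fst_conv snd_conv)
  also have "\<dots> = (\<Sum>s\<in>G. \<Sum>t'\<in>G. \<Sum>t\<in>G. ?D (s, t') * b t' t * ?P s t)"
    by (intro sum.cong sum.swap refl)
  also have "\<dots> = (\<Sum>t'\<in>G. \<Sum>s\<in>G. \<Sum>t\<in>G. ?D (s, t') * b t' t * ?P s t)"
    by (rule sum.swap)
  also have "\<dots> = (\<Sum>t'\<in>G. wsum (\<lambda>s. ?D (s, t')) G (\<lambda>s. wsum (b t') G (\<lambda>t. ?P s t)))"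
    by (simp add: wsum_def[of _ G] sum_distrib_left mult.assoc)
  also have "\<dots> = 0"
  proof (rule sum.neutral, rule)
    fix t' assume t': "t' \<in> G"
    let ?z = "\<lambda>s. ?D (s, t')"
    have z: "?z \<in> rad" by (rule rad_slice[OF x t'])
    have ind: "wsum ?z G (\<lambda>s. if s \<circ> w = id then 1 else 0) = ?z (inv w)" if "w \<in> G" for w
    proof -
      have "(s \<circ> w = id) = (s = inv w)" if "s \<in> G" for s
      proof
        assume "s \<circ> w = id"
        then have "s \<circ> w \<circ> inv w = inv w" by simp
        then show "s = inv w" using \<open>w \<in> G\<close> by (simp add: comp_assoc)
      qed (use \<open>w \<in> G\<close> in simp)
      then have "wsum ?z G (\<lambda>s. if s \<circ> w = id then 1 else 0) = wsum ?z G (\<lambda>s. if s = inv w then 1 else 0)"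
        by (intro wsum_cong) simp
      then show ?thesis using that by (simp add: wsum_indicator finite_G inv_in)
    qed
    have "wsum ?z G (\<lambda>s. wsum (b t') G (\<lambda>t. ?P s t)) =
      wsum (b t') G (\<lambda>t. wsum U H (\<lambda>u. wsum U H (\<lambda>v. wsum ?z G (\<lambda>s. if s \<circ> (u \<circ> inv t \<circ> v) = id then 1 else 0))))"
      by (subst wsum_swap, rule wsum_cong, subst wsum_swap, rule wsum_cong, rule wsum_swap)
    also have "\<dots> = wsum (b t') G (\<lambda>t. wsum U H (\<lambda>u. wsum U H (\<lambda>v. ?z (inv (u \<circ> inv t \<circ> v)))))"
      by (rule wsum_cong, rule wsum_cong, rule wsum_cong, rule ind) (simp add: comp_in inv_in)
    also have "\<dots> = wsum (S_tw G J (b t')) G (\<lambda>r. ?z (inv r))"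
      unfolding wsum_S_tw by (rule wsum_swap)
    also have "\<dots> = 0"
      using z K_S[OF b(1)] unfolding form_commute[of _ ?z] by (auto simp: rad_def)
    finally show "wsum ?z G (\<lambda>s. wsum (b t') G (\<lambda>t. ?P s t)) = 0" .
  qed
  finally show ?thesis .
qed

text \<open>The coefficient of x at t is \<epsilon> of the first-leg slice at t, and that slice is
  again in the radical.\<close>

lemma rad_zero:
  assumes x: "x \<in> rad" shows "x = (\<lambda>_. 0)"
proof
  have xK: "x \<in> K" using x by (simp add: rad_def)
  fix t show "x t = 0"
  proof (cases "t \<in> G")
    case True
    have "x t = wsum (Delta_tw G J x) (G \<times> G) (\<lambda>z. if snd z = t then 1 else 0)"
      by (simp add: wsum_Delta_tw_counit(2)[of x "\<lambda>s. if s = t then 1 else 0"] wsum_indicator finite_G True)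
    also have "\<dots> = 0"
      using wsum_slice[OF True, of "Delta_tw G J x" "\<lambda>_. 1"] rad_eps[OF rad_slice[OF x True]] by simp
    finally show ?thesis .
  qed (use K_outside[OF xK] in simp)
qed

text \<open>The counit of K must be represented by the form. For this it suffices that the counit
  vanishes on the radical, which is \<open>rad_eps\<close>.\<close>

lemma integral_exists:
  obtains e where "e \<in> K" "\<And>k. k \<in> K \<Longrightarrow> wsum e G (\<lambda>g. k (inv g)) = wsum k G (\<lambda>_. 1)"
proof -
  obtain b where b: "\<And>t. b t \<in> K" "\<And>x i. x \<in> K \<Longrightarrow> x i = (\<Sum>t\<in>G. x t * b t i)"
    using K_coordinates by blast
  \<comment> \<open>\<open>ev k\<close> lists the values of the form at k and the spanning vectors
    b, and \<epsilon> lists their counits. An integral is a k in K with \<open>ev k\<close> equal to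
    \<epsilon>.\<close>
  define ev where "ev k = (\<lambda>t. if t \<in> G then wsum k G (\<lambda>g. b t (inv g)) else 0)" for k
  define \<epsilon> where "\<epsilon> = (\<lambda>t. if t \<in> G then wsum (b t) G (\<lambda>_. 1) else 0)"
  have lin: "ev (\<lambda>g. \<Sum>i\<in>I. c i * k i g) t = (\<Sum>i\<in>I. c i * ev (k i) t)"
    for I :: "perm set" and c k t
    unfolding ev_def wsum_def
    by (simp add: sum_distrib_right sum_distrib_left sum.swap[of _ I] mult.assoc)
  have lin2: "ev (\<lambda>g. k g + l g) t = ev k t + ev l t" "ev (\<lambda>g. c * k g) t = c * ev k t" for k l c t
    unfolding ev_def wsum_def by (simp_all add: sum.distrib algebra_simps sum_distrib_left)
  have "\<exists>d. (\<forall>s. d s \<in> ev ` K) \<and> (\<forall>v\<in>ev ` K. \<forall>i. v i = (\<Sum>s\<in>G. v s * d s i))"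
  proof (rule coordinate_projection[OF finite_G])
    show "(\<lambda>_. 0) \<in> ev ` K" by (rule image_eqI[OF _ K_zero]) (simp add: ev_def wsum_def fun_eq_iff)
    show "(\<lambda>i. v i + w i) \<in> ev ` K" if "v \<in> ev ` K" "w \<in> ev ` K" for v w
    proof -
      from that obtain k l where "k \<in> K" "l \<in> K" "v = ev k" "w = ev l" by blast
      then show ?thesis by (intro image_eqI[OF _ K_add[of k l]]) (auto simp: lin2)
    qed
    show "(\<lambda>i. c * v i) \<in> ev ` K" if "v \<in> ev ` K" for v c
    proof -
      from that obtain k where "k \<in> K" "v = ev k" by blast
      then show ?thesis by (intro image_eqI[OF _ K_smult[of k c]]) (auto simp: lin2)
    qed
  qed (auto simp: ev_def)
  then obtain d where dK: "\<And>s. d s \<in> ev ` K" and d: "\<And>v i. v \<in> ev ` K \<Longrightarrow> v i = (\<Sum>s\<in>G. v s * d s i)"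
    by blast
  \<comment> \<open>The vectors d project onto the image of \<open>ev\<close>; being reproduced by d
    means that \<epsilon> lies in this image.\<close>
  have \<epsilon>: "\<epsilon> i = (\<Sum>s\<in>G. \<epsilon> s * d s i)" for i
  proof (cases "i \<in> G")
    case True
    \<comment> \<open>The defect of \<open>b i\<close> from its projected expansion pairs to zero
      with every k, because d reproduces \<open>ev k\<close>; so it is in the radical and its counit
      vanishes.\<close>
    define x where "x = (\<lambda>g. b i g + (- 1) * (\<Sum>s\<in>G. d s i * b s g))"
    have xK: "x \<in> K" unfolding x_def by (intro K_add K_smult K_sum b)
    have val: "wsum x G f = wsum (b i) G f - (\<Sum>s\<in>G. d s i * wsum (b s) G f)" for f
    proof -
      have "wsum x G f = wsum (b i) G f - (\<Sum>g\<in>G. \<Sum>s\<in>G. d s i * (b s g * f g))"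
        unfolding x_def wsum_lin by (simp add: wsum_def sum_distrib_right mult.assoc)
      also have "(\<Sum>g\<in>G. \<Sum>s\<in>G. d s i * (b s g * f g)) = (\<Sum>s\<in>G. d s i * wsum (b s) G f)"
        by (subst sum.swap) (simp add: wsum_def sum_distrib_left)
      finally show ?thesis .
    qed
    have "x \<in> rad"
      unfolding rad_def
    proof (intro CollectI conjI ballI xK)
      fix k assume k: "k \<in> K"
      have *: "wsum (b s) G (\<lambda>g. k (inv g)) = ev k s" if "s \<in> G" for s
        using that by (simp add: ev_def form_commute[of "b s"])
      show "wsum x G (\<lambda>g. k (inv g)) = 0"
        using d[of "ev k" i] k True unfolding val by (simp add: * mult.commute)
    qed
    then have "wsum x G (\<lambda>_. 1) = 0" by (rule rad_eps)
    then show ?thesis using True unfolding val \<epsilon>_def by (simp add: mult.commute)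
  next
    case False
    have "d s i = 0" for s using dK[of s] False by (auto simp: ev_def)
    then show ?thesis using False by (simp add: \<epsilon>_def)
  qed
  obtain k where k: "\<And>s. k s \<in> K" "\<And>s. d s = ev (k s)"
    using dK unfolding image_iff by metis
  define e where "e = (\<lambda>g. \<Sum>s\<in>G. \<epsilon> s * k s g)"
  have eK: "e \<in> K" unfolding e_def by (intro K_sum k)
  have ev_e: "ev e t = \<epsilon> t" for t
    unfolding e_def lin using \<epsilon>[of t] by (simp add: k(2))
  have "wsum e G (\<lambda>g. x (inv g)) = wsum x G (\<lambda>_. 1)" if x: "x \<in> K" for x
  proof -
    have "wsum e G (\<lambda>g. x (inv g)) = wsum e G (\<lambda>g. \<Sum>t\<in>G. x t * b t (inv g))"
      using b(2)[OF x] by (intro wsum_cong) blast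
    also have "\<dots> = (\<Sum>t\<in>G. x t * \<epsilon> t)"
      unfolding wsum_sum
    proof (rule sum.cong[OF refl])
      fix t assume "t \<in> G"
      then show "x t * wsum e G (\<lambda>g. b t (inv g)) = x t * \<epsilon> t" using ev_e[of t] by (simp add: ev_def)
    qed
    also have "\<dots> = (\<Sum>t\<in>G. \<Sum>g\<in>G. x t * b t g)"
      by (simp add: \<epsilon>_def wsum_def sum_distrib_left)
    also have "\<dots> = (\<Sum>g\<in>G. \<Sum>t\<in>G. x t * b t g)" by (rule sum.swap)
    also have "\<dots> = wsum x G (\<lambda>_. 1)" by (simp only: wsum_def b(2)[OF x, symmetric] mult_1_right)
    finally show ?thesis .
  qed
  then show ?thesis using eK that by blast
qed

text \<open>The form is associative, so ex and \<epsilon>(x) e have the same pairing with every k in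
  K, and nondegeneracy gives ex = \<epsilon>(x) e. Reading off the coefficient at the inverse of a
  is the invariance.\<close>

lemma integral_invariant:
  assumes e: "e \<in> K" "\<And>k. k \<in> K \<Longrightarrow> wsum e G (\<lambda>g. k (inv g)) = wsum k G (\<lambda>_. 1)"
  shows "invariant K (\<lambda>g. e (inv g))"
  unfolding invariant_def
proof (intro ballI)
  fix x a assume x: "x \<in> K" and a: "a \<in> G"
  let ?\<epsilon> = "wsum x G (\<lambda>_. 1)"
  define y where "y = (\<lambda>g. ga_mult G e x g + (- ?\<epsilon>) * e g)"
  have yK: "y \<in> K" unfolding y_def by (intro K_add K_smult K_mult e x)
  have "y \<in> rad"
    unfolding rad_def
  proof (intro CollectI conjI ballI yK)
    fix k assume k: "k \<in> K"
    have "wsum (ga_mult G e x) G (\<lambda>g. k (inv g)) = wsum e G (\<lambda>g. ga_mult G x k (inv g))"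
      unfolding wsum_ga_mult
      by (intro wsum_cong) (simp add: ga_mult_def inv_in inv_comp wsum_def)
    also have "\<dots> = wsum (ga_mult G x k) G (\<lambda>_. 1)" by (intro e K_mult x k)
    also have "\<dots> = ?\<epsilon> * wsum k G (\<lambda>_. 1)" by (simp add: wsum_ga_mult wsum_const[symmetric])
    finally have "wsum (ga_mult G e x) G (\<lambda>g. k (inv g)) = ?\<epsilon> * wsum e G (\<lambda>g. k (inv g))"
      by (simp add: e(2)[OF k])
    then show "wsum y G (\<lambda>g. k (inv g)) = 0"
      unfolding y_def wsum_lin by simp
  qed
  then have "y (inv a) = 0" using rad_zero by (simp add: fun_eq_iff)
  then have "ga_mult G e x (inv a) = ?\<epsilon> * e (inv a)" by (simp add: y_def)
  moreover have "ga_mult G e x (inv a) = wsum x G (\<lambda>h. e (inv (h \<circ> a)))"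
    using a unfolding ga_mult_def wsum_def
    by (auto simp: inv_in intro!: sum.reindex_bij_witness[of _ "\<lambda>h. inv (h \<circ> a)" "\<lambda>h. inv h \<circ> inv a"])
      (auto simp: inv_in comp_in inv_comp comp_assoc mult.commute)
  ultimately show "wsum x G (\<lambda>h. e (inv (h \<circ> a))) = ?\<epsilon> * e (inv a)" by simp
qed

end

section \<open>Normal subgroups of symmetric groups\<close>

lemma transpose_conj: "bij g \<Longrightarrow> g \<circ> transpose a b \<circ> inv g = transpose (g a) (g b)"
proof -
  assume g: "bij g"
  have "transpose (g a) (g b) \<circ> g = g \<circ> transpose a b"
    using transpose_comp_eq[OF g, of "g a" "g b"] g by (simp add: bij_is_inj)
  then have "g \<circ> transpose a b \<circ> inv g = transpose (g a) (g b) \<circ> (g \<circ> inv g)"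
    by (simp only: comp_assoc[symmetric])
  then show ?thesis using g by (simp add: surj_iff[THEN iffD1, OF bij_is_surj])
qed

lemma ex_permutes_triple:
  assumes "p \<in> S" "q \<in> S" "r \<in> S" "a \<in> S" "b \<in> S" "c \<in> S"
    and "p \<noteq> q" "p \<noteq> r" "q \<noteq> r" "a \<noteq> b" "a \<noteq> c" "b \<noteq> c"
  obtains g where "g permutes S" "g p = a" "g q = b" "g r = c"
proof -
  define g1 where "g1 = transpose p a"
  define g2 where "g2 = transpose (g1 q) b"
  define g3 where "g3 = transpose (g2 (g1 r)) c"
  have 1: "g1 permutes S" unfolding g1_def using assms by (intro permutes_swap_id)
  have "g1 q \<in> S" using 1 assms by (simp add: permutes_in_image)
  then have 2: "g2 permutes S" unfolding g2_def using assms by (intro permutes_swap_id)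
  have "g2 (g1 r) \<in> S" using 1 2 assms by (simp add: permutes_in_image)
  then have 3: "g3 permutes S" unfolding g3_def using assms by (intro permutes_swap_id)
  have inj: "inj g1" "inj g2" using 1 2 by (auto intro: permutes_inj)
  have "g1 p = a" by (simp add: g1_def)
  then have "g1 q \<noteq> a" "g1 r \<noteq> a" using inj(1) assms by (metis injD)+
  then have a2: "g2 a = a" using assms by (simp add: g2_def)
  have b2: "g2 (g1 q) = b" by (simp add: g2_def)
  have "g2 (g1 r) \<noteq> a" "g2 (g1 r) \<noteq> b"
    using a2 b2 \<open>g1 r \<noteq> a\<close> inj assms by (metis injD)+
  then have "g3 a = a" "g3 b = b" using assms by (simp_all add: g3_def)
  then show ?thesis
    using that[of "g3 \<circ> (g2 \<circ> g1)"] 1 2 3 \<open>g1 p = a\<close> a2 b2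
    by (simp add: permutes_compose g3_def)
qed

text \<open>A commutator of \<sigma> with a transposition leads to one 3-cycle in N. Conjugation
  gives all 3-cycles, hence all products of two transpositions.\<close>

lemma normal_subgroup_contains_even:
  fixes S :: "nat set"
  assumes S: "finite S" "card S \<ge> 5"
    and N: "N \<subseteq> {p. p permutes S}" "id \<in> N"
    and comp: "\<And>x y. x \<in> N \<Longrightarrow> y \<in> N \<Longrightarrow> x \<circ> y \<in> N"
    and inv: "\<And>x. x \<in> N \<Longrightarrow> inv x \<in> N"
    and conj: "\<And>x g. x \<in> N \<Longrightarrow> g permutes S \<Longrightarrow> g \<circ> x \<circ> inv g \<in> N"
    and nontriv: "\<sigma> \<in> N" "\<sigma> \<noteq> id"
    and p: "p permutes S" "sign p = 1"
  shows "p \<in> N"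
proof -
  have fresh: "\<exists>x\<in>S. x \<notin> T" if "finite T" "card T \<le> 4" for T
  proof (rule ccontr)
    assume "\<not> (\<exists>x\<in>S. x \<notin> T)"
    then have "S \<subseteq> T" by blast
    then have "card S \<le> card T" using that(1) by (rule card_mono[rotated])
    then show False using that S by simp
  qed
  have card4: "card {a, b, c, d :: nat} \<le> 4" for a b c d
    by (rule order.trans[OF card_insert_le_m1]) (auto intro!: order.trans[OF card_insert_le_m1])
  have perm_tr: "transpose a b permutes S" if "a \<in> S" "b \<in> S" for a b
    using that by (rule permutes_swap_id)
  have \<sigma>: "\<sigma> permutes S" using nontriv N by blast
  have "\<exists>q r s. q \<in> S \<and> r \<in> S \<and> s \<in> S \<and> q \<noteq> r \<and> q \<noteq> s \<and> r \<noteq> s \<and> transpose q r \<circ> transpose r s \<in> N"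
  proof -
    obtain a where a: "\<sigma> a \<noteq> a" using nontriv(2) by (auto simp: fun_eq_iff)
    define b where "b = \<sigma> a"
    have aS: "a \<in> S" using a \<sigma> by (meson permutes_not_in)
    have bS: "b \<in> S" using aS \<sigma> by (simp add: b_def permutes_in_image)
    \<comment> \<open>Excluding a, b and the preimage of a makes d = \<sigma>(c) differ from both a
      and b. The repeated a only fills up a four-element list.\<close>
    obtain c where c: "c \<in> S" "c \<noteq> a" "c \<noteq> b" "c \<noteq> inv \<sigma> a"
      using fresh[of "{a, b, inv \<sigma> a, a}"] card4[of a b "inv \<sigma> a" a] by auto
    define d where "d = \<sigma> c"
    have dS: "d \<in> S" using c \<sigma> by (simp add: d_def permutes_in_image)
    have "d \<noteq> a" using c(4) \<sigma> permutes_inverses(2)[OF \<sigma>, of c] by (auto simp: d_def)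
    have "d \<noteq> b" using c(2) permutes_inj[OF \<sigma>] by (auto simp: d_def b_def dest: injD)
    \<comment> \<open>The commutator of \<sigma> and (a c); conjugating (a c) by \<sigma> gives (b
      d), so the commutator is (b d)(a c).\<close>
    have "\<sigma> \<circ> (transpose a c \<circ> inv \<sigma> \<circ> inv (transpose a c)) \<in> N"
      using nontriv aS c perm_tr by (intro comp conj inv)
    moreover have "\<sigma> \<circ> (transpose a c \<circ> inv \<sigma> \<circ> inv (transpose a c)) =
        (\<sigma> \<circ> transpose a c \<circ> inv \<sigma>) \<circ> transpose a c"
      by (simp add: comp_assoc)
    ultimately have bd: "transpose b d \<circ> transpose a c \<in> N"
      using transpose_conj[OF permutes_bij[OF \<sigma>]] by (simp add: b_def d_def)
    show ?thesis
    proof (cases "d = c")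
      case True
      then have "transpose b c \<circ> transpose c a \<in> N" using bd by (simp add: transpose_commute)
      then show ?thesis using aS bS c a b_def by (intro exI[of _ b] exI[of _ c] exI[of _ a]) auto
    next
      case False
      \<comment> \<open>A fifth point is required: conjugating (b d)(a c) by (c x) and dividing by
        the original removes (b d) and leaves a 3-cycle.\<close>
      obtain x where x: "x \<in> S" "x \<noteq> a" "x \<noteq> b" "x \<noteq> c" "x \<noteq> d"
        using fresh[of "{a, b, c, d}"] card4[of a b c d] by auto
      have "transpose c x \<circ> (transpose b d \<circ> transpose a c) \<circ> inv (transpose c x) \<in> N"
        using bd c x perm_tr by (intro conj)
      then have "inv (transpose b d \<circ> transpose a c) \<circ>
          (transpose c x \<circ> (transpose b d \<circ> transpose a c) \<circ> inv (transpose c x)) \<in> N"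
        by (rule comp[OF inv[OF bd]])
      moreover have "inv (transpose b d \<circ> transpose a c) \<circ>
          (transpose c x \<circ> (transpose b d \<circ> transpose a c) \<circ> inv (transpose c x)) =
          transpose c a \<circ> transpose a x"
      proof -
        have "inv (transpose b d \<circ> transpose a c) = transpose a c \<circ> transpose b d"
          by (simp add: o_inv_distrib)
        then show ?thesis
          using x c \<open>d \<noteq> a\<close> \<open>d \<noteq> b\<close> False a b_def
          by (simp add: fun_eq_iff) (auto simp: transpose_def)
      qed
      ultimately show ?thesis using aS c x by (intro exI[of _ c] exI[of _ a] exI[of _ x]) auto
    qed
  qed
  then obtain q r s where qrs: "q \<in> S" "r \<in> S" "s \<in> S" "q \<noteq> r" "q \<noteq> s" "r \<noteq> s"
    "transpose q r \<circ> transpose r s \<in> N" by blast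
  have cyc: "transpose a b \<circ> transpose b c \<in> N"
    if abc: "a \<in> S" "b \<in> S" "c \<in> S" "a \<noteq> b" "a \<noteq> c" "b \<noteq> c" for a b c
  proof -
    obtain g where g: "g permutes S" "g q = a" "g r = b" "g s = c"
      using ex_permutes_triple[OF qrs(1-3) abc(1-3) qrs(4-6) abc(4-6)] .
    have "g \<circ> (transpose q r \<circ> transpose r s) \<circ> inv g \<in> N" by (rule conj[OF qrs(7) g(1)])
    moreover have "g \<circ> (transpose q r \<circ> transpose r s) \<circ> inv g =
      (g \<circ> transpose q r \<circ> inv g) \<circ> (g \<circ> transpose r s \<circ> inv g)"
      using permutes_inv_o(2)[OF g(1)] by (simp add: fun_eq_iff)
    ultimately show ?thesis using transpose_conj[OF permutes_bij[OF g(1)]] g by simp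
  qed
  have share: "transpose a b \<circ> transpose b c \<in> N"
    if "a \<in> S" "b \<in> S" "c \<in> S" "a \<noteq> b" "b \<noteq> c" for a b c
    using that cyc[of a b c] N(2) by (cases "a = c") (auto simp: transpose_commute[of b c])
  have pair: "transpose a b \<circ> transpose c d \<in> N"
    if abcd: "a \<in> S" "b \<in> S" "c \<in> S" "d \<in> S" "a \<noteq> b" "c \<noteq> d" for a b c d
  proof (cases "b = c")
    case True
    then show ?thesis using share abcd by simp
  next
    case False
    have "(transpose a b \<circ> transpose b c) \<circ> (transpose b c \<circ> transpose c d) \<in> N"
      by (rule comp[OF share share]) (use abcd False in auto)
    moreover have "(transpose a b \<circ> transpose b c) \<circ> (transpose b c \<circ> transpose c d) =
      transpose a b \<circ> transpose c d"
      by (simp add: fun_eq_iff)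
    ultimately show ?thesis by simp
  qed
  obtain u v where uv: "u \<in> S" "v \<in> S" "u \<noteq> v" using qrs by blast
  \<comment> \<open>Odd permutations are corrected by the fixed transposition (u v), so that the
    claim survives multiplication by a single transposition.\<close>
  have "if sign p = 1 then p \<in> N else transpose u v \<circ> p \<in> N"
    using p(1) S(1)
  proof (induction rule: permutes_induct)
    case (swap a b p)
    have perm: "permutation p" using swap S(1) by (auto simp: permutation_permutes)
    have sgn: "sign (transpose a b \<circ> p) = - sign p"
      using swap perm by (simp add: sign_compose permutation_swap_id sign_swap_id)
    show ?case
    proof (cases p rule: sign_cases)
      case even
      then have "(transpose u v \<circ> transpose a b) \<circ> p \<in> N"
        using swap uv by (intro comp[OF pair]) auto
      then show ?thesis unfolding sgn even by (simp add: comp_assoc)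
    next
      case odd
      then have "(transpose a b \<circ> transpose u v) \<circ> (transpose u v \<circ> p) \<in> N"
        using swap uv by (intro comp[OF pair]) auto
      moreover have "(transpose a b \<circ> transpose u v) \<circ> (transpose u v \<circ> p) = transpose a b \<circ> p"
        by (simp add: fun_eq_iff)
      ultimately have "transpose a b \<circ> p \<in> N" by (simp only:)
      then show ?thesis unfolding sgn odd by simp
    qed
  qed (simp add: N)
  then show ?thesis using p by simp
qed

section \<open>Bicharacter twists of elementary abelian 2-groups\<close>

locale bicharacter_twist = finite_perm_group G for G +
  fixes H :: "perm set" and \<omega> :: "(perm \<Rightarrow> 'k::field_char_0) \<Rightarrow> (perm \<Rightarrow> 'k) \<Rightarrow> 'k"
  assumes H_sub: "H \<subseteq> G" and id_H: "id \<in> H"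
    and comp_H: "g \<in> H \<Longrightarrow> h \<in> H \<Longrightarrow> g \<circ> h \<in> H"
    and invol: "h \<in> H \<Longrightarrow> h \<circ> h = id"
    and bichar: "bicharacter H \<omega>"
    and separating: "h \<in> H \<Longrightarrow> h \<noteq> id \<Longrightarrow> \<exists>\<chi>::perm \<Rightarrow> 'k. \<chi> \<in> characters H \<and> \<chi> h \<noteq> 1"
begin

abbreviation "X \<equiv> characters H :: (perm \<Rightarrow> 'k) set"
abbreviation "J \<equiv> twist_J H \<omega>"
abbreviation "HH \<equiv> H \<times> H"

definition triv :: "perm \<Rightarrow> 'k" where "triv = (\<lambda>h. if h \<in> H then 1 else 0)"

lemma finite_H: "finite H" using H_sub finite_G finite_subset by blast

lemma inv_H: "h \<in> H \<Longrightarrow> inv h = h"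
  using invol by (intro inv_unique_comp) auto

lemma char_comp: "\<chi> \<in> X \<Longrightarrow> g \<in> H \<Longrightarrow> h \<in> H \<Longrightarrow> \<chi> (g \<circ> h) = \<chi> g * \<chi> h"
  and char_id: "\<chi> \<in> X \<Longrightarrow> \<chi> id = 1"
  and char_outside: "\<chi> \<in> X \<Longrightarrow> g \<notin> H \<Longrightarrow> \<chi> g = 0"
  by (simp_all add: characters_def)

lemma char_square: "\<chi> \<in> X \<Longrightarrow> h \<in> H \<Longrightarrow> \<chi> h * \<chi> h = 1"
  using char_comp[of \<chi> h h] by (simp add: invol char_id)

lemma triv_char: "triv \<in> X"
  by (simp add: triv_def characters_def id_H comp_H)

lemma char_mult_char: "\<alpha> \<in> X \<Longrightarrow> \<beta> \<in> X \<Longrightarrow> char_mult \<alpha> \<beta> \<in> X"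
  by (simp add: characters_def char_mult_def)

lemma char_mult_self: "\<alpha> \<in> X \<Longrightarrow> char_mult \<alpha> \<alpha> = triv"
  by (auto simp: fun_eq_iff char_mult_def triv_def char_square char_outside)

lemma char_mult_triv: "\<alpha> \<in> X \<Longrightarrow> char_mult \<alpha> triv = \<alpha>"
  by (auto simp: fun_eq_iff char_mult_def triv_def char_outside)

lemma char_mult_assoc: "char_mult (char_mult \<alpha> \<beta>) \<gamma> = char_mult \<alpha> (char_mult \<beta> \<gamma>)"
  by (simp add: char_mult_def mult.assoc)

lemma char_mult_commute: "char_mult \<alpha> \<beta> = char_mult \<beta> \<alpha>"
  by (simp add: char_mult_def mult.commute)

lemma char_mult_cancel: "\<alpha> \<in> X \<Longrightarrow> \<beta> \<in> X \<Longrightarrow> char_mult \<alpha> (char_mult \<alpha> \<beta>) = \<beta>"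
  by (simp add: char_mult_assoc[symmetric] char_mult_self char_mult_commute[of triv] char_mult_triv)

lemma char_pm1: "\<chi> \<in> X \<Longrightarrow> h \<in> H \<Longrightarrow> \<chi> h = 1 \<or> \<chi> h = - 1"
  using char_square[of \<chi> h] by (simp add: square_eq_1_iff)

text \<open>Values are 1 or -1, so a character is determined by its kernel, a subset of H.\<close>

lemma finite_X: "finite X"
proof (rule finite_imageD)
  show "finite ((\<lambda>\<chi>. {h \<in> H. \<chi> h = 1}) ` X)"
    by (rule finite_subset[of _ "Pow H"], rule image_subsetI) (simp_all add: finite_H)
  show "inj_on (\<lambda>\<chi>. {h \<in> H. \<chi> h = 1}) X"
  proof (rule inj_onI, rule ext)
    fix \<alpha> \<beta> h assume a: "\<alpha> \<in> X" "\<beta> \<in> X" "{h \<in> H. \<alpha> h = 1} = {h \<in> H. \<beta> h = 1}"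
    show "\<alpha> h = \<beta> h"
    proof (cases "h \<in> H")
      case True
      then have "\<alpha> h = 1 \<longleftrightarrow> \<beta> h = 1" using arg_cong[OF a(3), of "\<lambda>A. h \<in> A"] by simp
      then show ?thesis using char_pm1[OF a(1) True] char_pm1[OF a(2) True] by auto
    qed (simp add: char_outside a)
  qed
qed

lemma sum_char:
  assumes "\<chi> \<in> X" shows "(\<Sum>h\<in>H. \<chi> h) = (if \<chi> = triv then of_nat (card H) else 0)"
proof (cases "\<chi> = triv")
  case True
  then have "(\<Sum>h\<in>H. \<chi> h) = (\<Sum>h\<in>H. 1)" by (intro sum.cong) (auto simp: triv_def)
  then show ?thesis using True by simp
next
  case False
  have "\<exists>g\<in>H. \<chi> g \<noteq> 1"
  proof (rule ccontr)
    assume "\<not> (\<exists>g\<in>H. \<chi> g \<noteq> 1)"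
    then have "\<chi> g = triv g" for g using char_outside[OF assms, of g] by (cases "g \<in> H") (auto simp: triv_def)
    then show False using False by (simp add: fun_eq_iff)
  qed
  then obtain g where g: "g \<in> H" "\<chi> g \<noteq> 1" by blast
  have "(\<Sum>h\<in>H. \<chi> h) = (\<Sum>h\<in>H. \<chi> (g \<circ> h))"
    by (rule sum.reindex_bij_witness[of _ "\<lambda>h. g \<circ> h" "\<lambda>h. g \<circ> h"])
      (use g in \<open>simp_all add: comp_H comp_assoc[symmetric] invol\<close>)
  also have "\<dots> = \<chi> g * (\<Sum>h\<in>H. \<chi> h)" using g by (simp add: char_comp[OF assms] sum_distrib_left)
  finally show ?thesis using g False by simp
qed

lemma sum_characters:
  assumes h: "h \<in> H" shows "(\<Sum>\<chi>\<in>X. \<chi> h) = (if h = id then of_nat (card H) else 0)"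
proof -
  have ort: "(\<Sum>\<chi>\<in>X. \<chi> h) = (if h = id then of_nat (card X) else 0)" if h: "h \<in> H" for h
  proof (cases "h = id")
    case True
    then show ?thesis by (simp add: char_id)
  next
    case False
    then obtain \<alpha> where \<alpha>: "\<alpha> \<in> X" "\<alpha> h \<noteq> 1" using separating h by blast
    have "(\<Sum>\<chi>\<in>X. \<chi> h) = (\<Sum>\<chi>\<in>X. char_mult \<alpha> \<chi> h)"
      by (rule sum.reindex_bij_witness[of _ "char_mult \<alpha>" "char_mult \<alpha>"])
        (use \<alpha> in \<open>simp_all add: char_mult_char char_mult_cancel\<close>)
    also have "\<dots> = \<alpha> h * (\<Sum>\<chi>\<in>X. \<chi> h)" by (simp add: char_mult_def sum_distrib_left)
    finally show ?thesis using \<alpha> False by simp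
  qed
  \<comment> \<open>Orthogonality gives the value at the identity as the number of characters.
    Summing over all pairs in both orders shows that this number is the order of H.\<close>
  have "(of_nat (card X) :: 'k) = (\<Sum>h\<in>H. \<Sum>\<chi>\<in>X. \<chi> h)"
    using finite_H id_H by (simp add: ort)
  also have "\<dots> = (\<Sum>\<chi>\<in>X. \<Sum>h\<in>H. \<chi> h)" by (rule sum.swap)
  also have "\<dots> = of_nat (card H)" using finite_X triv_char by (simp add: sum_char)
  finally show ?thesis using ort[OF h] by simp
qed

lemma card_H_nz: "(of_nat (card H) :: 'k) \<noteq> 0"
  using finite_H id_H by auto

lemma fourier_expand:
  fixes f :: "perm \<Rightarrow> 'k"
  assumes h: "h \<in> H"
  shows "f h = (\<Sum>\<chi>\<in>X. ((\<Sum>k\<in>H. f k * \<chi> k) / of_nat (card H)) * \<chi> h)"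
proof -
  have "(\<Sum>\<chi>\<in>X. ((\<Sum>k\<in>H. f k * \<chi> k) / of_nat (card H)) * \<chi> h) =
     (\<Sum>\<chi>\<in>X. \<Sum>k\<in>H. f k / of_nat (card H) * \<chi> (k \<circ> h))"
    unfolding sum_divide_distrib sum_distrib_right
  proof (intro sum.cong refl)
    fix \<chi> k assume "\<chi> \<in> X" "k \<in> H"
    then show "f k * \<chi> k / of_nat (card H) * \<chi> h = f k / of_nat (card H) * \<chi> (k \<circ> h)"
      using char_comp[of \<chi> k h] h by (simp only: mult.assoc times_divide_eq_left times_divide_eq_right)
  qed
  also have "\<dots> = (\<Sum>k\<in>H. \<Sum>\<chi>\<in>X. f k / of_nat (card H) * \<chi> (k \<circ> h))" by (rule sum.swap)
  also have "\<dots> = (\<Sum>k\<in>H. if k = h then f h else 0)"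
  proof (rule sum.cong[OF refl])
    fix k assume k: "k \<in> H"
    have "k \<circ> h = id \<longleftrightarrow> k = h"
    proof
      assume "k \<circ> h = id"
      then have "k \<circ> h \<circ> h = h" by simp
      then show "k = h" using h by (simp add: comp_assoc invol)
    qed (use invol h in simp)
    then show "(\<Sum>\<chi>\<in>X. f k / of_nat (card H) * \<chi> (k \<circ> h)) = (if k = h then f h else 0)"
      unfolding sum_distrib_left[symmetric] using sum_characters[OF comp_H[OF k h]] card_H_nz by simp
  qed
  finally show ?thesis using h finite_H by simp
qed

lemma fourier_expand2:
  fixes f :: "perm \<Rightarrow> perm \<Rightarrow> 'k"
  shows "\<exists>c. \<forall>p\<in>H. \<forall>q\<in>H. f p q = (\<Sum>z\<in>X \<times> X. c z * (fst z p * snd z q))"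
proof -
  let ?n = "of_nat (card H) :: 'k"
  define d where "d \<alpha> q = (\<Sum>k\<in>H. f k q * \<alpha> k) / ?n" for \<alpha> q
  define c where "c z = (\<Sum>l\<in>H. d (fst z) l * snd z l) / ?n" for z
  have "f p q = (\<Sum>z\<in>X \<times> X. c z * (fst z p * snd z q))" if "p \<in> H" "q \<in> H" for p q
  proof -
    have "f p q = (\<Sum>\<alpha>\<in>X. d \<alpha> q * \<alpha> p)"
      unfolding d_def by (rule fourier_expand[OF that(1), of "\<lambda>p. f p q"])
    also have "\<dots> = (\<Sum>\<alpha>\<in>X. (\<Sum>\<beta>\<in>X. c (\<alpha>, \<beta>) * \<beta> q) * \<alpha> p)"
      unfolding c_def using fourier_expand[OF that(2), of "d _"] by simp
    also have "\<dots> = (\<Sum>\<alpha>\<in>X. \<Sum>\<beta>\<in>X. c (\<alpha>, \<beta>) * (\<alpha> p * \<beta> q))"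
      by (simp add: sum_distrib_left sum_distrib_right mult_ac)
    finally show ?thesis by (simp add: sum.cartesian_product case_prod_unfold)
  qed
  then show ?thesis by (intro exI[of _ c] ballI)
qed

text \<open>Products of two characters span the functions on H x H, so linear functionals depending
  only on values there are compared on such products.\<close>

lemma char_ext:
  fixes L L' :: "(perm \<Rightarrow> perm \<Rightarrow> 'k) \<Rightarrow> 'k"
  assumes lin: "\<And>c F. L (\<lambda>p q. \<Sum>z\<in>X \<times> X. c z * F z p q) = (\<Sum>z\<in>X \<times> X. c z * L (F z))"
      "\<And>c F. L' (\<lambda>p q. \<Sum>z\<in>X \<times> X. c z * F z p q) = (\<Sum>z\<in>X \<times> X. c z * L' (F z))"
    and local: "\<And>f f'. (\<And>p q. p \<in> H \<Longrightarrow> q \<in> H \<Longrightarrow> f p q = f' p q) \<Longrightarrow> L f = L f'"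
      "\<And>f f'. (\<And>p q. p \<in> H \<Longrightarrow> q \<in> H \<Longrightarrow> f p q = f' p q) \<Longrightarrow> L' f = L' f'"
    and eq: "\<And>\<alpha> \<beta>. \<alpha> \<in> X \<Longrightarrow> \<beta> \<in> X \<Longrightarrow> L (\<lambda>p q. \<alpha> p * \<beta> q) = L' (\<lambda>p q. \<alpha> p * \<beta> q)"
  shows "L f = L' f"
proof -
  obtain c where c0: "\<forall>p\<in>H. \<forall>q\<in>H. f p q = (\<Sum>z\<in>X \<times> X. c z * (fst z p * snd z q))"
    using fourier_expand2[of f] by (rule exE)
  have c: "f p q = (\<Sum>z\<in>X \<times> X. c z * (fst z p * snd z q))" if "p \<in> H" "q \<in> H" for p q
    by (rule c0[THEN bspec, THEN bspec, OF that])
  have "L f = L (\<lambda>p q. \<Sum>z\<in>X \<times> X. c z * (fst z p * snd z q))" by (rule local(1)) (rule c)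
  also have "\<dots> = (\<Sum>z\<in>X \<times> X. c z * L (\<lambda>p q. fst z p * snd z q))" by (rule lin(1))
  also have "\<dots> = (\<Sum>z\<in>X \<times> X. c z * L' (\<lambda>p q. fst z p * snd z q))"
    by (intro sum.cong refl) (auto simp: eq)
  also have "\<dots> = L' (\<lambda>p q. \<Sum>z\<in>X \<times> X. c z * (fst z p * snd z q))" by (rule lin(2)[symmetric])
  also have "\<dots> = L' f" by (rule local(2)) (rule c[symmetric])
  finally show ?thesis .
qed

lemma \<omega>_mult: "\<alpha> \<in> X \<Longrightarrow> \<beta> \<in> X \<Longrightarrow> \<gamma> \<in> X \<Longrightarrow> \<omega> (char_mult \<alpha> \<beta>) \<gamma> = \<omega> \<alpha> \<gamma> * \<omega> \<beta> \<gamma>"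
    "\<alpha> \<in> X \<Longrightarrow> \<beta> \<in> X \<Longrightarrow> \<gamma> \<in> X \<Longrightarrow> \<omega> \<alpha> (char_mult \<beta> \<gamma>) = \<omega> \<alpha> \<beta> * \<omega> \<alpha> \<gamma>"
  and \<omega>_nz: "\<alpha> \<in> X \<Longrightarrow> \<beta> \<in> X \<Longrightarrow> \<omega> \<alpha> \<beta> \<noteq> 0"
  using bichar unfolding bicharacter_def by blast+

lemma \<omega>_triv: "\<alpha> \<in> X \<Longrightarrow> \<omega> triv \<alpha> = 1" "\<alpha> \<in> X \<Longrightarrow> \<omega> \<alpha> triv = 1"
  using \<omega>_mult(1)[of triv triv \<alpha>] \<omega>_mult(2)[of \<alpha> triv triv] \<omega>_nz[of triv \<alpha>] \<omega>_nz[of \<alpha> triv]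
  by (auto simp: triv_char char_mult_triv)

lemma \<omega>_square: "\<alpha> \<in> X \<Longrightarrow> \<beta> \<in> X \<Longrightarrow> \<omega> \<alpha> \<beta> * \<omega> \<alpha> \<beta> = 1"
  using \<omega>_mult(1)[of \<alpha> \<alpha> \<beta>] by (simp add: char_mult_self \<omega>_triv)

lemma J_outside: "z \<notin> HH \<Longrightarrow> J z = 0"
  by (cases z) (auto simp: twist_J_def tensor_def idem_def)

text \<open>The idempotents in J are dual to the characters, so evaluating a pair of characters on J
  selects one value of \<omega>.\<close>

lemma wsum_J_char:
  assumes "\<alpha> \<in> X" "\<beta> \<in> X"
  shows "wsum J HH (\<lambda>a. \<alpha> (fst a) * \<beta> (snd a)) = \<omega> \<alpha> \<beta>"
proof -
  have idem: "(\<Sum>p\<in>H. idem H \<alpha>' p * \<alpha> p) = (if \<alpha>' = \<alpha> then 1 else 0)" if "\<alpha>' \<in> X" "\<alpha> \<in> X" for \<alpha>' \<alpha> :: "perm \<Rightarrow> 'k"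
  proof -
    have "(\<Sum>p\<in>H. idem H \<alpha>' p * \<alpha> p) = (\<Sum>p\<in>H. char_mult \<alpha>' \<alpha> p) / of_nat (card H)"
      by (simp add: idem_def inv_H char_mult_def sum_divide_distrib)
    moreover have "char_mult \<alpha>' \<alpha> = triv \<longleftrightarrow> \<alpha>' = \<alpha>"
      using char_mult_cancel[of \<alpha> \<alpha>'] that
      by (auto simp: char_mult_commute[of \<alpha>' \<alpha>] char_mult_self char_mult_triv)
    ultimately show ?thesis using sum_char[OF char_mult_char[OF that]] card_H_nz by simp
  qed
  have "wsum J HH (\<lambda>a. \<alpha> (fst a) * \<beta> (snd a)) = (\<Sum>p\<in>H. \<Sum>q\<in>H. \<Sum>\<alpha>'\<in>X. \<Sum>\<beta>'\<in>X.
      \<omega> \<alpha>' \<beta>' * ((idem H \<alpha>' p * \<alpha> p) * (idem H \<beta>' q * \<beta> q)))"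
    unfolding wsum_Times(1) wsum_def[of _ H]
  proof (intro sum.cong refl)
    fix p q
    show "J (p, q) * (\<alpha> (fst (p, q)) * \<beta> (snd (p, q))) = (\<Sum>\<alpha>'\<in>X. \<Sum>\<beta>'\<in>X.
      \<omega> \<alpha>' \<beta>' * ((idem H \<alpha>' p * \<alpha> p) * (idem H \<beta>' q * \<beta> q)))"
      unfolding twist_J_def sum_distrib_right by (intro sum.cong refl) (simp add: tensor_def mult_ac)
  qed
  also have "\<dots> = (\<Sum>\<alpha>'\<in>X. \<Sum>\<beta>'\<in>X. \<Sum>p\<in>H. \<Sum>q\<in>H.
      \<omega> \<alpha>' \<beta>' * ((idem H \<alpha>' p * \<alpha> p) * (idem H \<beta>' q * \<beta> q)))"
    by (simp only: sum.swap[of _ X H])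
  also have "\<dots> = (\<Sum>\<alpha>'\<in>X. \<Sum>\<beta>'\<in>X. \<omega> \<alpha>' \<beta>' * ((if \<alpha>' = \<alpha> then 1 else 0) * (if \<beta>' = \<beta> then 1 else 0)))"
  proof (intro sum.cong refl)
    fix \<alpha>' \<beta>' assume "\<alpha>' \<in> X" "\<beta>' \<in> X"
    moreover have "(\<Sum>p\<in>H. \<Sum>q\<in>H. \<omega> \<alpha>' \<beta>' * ((idem H \<alpha>' p * \<alpha> p) * (idem H \<beta>' q * \<beta> q))) =
       \<omega> \<alpha>' \<beta>' * ((\<Sum>p\<in>H. idem H \<alpha>' p * \<alpha> p) * (\<Sum>q\<in>H. idem H \<beta>' q * \<beta> q))"
      unfolding sum_product by (simp only: sum_distrib_left)
    ultimately show "(\<Sum>p\<in>H. \<Sum>q\<in>H. \<omega> \<alpha>' \<beta>' * ((idem H \<alpha>' p * \<alpha> p) * (idem H \<beta>' q * \<beta> q))) =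
       \<omega> \<alpha>' \<beta>' * ((if \<alpha>' = \<alpha> then 1 else 0) * (if \<beta>' = \<beta> then 1 else 0))"
      by (simp only: idem assms)
  qed
  also have "\<dots> = (\<Sum>\<alpha>'\<in>X. if \<alpha>' = \<alpha> then \<omega> \<alpha> \<beta> else 0)"
  proof (intro sum.cong refl)
    fix \<alpha>' 
    have "(\<Sum>\<beta>'\<in>X. \<omega> \<alpha>' \<beta>' * ((if \<alpha>' = \<alpha> then 1 else 0) * (if \<beta>' = \<beta> then 1 else 0))) =
      (\<Sum>\<beta>'\<in>X. if \<beta>' = \<beta> then (if \<alpha>' = \<alpha> then \<omega> \<alpha> \<beta> else 0) else 0)"
      by (intro sum.cong) auto
    then show "(\<Sum>\<beta>'\<in>X. \<omega> \<alpha>' \<beta>' * ((if \<alpha>' = \<alpha> then 1 else 0) * (if \<beta>' = \<beta> then 1 else 0))) =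
      (if \<alpha>' = \<alpha> then \<omega> \<alpha> \<beta> else 0)"
      using assms finite_X by simp
  qed
  finally show ?thesis using assms finite_X by simp
qed

lemma wsum_J_char1:
  assumes "\<alpha> \<in> X"
  shows "wsum J HH (\<lambda>a. \<alpha> (fst a)) = 1" "wsum J HH (\<lambda>a. \<alpha> (snd a)) = 1"
proof -
  have "wsum J HH (\<lambda>a. \<alpha> (fst a)) = wsum J HH (\<lambda>a. \<alpha> (fst a) * triv (snd a))"
    by (intro wsum_cong) (auto simp: triv_def)
  then show "wsum J HH (\<lambda>a. \<alpha> (fst a)) = 1" using assms by (simp add: wsum_J_char triv_char \<omega>_triv)
  have "wsum J HH (\<lambda>a. \<alpha> (snd a)) = wsum J HH (\<lambda>a. triv (fst a) * \<alpha> (snd a))"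
    by (intro wsum_cong) (auto simp: triv_def)
  then show "wsum J HH (\<lambda>a. \<alpha> (snd a)) = 1" using assms by (simp add: wsum_J_char triv_char \<omega>_triv)
qed

text \<open>Tested on characters, the axioms become statements about \<omega>: J^2 = 1 is
  \<omega>(\<alpha>, \<beta>)^2 = 1, the counit axioms say that \<omega> is 1 when one argument is
  trivial, and \<open>J_absorb\<close> is \<omega>(\<alpha>\<beta>, \<beta>) = \<omega>(\<alpha>,
  \<beta>) \<omega>(\<beta>, \<beta>).\<close>

sublocale tw: involutive_twist G H J
proof
  fix f :: "perm \<Rightarrow> perm \<Rightarrow> 'k" and f1 :: "perm \<Rightarrow> 'k"
  show "wsum J HH (\<lambda>a. wsum J HH (\<lambda>b. f (fst a \<circ> fst b) (snd a \<circ> snd b))) = f id id"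
  proof (rule char_ext[where L = "\<lambda>f. wsum J HH (\<lambda>a. wsum J HH (\<lambda>b. f (fst a \<circ> fst b) (snd a \<circ> snd b)))"
        and L' = "\<lambda>f. f id id"])
    fix \<alpha> \<beta> assume ab: "\<alpha> \<in> X" "\<beta> \<in> X"
    have "wsum J HH (\<lambda>a. wsum J HH (\<lambda>b. \<alpha> (fst a \<circ> fst b) * \<beta> (snd a \<circ> snd b))) =
      wsum J HH (\<lambda>a. wsum J HH (\<lambda>b. (\<alpha> (fst a) * \<beta> (snd a)) * (\<alpha> (fst b) * \<beta> (snd b))))"
      by (rule wsum_cong, rule wsum_cong) (use ab in \<open>auto simp: char_comp\<close>)
    then show "wsum J HH (\<lambda>a. wsum J HH (\<lambda>b. \<alpha> (fst a \<circ> fst b) * \<beta> (snd a \<circ> snd b))) = \<alpha> id * \<beta> id"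
      by (simp add: wsum_cmult wsum_multc wsum_J_char ab \<omega>_square char_id)
  next
    fix f f' :: "perm \<Rightarrow> perm \<Rightarrow> 'k" assume "\<And>p q. p \<in> H \<Longrightarrow> q \<in> H \<Longrightarrow> f p q = f' p q"
    then show "wsum J HH (\<lambda>a. wsum J HH (\<lambda>b. f (fst a \<circ> fst b) (snd a \<circ> snd b))) =
      wsum J HH (\<lambda>a. wsum J HH (\<lambda>b. f' (fst a \<circ> fst b) (snd a \<circ> snd b)))"
      by (intro wsum_cong) (auto simp: comp_H)
  qed (simp_all add: wsum_sum id_H)
  show "wsum J HH (\<lambda>a. f1 (fst a)) = f1 id"
  proof (rule char_ext[where L = "\<lambda>f. wsum J HH (\<lambda>a. f (fst a) id)" and L' = "\<lambda>f. f id id" and f = "\<lambda>p q. f1 p"])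
    fix f f' :: "perm \<Rightarrow> perm \<Rightarrow> 'k" assume "\<And>p q. p \<in> H \<Longrightarrow> q \<in> H \<Longrightarrow> f p q = f' p q"
    then show "wsum J HH (\<lambda>a. f (fst a) id) = wsum J HH (\<lambda>a. f' (fst a) id)"
      by (intro wsum_cong) (auto simp: id_H)
  qed (simp_all add: wsum_sum id_H wsum_J_char1 char_id)
  show "wsum J HH (\<lambda>a. f1 (snd a)) = f1 id"
  proof (rule char_ext[where L = "\<lambda>f. wsum J HH (\<lambda>a. f id (snd a))" and L' = "\<lambda>f. f id id" and f = "\<lambda>p q. f1 q"])
    fix f f' :: "perm \<Rightarrow> perm \<Rightarrow> 'k" assume "\<And>p q. p \<in> H \<Longrightarrow> q \<in> H \<Longrightarrow> f p q = f' p q"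
    then show "wsum J HH (\<lambda>a. f id (snd a)) = wsum J HH (\<lambda>a. f' id (snd a))"
      by (intro wsum_cong) (auto simp: id_H)
  qed (simp_all add: wsum_sum id_H wsum_J_char1 char_id)
  show "wsum J HH (\<lambda>a. wsum J HH (\<lambda>b. f (fst a) (fst b \<circ> snd b \<circ> snd a))) =
       wsum J HH (\<lambda>a. f (fst a) (fst a \<circ> snd a))"
  proof (rule char_ext[where L = "\<lambda>f. wsum J HH (\<lambda>a. wsum J HH (\<lambda>b. f (fst a) (fst b \<circ> snd b \<circ> snd a)))"
        and L' = "\<lambda>f. wsum J HH (\<lambda>a. f (fst a) (fst a \<circ> snd a))"])
    fix \<alpha> \<beta> assume ab: "\<alpha> \<in> X" "\<beta> \<in> X"
    have "wsum J HH (\<lambda>a. wsum J HH (\<lambda>b. \<alpha> (fst a) * \<beta> (fst b \<circ> snd b \<circ> snd a))) =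
      wsum J HH (\<lambda>a. wsum J HH (\<lambda>b. (\<alpha> (fst a) * \<beta> (snd a)) * (\<beta> (fst b) * \<beta> (snd b))))"
      by (rule wsum_cong, rule wsum_cong) (use ab in \<open>auto simp: char_comp comp_H\<close>)
    also have "\<dots> = \<omega> (char_mult \<alpha> \<beta>) \<beta>"
      by (simp add: wsum_cmult wsum_multc wsum_J_char ab \<omega>_mult)
    also have "\<dots> = wsum J HH (\<lambda>a. char_mult \<alpha> \<beta> (fst a) * \<beta> (snd a))"
      by (simp add: wsum_J_char ab char_mult_char)
    also have "\<dots> = wsum J HH (\<lambda>a. \<alpha> (fst a) * \<beta> (fst a \<circ> snd a))"
      by (rule wsum_cong) (use ab in \<open>auto simp: char_comp char_mult_def mult.assoc\<close>)
    finally show "wsum J HH (\<lambda>a. wsum J HH (\<lambda>b. \<alpha> (fst a) * \<beta> (fst b \<circ> snd b \<circ> snd a))) =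
      wsum J HH (\<lambda>a. \<alpha> (fst a) * \<beta> (fst a \<circ> snd a))" .
  next
    fix f f' :: "perm \<Rightarrow> perm \<Rightarrow> 'k" assume "\<And>p q. p \<in> H \<Longrightarrow> q \<in> H \<Longrightarrow> f p q = f' p q"
    then show "wsum J HH (\<lambda>a. wsum J HH (\<lambda>b. f (fst a) (fst b \<circ> snd b \<circ> snd a))) =
      wsum J HH (\<lambda>a. wsum J HH (\<lambda>b. f' (fst a) (fst b \<circ> snd b \<circ> snd a)))"
      by (intro wsum_cong) (auto simp: comp_H)
  next
    fix f f' :: "perm \<Rightarrow> perm \<Rightarrow> 'k" assume "\<And>p q. p \<in> H \<Longrightarrow> q \<in> H \<Longrightarrow> f p q = f' p q"
    then show "wsum J HH (\<lambda>a. f (fst a) (fst a \<circ> snd a)) = wsum J HH (\<lambda>a. f' (fst a) (fst a \<circ> snd a))"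
      by (intro wsum_cong) (auto simp: comp_H)
  qed (simp_all add: wsum_sum)
qed (fact H_sub id_H comp_H invol J_outside)+

end

section \<open>From invariant functions to the subalgebra\<close>

context normal_subalgebra
begin

lemma invariant_prod:
  "(\<And>i. i \<in> I \<Longrightarrow> invariant K (f i)) \<Longrightarrow> invariant K (\<lambda>g. \<Prod>i\<in>I. f i g)"
  by (induction I rule: infinite_finite_induct) (auto intro: invariant_const invariant_mult)

text \<open>If the algebra of invariant functions separates the identity from all other points, it
  contains the indicator of the identity. Pairing its right translates with x shows that x has no
  other coefficients.\<close>

lemma K_scalar_if_separated:
  assumes sep: "\<And>g. g \<in> G \<Longrightarrow> g \<noteq> id \<Longrightarrow> \<exists>f. invariant K f \<and> f g \<noteq> f id"
  shows "K = {ga_smult c ga_one |c. True}"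
proof -
  obtain F where F: "\<And>g. g \<in> G \<Longrightarrow> g \<noteq> id \<Longrightarrow> invariant K (F g) \<and> F g g \<noteq> F g id"
    using sep by metis
  \<comment> \<open>Lagrange interpolation: each factor is 1 at the identity and vanishes at its own
    g.\<close>
  define \<delta> where "\<delta> = (\<lambda>h. \<Prod>g\<in>G - {id}. (F g h + (- F g g)) * inverse (F g id - F g g))"
  have inv: "invariant K \<delta>"
    unfolding \<delta>_def
    by (intro invariant_prod invariant_mult invariant_add invariant_const) (use F in auto)
  have \<delta>_id: "\<delta> id = 1" unfolding \<delta>_def by (rule prod.neutral) (use F in force)
  have \<delta>_0: "\<delta> h = 0" if "h \<in> G" "h \<noteq> id" for h
    unfolding \<delta>_def by (rule prod_zero) (use that finite_G in force)+
  have "x g = 0" if x: "x \<in> K" and g: "g \<in> G" "g \<noteq> id" for x g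
  proof -
    have ga: "inv g \<in> G" "inv g \<noteq> id" using g by (auto simp: inv_in) (metis inv_cancel(5) inv_id)
    have "wsum x G (\<lambda>h. \<delta> (h \<circ> inv g)) = 0" using invariantD[OF inv x ga(1)] \<delta>_0[OF ga] by simp
    moreover have "wsum x G (\<lambda>h. \<delta> (h \<circ> inv g)) = wsum x G (\<lambda>h. if h = g then 1 else 0)"
    proof (rule wsum_cong)
      fix h assume h: "h \<in> G"
      have "h \<circ> inv g = id \<longleftrightarrow> h = g"
      proof
        assume "h \<circ> inv g = id"
        then have "h \<circ> inv g \<circ> g = g" by simp
        then show "h = g" using g by (simp add: comp_assoc)
      qed (use g in simp)
      then show "\<delta> (h \<circ> inv g) = (if h = g then 1 else 0)"
        using \<delta>_0[of "h \<circ> inv g"] \<delta>_id h ga by (cases "h = g") (auto simp: comp_in)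
    qed
    ultimately show ?thesis using g by (simp add: wsum_indicator finite_G)
  qed
  then have "x g = ga_smult (x id) ga_one g" if "x \<in> K" for x g
    using that K_outside[OF that, of g] id_in
    by (cases "g = id"; cases "g \<in> G") (simp_all add: ga_smult_def ga_one_def gdelta_def)
  then have "x = ga_smult (x id) ga_one" if "x \<in> K" for x using that by (intro ext)
  moreover have "ga_smult c ga_one \<in> K" for c
    using K_smult[OF K_one] by (simp add: ga_smult_def)
  ultimately show ?thesis by blast
qed

text \<open>The legs of \<open>\<Delta>\<^sup>J(\<Sum>g) = \<Sum> g \<otimes> UgU\<close> span the whole algebra.\<close>

lemma K_full_if_sum_in_K:
  assumes e: "e \<in> K" "\<And>g. g \<in> G \<Longrightarrow> e g = 1"
  shows "K = ga_carrier G"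
proof -
  have D: "wsum (Delta_tw G J e) (G \<times> G) (\<lambda>z. f (fst z) (snd z)) =
      (\<Sum>g\<in>G. wsum U H (\<lambda>u. wsum U H (\<lambda>v. f g (u \<circ> g \<circ> v))))" for f
  proof -
    have "wsum (Delta_tw G J e) (G \<times> G) (\<lambda>z. f (fst z) (snd z)) =
      wsum J HH (\<lambda>a. wsum J HH (\<lambda>b. wsum e G (\<lambda>g. f (fst a \<circ> g \<circ> fst b) (snd a \<circ> g \<circ> snd b))))"
      unfolding wsum_Delta_tw fst_conv snd_conv by (intro wsum_cong wsum_swap)
    \<comment> \<open>Replacing g by \<open>fst a \<circ> g \<circ> fst b\<close> clears the first
      leg and leaves the weights alone, since e is constant on G.\<close>
    also have "\<dots> = wsum J HH (\<lambda>a. wsum J HH (\<lambda>b. wsum e G (\<lambda>g. f g ((fst a \<circ> snd a) \<circ> g \<circ> (fst b \<circ> snd b)))))"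
    proof (rule wsum_cong, rule wsum_cong)
      fix a b assume "a \<in> HH" "b \<in> HH"
      then have h: "fst a \<in> H" "snd a \<in> H" "fst b \<in> H" "snd b \<in> H" by auto
      show "wsum e G (\<lambda>g. f (fst a \<circ> g \<circ> fst b) (snd a \<circ> g \<circ> snd b)) =
         wsum e G (\<lambda>g. f g ((fst a \<circ> snd a) \<circ> g \<circ> (fst b \<circ> snd b)))"
        unfolding wsum_def
        by (rule sum.reindex_bij_witness[of _ "\<lambda>g. fst a \<circ> g \<circ> fst b" "\<lambda>g. fst a \<circ> g \<circ> fst b"])
          (use h in \<open>auto simp: e comp_in comp_assoc invol invol_left comm_H left_comm_H\<close>)
    qed
    also have "\<dots> = wsum U H (\<lambda>u. wsum U H (\<lambda>v. wsum e G (\<lambda>g. f g (u \<circ> g \<circ> v))))"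
      by (simp add: wsum_U)
    also have "\<dots> = wsum e G (\<lambda>g. wsum U H (\<lambda>u. wsum U H (\<lambda>v. f g (u \<circ> g \<circ> v))))"
      by (subst (2) wsum_swap, subst wsum_swap) (rule refl)
    finally show ?thesis by (simp add: wsum_def[of e] e)
  qed
  have "gdelta g0 \<in> K" if g0: "g0 \<in> G" for g0
  proof -
    \<comment> \<open>\<open>\<psi> t\<close> is the coefficient of U t U at \<open>g0\<close>. As
      U^2 = 1, contracting the second leg U g U with it keeps only g = \<open>g0\<close>.\<close>
    define \<psi> :: "perm \<Rightarrow> 'k" where "\<psi> t = wsum U H (\<lambda>u. wsum U H (\<lambda>v. if u \<circ> t \<circ> v = g0 then 1 else 0))" for t
    define x where "x = (\<lambda>s. \<Sum>t\<in>G. \<psi> t * Delta_tw G J e (s, t))"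
    have xK: "x \<in> K" unfolding x_def by (intro K_sum slices_in_K e)
    have \<psi>: "wsum U H (\<lambda>u. wsum U H (\<lambda>v. \<psi> (u \<circ> g \<circ> v))) = (if g = g0 then 1 else 0)" for g
    proof -
      let ?f = "\<lambda>w w'. if w \<circ> g \<circ> w' = g0 then 1 else (0::'k)"
      have "wsum U H (\<lambda>u. wsum U H (\<lambda>v. \<psi> (u \<circ> g \<circ> v))) =
        wsum U H (\<lambda>u. wsum U H (\<lambda>v. wsum U H (\<lambda>u'. wsum U H (\<lambda>v'. ?f (u' \<circ> u) (v \<circ> v')))))"
        by (simp add: \<psi>_def comp_assoc)
      also have "\<dots> = wsum U H (\<lambda>u. wsum U H (\<lambda>u'. wsum U H (\<lambda>v. wsum U H (\<lambda>v'. ?f (u' \<circ> u) (v \<circ> v')))))"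
        by (intro wsum_cong wsum_swap)
      also have "\<dots> = wsum U H (\<lambda>u. wsum U H (\<lambda>u'. ?f (u' \<circ> u) id))"
        by (rule wsum_cong, rule wsum_cong, rule U_square)
      also have "\<dots> = wsum U H (\<lambda>u'. wsum U H (\<lambda>u. ?f (u' \<circ> u) id))" by (rule wsum_swap)
      also have "\<dots> = ?f id id" by (rule U_square)
      finally show ?thesis by simp
    qed
    have "x = gdelta g0"
    proof (rule carrier_ext[OF K_carrier[OF xK]])
      show "gdelta g0 \<in> ga_carrier G" using g0 by (auto simp: gdelta_def ga_carrier_def)
      fix f
      have "wsum x G f = (\<Sum>s\<in>G. \<Sum>t\<in>G. Delta_tw G J e (s, t) * (\<psi> t * f s))"
        by (simp add: x_def wsum_def sum_distrib_right sum_distrib_left mult_ac)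
      also have "\<dots> = wsum (Delta_tw G J e) (G \<times> G) (\<lambda>z. \<psi> (snd z) * f (fst z))"
        by (simp add: wsum_Times(1)) (simp add: wsum_def)
      also have "\<dots> = (\<Sum>g\<in>G. (if g = g0 then 1 else 0) * f g)"
        unfolding D[of "\<lambda>s t. \<psi> t * f s"] by (simp add: wsum_multc \<psi>)
      also have "\<dots> = f g0" using wsum_delta[OF finite_G g0, of 1 f] by (simp add: wsum_def)
      finally show "wsum x G f = wsum (gdelta g0) G f" by (simp add: wsum_gdelta g0)
    qed
    then show ?thesis using xK by simp
  qed
  then have "(\<lambda>h. \<Sum>g\<in>G. x g * gdelta g h) \<in> K" for x by (intro K_sum)
  moreover have "(\<lambda>h. \<Sum>g\<in>G. x g * gdelta g h) = x" if "x \<in> ga_carrier G" for x :: "perm \<Rightarrow> 'k"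
  proof
    fix h
    have "(\<Sum>g\<in>G. x g * gdelta g h) = wsum x G (\<lambda>g. if g = h then 1 else 0)"
      unfolding wsum_def by (intro sum.cong) (auto simp: gdelta_def)
    then show "(\<Sum>g\<in>G. x g * gdelta g h) = x h"
      using that by (auto simp: wsum_indicator finite_G ga_carrier_def)
  qed
  ultimately have "ga_carrier G \<subseteq> K" by (metis subsetI)
  then show ?thesis using K_carrier by blast
qed

section \<open>Coinvariance under a one-dimensional character\<close>

context
  fixes \<tau> :: "perm \<Rightarrow> 'k" and u v :: "perm \<Rightarrow> 'k"
  assumes \<tau>_comp: "\<forall>g\<in>G. \<forall>h\<in>G. \<tau> (g \<circ> h) = \<tau> g * \<tau> h" and \<tau>_id: "\<tau> id = 1"
    and \<tau>_inv: "invariant K \<tau>"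
    and u: "u = (\<lambda>p. \<Sum>q\<in>H. J (p, q) * \<tau> q)" and v: "v = (\<lambda>q. \<Sum>p\<in>H. J (p, q) * \<tau> p)"
begin

lemma wsum_u: "wsum u H f = wsum J HH (\<lambda>a. \<tau> (snd a) * f (fst a))"
  unfolding wsum_Times(1) by (simp add: wsum_def u sum_distrib_right mult.assoc)

lemma wsum_v: "wsum v H f = wsum J HH (\<lambda>a. \<tau> (fst a) * f (snd a))"
  unfolding wsum_Times(2) by (simp add: wsum_def v sum_distrib_right mult.assoc)

text \<open>Applying the character \<tau> to the second leg is an algebra map and sends J to u, so
  J^2 = 1 passes to u.\<close>

lemma u_square: "wsum u H (\<lambda>p. wsum u H (\<lambda>r. f (p \<circ> r))) = f id"
proof -
  have "wsum u H (\<lambda>p. wsum u H (\<lambda>r. f (p \<circ> r))) =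
    wsum J HH (\<lambda>a. wsum J HH (\<lambda>b. \<tau> (snd a \<circ> snd b) * f (fst a \<circ> fst b)))"
    unfolding wsum_u wsum_cmult[symmetric]
    by (rule wsum_cong, rule wsum_cong) (auto simp: \<tau>_comp)
  then show ?thesis using J_square[of "\<lambda>p q. \<tau> q * f p"] by (simp add: \<tau>_id)
qed

lemma v_square: "wsum v H (\<lambda>p. wsum v H (\<lambda>r. f (p \<circ> r))) = f id"
proof -
  have "wsum v H (\<lambda>p. wsum v H (\<lambda>r. f (p \<circ> r))) =
    wsum J HH (\<lambda>a. wsum J HH (\<lambda>b. \<tau> (fst a \<circ> fst b) * f (snd a \<circ> snd b)))"
    unfolding wsum_v wsum_cmult[symmetric]
    by (rule wsum_cong, rule wsum_cong) (auto simp: \<tau>_comp)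
  then show ?thesis using J_square[of "\<lambda>p q. \<tau> p * f q"] by (simp add: \<tau>_id)
qed

lemma \<tau>_eps: "x \<in> K \<Longrightarrow> wsum x G \<tau> = wsum x G (\<lambda>_. 1)"
  using invariantD[OF \<tau>_inv _ id_in, of x] by (simp add: \<tau>_id)

text \<open>The second leg of \<Delta>^J(x) lies in K, where \<tau> agrees with the counit. Applying
  \<tau> there returns x on the one hand and u \<tau>(x) u on the other.\<close>

lemma coinvariant_u:
  assumes x: "x \<in> K"
  shows "wsum x G f = wsum u H (\<lambda>p. wsum x G (\<lambda>g. wsum u H (\<lambda>r. \<tau> g * f (p \<circ> g \<circ> r))))"
proof -
  let ?D = "Delta_tw G J x"
  have "wsum x G f = wsum ?D (G \<times> G) (\<lambda>z. f (fst z))" by (simp add: wsum_Delta_tw_counit)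
  also have "\<dots> = (\<Sum>s\<in>G. wsum (\<lambda>t. ?D (s, t)) G (\<lambda>_. 1) * f s)"
    by (simp add: wsum_Times(1)) (simp add: wsum_def sum_distrib_right)
  also have "\<dots> = wsum ?D (G \<times> G) (\<lambda>z. \<tau> (snd z) * f (fst z))"
    by (simp add: wsum_Times(1) wsum_multc \<tau>_eps[OF slices_in_K(2)[OF x]])
  also have "\<dots> = wsum u H (\<lambda>p. wsum x G (\<lambda>g. wsum u H (\<lambda>r. \<tau> g * f (p \<circ> g \<circ> r))))"
    unfolding wsum_Delta_tw wsum_u wsum_cmult[symmetric] fst_conv snd_conv
    by (rule wsum_cong, rule wsum_cong, rule wsum_cong) (auto simp: \<tau>_comp comp_in mult_ac)
  finally show ?thesis .
qed

lemma coinvariant_v: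
  assumes x: "x \<in> K"
  shows "wsum x G f = wsum v H (\<lambda>p. wsum x G (\<lambda>g. wsum v H (\<lambda>r. \<tau> g * f (p \<circ> g \<circ> r))))"
proof -
  let ?D = "Delta_tw G J x"
  have "wsum x G f = wsum ?D (G \<times> G) (\<lambda>z. f (snd z))" by (simp add: wsum_Delta_tw_counit)
  also have "\<dots> = (\<Sum>t\<in>G. wsum (\<lambda>s. ?D (s, t)) G (\<lambda>_. 1) * f t)"
    by (simp add: wsum_Times(2)) (simp add: wsum_def sum_distrib_right)
  also have "\<dots> = wsum ?D (G \<times> G) (\<lambda>z. \<tau> (fst z) * f (snd z))"
    by (simp add: wsum_Times(2) wsum_multc \<tau>_eps[OF slices_in_K(1)[OF x]])
  also have "\<dots> = wsum v H (\<lambda>p. wsum x G (\<lambda>g. wsum v H (\<lambda>r. \<tau> g * f (p \<circ> g \<circ> r))))"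
    unfolding wsum_Delta_tw wsum_v wsum_cmult[symmetric] fst_conv snd_conv
    by (rule wsum_cong, rule wsum_cong, rule wsum_cong) (auto simp: \<tau>_comp comp_in mult_ac)
  finally show ?thesis .
qed

text \<open>Coinvariance together with u^2 = v^2 = 1 gives v x = \<tau>(x) v and x u = u \<tau>(x),
  hence u v x = u \<tau>(x) v = x u v.\<close>

lemma commute_uv:
  assumes x: "x \<in> K"
  shows "wsum u H (\<lambda>p. wsum v H (\<lambda>q. wsum x G (\<lambda>g. f (p \<circ> q \<circ> g)))) =
    wsum u H (\<lambda>p. wsum v H (\<lambda>q. wsum x G (\<lambda>g. f (g \<circ> (p \<circ> q)))))"
proof -
  have L: "wsum v H (\<lambda>q. wsum x G (\<lambda>g. f (p \<circ> q \<circ> g))) = wsum v H (\<lambda>s. wsum x G (\<lambda>g. \<tau> g * f (p \<circ> g \<circ> s)))" for p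
  proof -
    have "wsum v H (\<lambda>q. wsum x G (\<lambda>g. f (p \<circ> q \<circ> g))) = wsum x G (\<lambda>g. wsum v H (\<lambda>q. f (p \<circ> q \<circ> g)))"
      by (rule wsum_swap)
    also have "\<dots> = wsum v H (\<lambda>q'. wsum x G (\<lambda>g. wsum v H (\<lambda>s. \<tau> g * wsum v H (\<lambda>q. f (p \<circ> (q \<circ> q') \<circ> g \<circ> s)))))"
      unfolding coinvariant_v[OF x, of "\<lambda>g. wsum v H (\<lambda>q. f (p \<circ> q \<circ> g))"] by (simp add: comp_assoc)
    also have "\<dots> = wsum v H (\<lambda>q'. wsum v H (\<lambda>q. wsum x G (\<lambda>g. wsum v H (\<lambda>s. \<tau> g * f (p \<circ> (q \<circ> q') \<circ> g \<circ> s)))))"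
      unfolding wsum_cmult[symmetric] by (subst (3) wsum_swap, subst (2) wsum_swap) (rule refl)
    also have "\<dots> = wsum v H (\<lambda>q. wsum v H (\<lambda>q'. wsum x G (\<lambda>g. wsum v H (\<lambda>s. \<tau> g * f (p \<circ> (q \<circ> q') \<circ> g \<circ> s)))))"
      by (rule wsum_swap)
    also have "\<dots> = wsum x G (\<lambda>g. wsum v H (\<lambda>s. \<tau> g * f (p \<circ> g \<circ> s)))"
      using v_square[of "\<lambda>q. wsum x G (\<lambda>g. wsum v H (\<lambda>s. \<tau> g * f (p \<circ> q \<circ> g \<circ> s)))"] by simp
    also have "\<dots> = wsum v H (\<lambda>s. wsum x G (\<lambda>g. \<tau> g * f (p \<circ> g \<circ> s)))" by (rule wsum_swap)
    finally show ?thesis .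
  qed
  have R: "wsum u H (\<lambda>p. wsum x G (\<lambda>g. f (g \<circ> (p \<circ> q)))) = wsum u H (\<lambda>p. wsum x G (\<lambda>g. \<tau> g * f (p \<circ> g \<circ> q)))" for q
  proof -
    have "wsum u H (\<lambda>p. wsum x G (\<lambda>g. f (g \<circ> (p \<circ> q)))) = wsum x G (\<lambda>g. wsum u H (\<lambda>p. f (g \<circ> (p \<circ> q))))"
      by (rule wsum_swap)
    also have "\<dots> = wsum u H (\<lambda>p'. wsum x G (\<lambda>g. wsum u H (\<lambda>r. \<tau> g * wsum u H (\<lambda>p. f (p' \<circ> g \<circ> (r \<circ> p) \<circ> q)))))"
      unfolding coinvariant_u[OF x, of "\<lambda>g. wsum u H (\<lambda>p. f (g \<circ> (p \<circ> q)))"] by (simp add: comp_assoc)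
    also have "\<dots> = wsum u H (\<lambda>p'. wsum x G (\<lambda>g. \<tau> g * f (p' \<circ> g \<circ> q)))"
      unfolding wsum_cmult[symmetric]
      by (rule wsum_cong, rule wsum_cong) (use u_square[of "\<lambda>w. \<tau> g * f (p' \<circ> g \<circ> w \<circ> q)" for g p'] in simp)
    finally show ?thesis .
  qed
  have "wsum u H (\<lambda>p. wsum v H (\<lambda>q. wsum x G (\<lambda>g. f (g \<circ> (p \<circ> q))))) =
    wsum v H (\<lambda>q. wsum u H (\<lambda>p. wsum x G (\<lambda>g. f (g \<circ> (p \<circ> q)))))" by (rule wsum_swap)
  also have "\<dots> = wsum v H (\<lambda>q. wsum u H (\<lambda>p. wsum x G (\<lambda>g. \<tau> g * f (p \<circ> g \<circ> q))))" by (simp only: R)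
  also have "\<dots> = wsum u H (\<lambda>p. wsum v H (\<lambda>q. wsum x G (\<lambda>g. \<tau> g * f (p \<circ> g \<circ> q))))" by (rule wsum_swap)
  finally show ?thesis by (simp only: L)
qed

text \<open>uv commutes with the first legs of \<Delta>^J(x), which are in K, and with the legs of
  J, which are in kH; so uv (x) 1 commutes with \<Delta>(x) = J \<Delta>^J(x) J. The second leg of
  \<Delta>(x) separates the individual g.\<close>

lemma commute_uv_diagonal:
  assumes x: "x \<in> K"
  shows "wsum u H (\<lambda>p. wsum v H (\<lambda>q. wsum x G (\<lambda>g. f (p \<circ> q \<circ> g) g))) =
    wsum u H (\<lambda>p. wsum v H (\<lambda>q. wsum x G (\<lambda>g. f (g \<circ> (p \<circ> q)) g)))"
proof -
  let ?D = "Delta_tw G J x"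
  have tw: "wsum u H (\<lambda>p. wsum v H (\<lambda>q. wsum ?D (G \<times> G) (\<lambda>z. F (p \<circ> q \<circ> fst z) (snd z)))) =
    wsum u H (\<lambda>p. wsum v H (\<lambda>q. wsum ?D (G \<times> G) (\<lambda>z. F (fst z \<circ> (p \<circ> q)) (snd z))))" for F
  proof -
    have sl: "wsum u H (\<lambda>p. wsum v H (\<lambda>q. wsum ?D (G \<times> G) (\<lambda>z. E p q (fst z) (snd z)))) =
      (\<Sum>t\<in>G. wsum u H (\<lambda>p. wsum v H (\<lambda>q. wsum (\<lambda>s. ?D (s, t)) G (\<lambda>s. E p q s t))))" for E
      by (simp add: wsum_Times(2) wsum_sum1)
    show ?thesis unfolding sl[of "\<lambda>p q s. F (p \<circ> q \<circ> s)"] sl[of "\<lambda>p q s. F (s \<circ> (p \<circ> q))"]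
      by (intro sum.cong refl commute_uv slices_in_K x)
  qed
  let ?F = "\<lambda>s t. wsum J HH (\<lambda>a. wsum J HH (\<lambda>b. f (fst a \<circ> s \<circ> fst b) (snd a \<circ> t \<circ> snd b)))"
  have "wsum ?D (G \<times> G) (\<lambda>z. ?F (p \<circ> q \<circ> fst z) (snd z)) = wsum x G (\<lambda>g. f (p \<circ> q \<circ> g) g)"
    if pq: "p \<in> H" "q \<in> H" for p q
  proof -
    have "wsum ?D (G \<times> G) (\<lambda>z. ?F (p \<circ> q \<circ> fst z) (snd z)) =
      wsum J HH (\<lambda>a. wsum ?D (G \<times> G) (\<lambda>z. wsum J HH (\<lambda>b. f (fst a \<circ> (p \<circ> q \<circ> fst z) \<circ> fst b) (snd a \<circ> snd z \<circ> snd b))))"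
      by (rule wsum_swap)
    also have "\<dots> = wsum J HH (\<lambda>a. wsum ?D (G \<times> G) (\<lambda>z. wsum J HH (\<lambda>b. f (p \<circ> q \<circ> (fst a \<circ> fst z \<circ> fst b)) (snd a \<circ> snd z \<circ> snd b))))"
      by (intro wsum_cong arg_cong2[of _ _ _ _ f] refl) (use pq in \<open>auto simp: comp_assoc left_comm_H\<close>)
    also have "\<dots> = wsum x G (\<lambda>g. f (p \<circ> q \<circ> g) g)"
      by (rule untwist_Delta[of x "\<lambda>s t. f (p \<circ> q \<circ> s) t"])
    finally show ?thesis .
  qed
  moreover have "wsum ?D (G \<times> G) (\<lambda>z. ?F (fst z \<circ> (p \<circ> q)) (snd z)) = wsum x G (\<lambda>g. f (g \<circ> (p \<circ> q)) g)"
    if pq: "p \<in> H" "q \<in> H" for p q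
  proof -
    have "wsum ?D (G \<times> G) (\<lambda>z. ?F (fst z \<circ> (p \<circ> q)) (snd z)) =
      wsum J HH (\<lambda>a. wsum ?D (G \<times> G) (\<lambda>z. wsum J HH (\<lambda>b. f (fst a \<circ> (fst z \<circ> (p \<circ> q)) \<circ> fst b) (snd a \<circ> snd z \<circ> snd b))))"
      by (rule wsum_swap)
    also have "\<dots> = wsum J HH (\<lambda>a. wsum ?D (G \<times> G) (\<lambda>z. wsum J HH (\<lambda>b. f ((fst a \<circ> fst z \<circ> fst b) \<circ> (p \<circ> q)) (snd a \<circ> snd z \<circ> snd b))))"
      by (intro wsum_cong arg_cong2[of _ _ _ _ f] refl) (use pq in \<open>auto simp: comp_assoc left_comm_H comm_H\<close>)
    also have "\<dots> = wsum x G (\<lambda>g. f (g \<circ> (p \<circ> q)) g)"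
      by (rule untwist_Delta[of x "\<lambda>s t. f (s \<circ> (p \<circ> q)) t"])
    finally show ?thesis .
  qed
  ultimately show ?thesis using tw[of ?F] by (simp cong: wsum_cong)
qed

text \<open>\<open>uv\<close> commutes with every group element in the support of a member of K, so its coefficient vanishes
  at each point of H that such an element conjugates out of H.\<close>

lemma uv_coefficient_zero:
  assumes x: "x \<in> K" and g0: "g0 \<in> G" "x g0 \<noteq> 0" and h0: "h0 \<in> H" "inv g0 \<circ> h0 \<circ> g0 \<notin> H"
  shows "wsum u H (\<lambda>p. wsum v H (\<lambda>q. if p \<circ> q = h0 then 1 else 0)) = 0"
proof -
  \<comment> \<open>The second leg selects the term g = \<open>g0\<close> of x, the first leg the
    coefficient at \<open>h0 \<circ> g0\<close>.\<close>
  let ?f = "\<lambda>s g. (if g = g0 then 1 else 0) * (if s = h0 \<circ> g0 then 1 else (0::'k))"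
  have pick: "wsum x G (\<lambda>g. (if g = g0 then 1 else 0) * F g) = x g0 * F g0" for F
  proof -
    have "wsum x G (\<lambda>g. (if g = g0 then 1 else 0) * F g) = wsum (\<lambda>g. if g = g0 then x g0 else 0) G F"
      unfolding wsum_def by (intro sum.cong) auto
    then show ?thesis using g0 by (simp add: wsum_delta finite_G)
  qed
  have eq: "wsum u H (\<lambda>p. wsum v H (\<lambda>q. x g0 * (if p \<circ> q \<circ> g0 = h0 \<circ> g0 then 1 else 0))) =
    wsum u H (\<lambda>p. wsum v H (\<lambda>q. x g0 * (if g0 \<circ> (p \<circ> q) = h0 \<circ> g0 then 1 else 0)))"
    using commute_uv_diagonal[OF x, of ?f] by (simp only: pick)
  have ne: "g0 \<circ> (p \<circ> q) \<noteq> h0 \<circ> g0" if "p \<in> H" "q \<in> H" for p q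
  proof
    assume "g0 \<circ> (p \<circ> q) = h0 \<circ> g0"
    then have "inv g0 \<circ> (g0 \<circ> (p \<circ> q)) = inv g0 \<circ> h0 \<circ> g0" by (simp add: comp_assoc)
    then have "p \<circ> q = inv g0 \<circ> h0 \<circ> g0" using g0 by simp
    then show False using comp_H[OF that] h0 by simp
  qed
  have iff: "p \<circ> q \<circ> g0 = h0 \<circ> g0 \<longleftrightarrow> p \<circ> q = h0" for p q
  proof
    assume "p \<circ> q \<circ> g0 = h0 \<circ> g0"
    then have "p \<circ> q \<circ> g0 \<circ> inv g0 = h0 \<circ> g0 \<circ> inv g0" by simp
    then show "p \<circ> q = h0" using g0 by (simp add: comp_assoc)
  qed simp
  have "x g0 * wsum u H (\<lambda>p. wsum v H (\<lambda>q. if p \<circ> q = h0 then 1 else 0)) =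
     wsum u H (\<lambda>p. wsum v H (\<lambda>q. x g0 * (if p \<circ> q \<circ> g0 = h0 \<circ> g0 then 1 else 0)))"
    by (simp only: iff wsum_cmult)
  also have "\<dots> = wsum u H (\<lambda>p. wsum v H (\<lambda>q. 0))"
    unfolding eq by (rule wsum_cong, rule wsum_cong) (simp add: ne)
  finally show ?thesis using g0 by (simp add: wsum_def)
qed

end

end

section \<open>The twist of the symmetric group\<close>

lemma finite_perm_group_sym_group: "finite_perm_group (sym_group m)"
proof
  show "finite (sym_group m)" unfolding sym_group_def by (rule finite_permutations) simp
qed (auto simp: sym_group_def permutes_id permutes_compose permutes_inv permutes_bij)

section \<open>The group generated by the disjoint transpositions\<close>

lemma H_n_minimal:
  assumes "id \<in> L" "\<And>i. i \<in> {1..n} \<Longrightarrow> tt i \<in> L" "\<And>x y. x \<in> L \<Longrightarrow> y \<in> L \<Longrightarrow> x \<circ> y \<in> L"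
    "\<And>x. x \<in> L \<Longrightarrow> inv x \<in> L"
  shows "H_n n \<subseteq> L"
  unfolding H_n_def gen_subgroup_def by (rule Inter_lower) (use assms in auto)

lemma H_n_id: "id \<in> H_n n"
  and H_n_tt: "i \<in> {1..n} \<Longrightarrow> tt i \<in> H_n n"
  and H_n_comp: "x \<in> H_n n \<Longrightarrow> y \<in> H_n n \<Longrightarrow> x \<circ> y \<in> H_n n"
  unfolding H_n_def gen_subgroup_def by auto

text \<open>H is an intersection of closed sets and hides the shape of its members. This explicit
  set contains the generators and is closed under products, so it bounds H from above; only this
  inclusion is used.\<close>

definition preserves_pairs :: "nat \<Rightarrow> perm \<Rightarrow> bool" where
  "preserves_pairs n h \<longleftrightarrow> h permutes {1..2 * n} \<and>
    (\<forall>i\<in>{1..n}. (h (2 * i - 1) = 2 * i - 1 \<and> h (2 * i) = 2 * i) \<or>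
      (h (2 * i - 1) = 2 * i \<and> h (2 * i) = 2 * i - 1))"

lemma pair_index:
  fixes x n :: nat
  assumes "x \<in> {1..2 * n}"
  obtains i where "i \<in> {1..n}" "x = 2 * i - 1 \<or> x = 2 * i"
proof (rule that[of "(x + 1) div 2"])
  show "(x + 1) div 2 \<in> {1..n}" using assms by auto
  show "x = 2 * ((x + 1) div 2) - 1 \<or> x = 2 * ((x + 1) div 2)" by presburger
qed

lemma preserves_pairs_invol:
  assumes "preserves_pairs n h" shows "h \<circ> h = id"
proof
  fix x
  show "(h \<circ> h) x = id x"
  proof (cases "x \<in> {1..2 * n}")
    case True
    then obtain i where "i \<in> {1..n}" "x = 2 * i - 1 \<or> x = 2 * i" by (rule pair_index)
    then show ?thesis using assms unfolding preserves_pairs_def by fastforce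
  next
    case False
    then have "h x = x" using assms permutes_not_in[of h "{1..2 * n}" x] unfolding preserves_pairs_def by blast
    then show ?thesis by simp
  qed
qed

lemma tt_pair:
  assumes "i \<in> {1..n}" "j \<in> {1..n}"
  shows "tt j (2 * i - 1) = (if i = j then 2 * i else 2 * i - 1)" "tt j (2 * i) = (if i = j then 2 * i - 1 else 2 * i)"
proof -
  have *: "2 * i - 1 \<noteq> 2 * j" "2 * j - 1 \<noteq> 2 * i" "2 * i - 1 = 2 * j - 1 \<longleftrightarrow> i = j"
    using assms by (auto; presburger)+
  then show "tt j (2 * i - 1) = (if i = j then 2 * i else 2 * i - 1)" "tt j (2 * i) = (if i = j then 2 * i - 1 else 2 * i)"
    by (auto simp: tt_def transpose_def)
qed

lemma preserves_pairs_tt: "j \<in> {1..n} \<Longrightarrow> preserves_pairs n (tt j)"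
  unfolding preserves_pairs_def
  using tt_pair[of _ n j] by (auto simp: tt_def intro!: permutes_swap_id)

lemma preserves_pairs_comp: "preserves_pairs n g \<Longrightarrow> preserves_pairs n h \<Longrightarrow> preserves_pairs n (g \<circ> h)"
proof -
  assume g: "preserves_pairs n g" and h: "preserves_pairs n h"
  have "g \<circ> h permutes {1..2 * n}" using g h by (simp add: preserves_pairs_def permutes_compose)
  moreover have "((g \<circ> h) (2 * i - 1) = 2 * i - 1 \<and> (g \<circ> h) (2 * i) = 2 * i) \<or>
      ((g \<circ> h) (2 * i - 1) = 2 * i \<and> (g \<circ> h) (2 * i) = 2 * i - 1)" if "i \<in> {1..n}" for i
  proof -
    have "(g (2 * i - 1) = 2 * i - 1 \<and> g (2 * i) = 2 * i) \<or> (g (2 * i - 1) = 2 * i \<and> g (2 * i) = 2 * i - 1)"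
      "(h (2 * i - 1) = 2 * i - 1 \<and> h (2 * i) = 2 * i) \<or> (h (2 * i - 1) = 2 * i \<and> h (2 * i) = 2 * i - 1)"
      using g h that unfolding preserves_pairs_def by blast+
    then show ?thesis by (elim disjE) (simp_all only: o_apply simp_thms)
  qed
  ultimately show ?thesis unfolding preserves_pairs_def by blast
qed

lemma H_n_preserves_pairs: "h \<in> H_n n \<Longrightarrow> preserves_pairs n h"
proof -
  have "H_n n \<subseteq> {h. preserves_pairs n h}"
  proof (rule H_n_minimal)
    show "inv h \<in> {h. preserves_pairs n h}" if "h \<in> {h. preserves_pairs n h}" for h
      using that preserves_pairs_invol inv_unique_comp[of h h] by auto
  qed (auto simp: preserves_pairs_tt preserves_pairs_comp, simp add: preserves_pairs_def permutes_id)
  then show "h \<in> H_n n \<Longrightarrow> preserves_pairs n h" by blast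
qed

lemma H_n_moved:
  assumes "h \<in> H_n n" "h \<noteq> id"
  obtains i where "i \<in> {1..n}" "h (2 * i - 1) = 2 * i" "h (2 * i) = 2 * i - 1"
proof -
  have pp: "preserves_pairs n h" using assms by (simp add: H_n_preserves_pairs)
  obtain x where x: "h x \<noteq> x" using assms(2) by (auto simp: fun_eq_iff)
  then have "x \<in> {1..2 * n}" using pp unfolding preserves_pairs_def by (meson permutes_not_in)
  then obtain i where i: "i \<in> {1..n}" "x = 2 * i - 1 \<or> x = 2 * i" by (rule pair_index)
  then show ?thesis using that[of i] x pp unfolding preserves_pairs_def by auto
qed

section \<open>The given bicharacter and the sign character\<close>

locale pair_twist =
  fixes n :: nat and a :: "nat \<Rightarrow> perm \<Rightarrow> 'k::field_char_0" and \<omega> :: "(perm \<Rightarrow> 'k) \<Rightarrow> (perm \<Rightarrow> 'k) \<Rightarrow> 'k"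
  assumes n: "n \<ge> 3" and even_n: "even n"
    and a_char: "i \<in> {1..n} \<Longrightarrow> a i \<in> characters (H_n n)"
    and a_tt: "i \<in> {1..n} \<Longrightarrow> j \<in> {1..n} \<Longrightarrow> a i (tt j) = (if i = j then -1 else 1)"
    and bichar: "bicharacter (H_n n) \<omega>"
    and \<omega>_a: "i \<in> {1..n} \<Longrightarrow> j \<in> {1..n} \<Longrightarrow> \<omega> (a i) (a j) = (if i < j then -1 else 1)"
begin

text \<open>A non-identity h in H swaps some pair, and the character of that pair detects it; this
  makes the characters separate H.\<close>

lemma a_value:
  assumes "h \<in> H_n n" "i \<in> {1..n}"
  shows "a i h = (if h (2 * i) = 2 * i then 1 else - 1)"
proof -
  let ?L = "{h \<in> H_n n. a i h = (if h (2 * i) = 2 * i then 1 else - 1)}"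
  have "H_n n \<subseteq> ?L"
  proof (rule H_n_minimal)
    show "id \<in> ?L" using a_char[OF assms(2)] by (simp add: H_n_id characters_def)
    show "tt j \<in> ?L" if "j \<in> {1..n}" for j
      using that assms(2) tt_pair[of i n j] a_tt[of i j] by (auto simp: H_n_tt)
    show "g \<circ> h \<in> ?L" if "g \<in> ?L" "h \<in> ?L" for g h
    proof -
      have "a i (g \<circ> h) = a i g * a i h"
        using that a_char[OF assms(2)] by (simp add: characters_def)
      moreover have "(g (2 * i - 1) = 2 * i - 1 \<and> g (2 * i) = 2 * i) \<or> (g (2 * i - 1) = 2 * i \<and> g (2 * i) = 2 * i - 1)"
        "(h (2 * i - 1) = 2 * i - 1 \<and> h (2 * i) = 2 * i) \<or> (h (2 * i - 1) = 2 * i \<and> h (2 * i) = 2 * i - 1)"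
        using that assms(2) H_n_preserves_pairs[of g n] H_n_preserves_pairs[of h n]
        unfolding preserves_pairs_def by blast+
      moreover have "2 * i - 1 \<noteq> 2 * i" using assms(2) by auto
      ultimately show ?thesis using that by (elim disjE) (simp_all add: H_n_comp)
    qed
    show "inv h \<in> ?L" if "h \<in> ?L" for h
    proof -
      have "inv h = h" using that preserves_pairs_invol[OF H_n_preserves_pairs] inv_unique_comp[of h h] by auto
      then show ?thesis using that by simp
    qed
  qed
  then show ?thesis using assms(1) by blast
qed

sublocale bicharacter_twist "sym_group (2 * n)" "H_n n" \<omega>
proof -
  interpret finite_perm_group "sym_group (2 * n)" by (rule finite_perm_group_sym_group)
  show "bicharacter_twist (sym_group (2 * n)) (H_n n) \<omega>"
  proof
    show "H_n n \<subseteq> sym_group (2 * n)"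
      using H_n_preserves_pairs by (auto simp: sym_group_def preserves_pairs_def)
    show "h \<circ> h = id" if "h \<in> H_n n" for h
      using that by (intro preserves_pairs_invol H_n_preserves_pairs)
    show "\<exists>\<chi>::perm \<Rightarrow> 'k. \<chi> \<in> characters (H_n n) \<and> \<chi> h \<noteq> 1" if h: "h \<in> H_n n" "h \<noteq> id" for h
    proof -
      obtain i where i: "i \<in> {1..n}" "h (2 * i) = 2 * i - 1"
        using H_n_moved[OF h] by metis
      moreover have "2 * i - 1 \<noteq> 2 * i" using i by auto
      ultimately have "a i h \<noteq> 1" using a_value[OF h(1) i(1)] by simp
      then show ?thesis using a_char[OF i(1)] by blast
    qed
  qed (fact H_n_id H_n_comp bichar)+
qed

fun a_prod :: "nat \<Rightarrow> perm \<Rightarrow> 'k" where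
  "a_prod 0 = triv"
| "a_prod (Suc k) = char_mult (a (Suc k)) (a_prod k)"

lemma a_prod_char: "k \<le> n \<Longrightarrow> a_prod k \<in> X"
proof (induction k)
  case (Suc k)
  have "a (Suc k) \<in> X" using Suc.prems by (intro a_char) auto
  then show ?case using Suc by (simp add: char_mult_char)
qed (simp add: triv_char)

lemma a_prod_tt: "k \<le> n \<Longrightarrow> j \<in> {1..n} \<Longrightarrow> a_prod k (tt j) = (if j \<le> k then - 1 else 1)"
proof (induction k)
  case 0
  then show ?case using H_n_tt[of j n] by (simp add: triv_def)
next
  case (Suc k)
  then show ?case using a_tt[of "Suc k" j] by (auto simp: char_mult_def)
qed

definition sgn_char :: "perm \<Rightarrow> 'k" where
  "sgn_char h = (if h \<in> H_n n then of_int (sign h) else 0)"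

lemma permutation_sym_group: "g \<in> sym_group m \<Longrightarrow> permutation g"
  by (auto simp: sym_group_def permutation_permutes)

lemma sgn_char: "sgn_char \<in> X"
proof -
  have "permutation h" if "h \<in> H_n n" for h
    using that H_sub by (intro permutation_sym_group) blast
  then show ?thesis by (simp add: characters_def sgn_char_def H_n_id H_n_comp sign_compose)
qed

text \<open>Both sides are characters of H and take the value -1 at every generator.\<close>

lemma sgn_char_eq: "sgn_char = a_prod n"
proof
  fix h
  let ?L = "{h \<in> H_n n. sgn_char h = a_prod n h}"
  have p: "a_prod n \<in> X" by (simp add: a_prod_char)
  have "H_n n \<subseteq> ?L"
  proof (rule H_n_minimal)
    show "id \<in> ?L" using char_id[OF p] char_id[OF sgn_char] by (simp add: H_n_id)
    show "tt j \<in> ?L" if "j \<in> {1..n}" for j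
    proof -
      have "2 * j - 1 \<noteq> 2 * j" using that by auto
      then show ?thesis using that a_prod_tt[of n j] H_n_tt[OF that]
        by (simp add: sgn_char_def) (simp add: tt_def sign_swap_id)
    qed
    show "g \<circ> h \<in> ?L" if "g \<in> ?L" "h \<in> ?L" for g h
      using that char_comp[OF p] char_comp[OF sgn_char] by (simp add: H_n_comp)
    show "inv h \<in> ?L" if "h \<in> ?L" for h
      using that inv_H[of h] by simp
  qed
  then show "sgn_char h = a_prod n h"
    using char_outside[OF p, of h] by (cases "h \<in> H_n n") (auto simp: sgn_char_def)
qed

lemma \<omega>_sgn: "\<omega> (a 1) sgn_char * \<omega> sgn_char (a 1) = - 1"
proof -
  have a1: "a 1 \<in> X" using n by (intro a_char) auto
  \<comment> \<open>Only the factors a_2, ..., a_k contribute -1. Truncated subtraction gives the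
    value 1 for k = 0 as well as for k = 1.\<close>
  have 1: "\<omega> (a 1) (a_prod k) = (- 1) ^ (k - 1)" if "k \<le> n" for k
    using that
  proof (induction k)
    case (Suc k)
    have "a (Suc k) \<in> X" using Suc.prems by (intro a_char) auto
    then have "\<omega> (a 1) (a_prod (Suc k)) = \<omega> (a 1) (a (Suc k)) * \<omega> (a 1) (a_prod k)"
      using a1 a_prod_char[of k] Suc.prems by (simp add: \<omega>_mult)
    also have "\<dots> = (if k = 0 then 1 else - 1) * (- 1) ^ (k - 1)"
      using Suc \<omega>_a[of 1 "Suc k"] by simp
    finally show ?case by (cases k) auto
  qed (use \<omega>_triv(2)[OF a1] in simp)
  have 2: "\<omega> (a_prod k) (a 1) = 1" if "k \<le> n" for k
    using that
  proof (induction k)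
    case (Suc k)
    have "a (Suc k) \<in> X" using Suc.prems by (intro a_char) auto
    then have "\<omega> (a_prod (Suc k)) (a 1) = \<omega> (a (Suc k)) (a 1) * \<omega> (a_prod k) (a 1)"
      using a1 a_prod_char[of k] Suc.prems by (simp add: \<omega>_mult)
    then show ?case using Suc \<omega>_a[of "Suc k" 1] by simp
  qed (use \<omega>_triv(1)[OF a1] in simp)
  have "odd (n - 1)" using even_n n by simp
  then show ?thesis using 1[of n] 2[of n] by (simp add: sgn_char_eq)
qed

text \<open>If h swaps the pair i, a conjugate can be made to send one point of this pair into
  another pair, which no member of H does. Parity is adjusted inside that other pair.\<close>

lemma even_conj_outside_H:
  assumes "h \<in> H_n n" "h \<noteq> id"
  obtains g where "g \<in> sym_group (2 * n)" "sign g = 1" "inv g \<circ> h \<circ> g \<notin> H_n n"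
proof -
  obtain i where i: "i \<in> {1..n}" "h (2 * i - 1) = 2 * i" using H_n_moved[OF assms] by metis
  obtain j where j: "j \<in> {1..n}" "j \<noteq> i"
  proof (cases "i = 1")
    case True
    show ?thesis by (rule that[of 2]) (use n True in auto)
  next
    case False
    show ?thesis by (rule that[of 1]) (use n False in auto)
  qed
  have ne: "2 * j - 1 \<noteq> 2 * i" "2 * j - 1 \<noteq> 2 * j" "2 * i - 1 \<noteq> 2 * j" "2 * i - 1 \<noteq> 2 * i" "2 * i - 1 \<noteq> 2 * j - 1" "2 * i \<noteq> 2 * j"
    using i j by (auto; presburger)+
  \<comment> \<open>\<open>t1\<close> links the pairs i and j; \<open>t2\<close> makes the product
    even. The conjugate sends 2i - 1 to 2j, since h takes 2i - 1 to 2i, \<open>t1\<close> takes that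
    to 2j - 1, and \<open>t2\<close> to 2j.\<close>
  define t1 where "t1 = transpose (2 * i) (2 * j - 1)"
  define t2 where "t2 = transpose (2 * j - 1) (2 * j)"
  have p: "t1 \<in> sym_group (2 * n)" "t2 \<in> sym_group (2 * n)"
    unfolding t1_def t2_def sym_group_def using i j by (auto intro!: permutes_swap_id)
  show ?thesis
  proof (rule that[of "t1 \<circ> t2"])
    show "t1 \<circ> t2 \<in> sym_group (2 * n)" by (intro comp_in p)
    show "sign (t1 \<circ> t2) = 1"
      unfolding t1_def t2_def using ne by (simp add: sign_compose permutation_swap_id sign_swap_id)
    have "inv (t1 \<circ> t2) = t2 \<circ> t1" unfolding t1_def t2_def by (simp add: o_inv_distrib)
    then have "(inv (t1 \<circ> t2) \<circ> h \<circ> (t1 \<circ> t2)) (2 * i - 1) = 2 * j"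
      unfolding t1_def t2_def using ne i by simp
    then show "inv (t1 \<circ> t2) \<circ> h \<circ> (t1 \<circ> t2) \<notin> H_n n"
      using H_n_preserves_pairs[of "inv (t1 \<circ> t2) \<circ> h \<circ> (t1 \<circ> t2)" n] i ne
      unfolding preserves_pairs_def by (metis)
  qed
qed

text \<open>Every even permutation is in the support of x and so commutes with uv. Each h other than
  the identity is moved out of H by some even conjugation, so uv has no coefficient there and is a
  scalar. Its values at the trivial character and at a_1 differ.\<close>

lemma sign_not_invariant:
  assumes K: "normal_subalgebra (sym_group (2 * n)) (H_n n) J K"
    and x: "x \<in> K" "\<And>g. g \<in> sym_group (2 * n) \<Longrightarrow> sign g = 1 \<Longrightarrow> x g \<noteq> 0"
    and inv: "invariant K (\<lambda>g. of_int (sign g))"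
  shows False
proof -
  interpret K: normal_subalgebra "sym_group (2 * n)" "H_n n" J K by (rule K)
  define \<tau> :: "perm \<Rightarrow> 'k" where "\<tau> g = of_int (sign g)" for g
  define u where "u = (\<lambda>p. \<Sum>q\<in>H_n n. J (p, q) * \<tau> q)"
  define v where "v = (\<lambda>q. \<Sum>p\<in>H_n n. J (p, q) * \<tau> p)"
  have \<tau>: "\<forall>g\<in>sym_group (2 * n). \<forall>h\<in>sym_group (2 * n). \<tau> (g \<circ> h) = \<tau> g * \<tau> h"
    using permutation_sym_group by (simp add: \<tau>_def sign_compose)
  have \<tau>_id: "\<tau> id = 1" by (simp add: \<tau>_def)
  have \<tau>_inv: "invariant K \<tau>" using inv by (simp add: \<tau>_def[abs_def])
  note ctx = \<tau> \<tau>_id \<tau>_inv u_def v_def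
  \<comment> \<open>\<open>W h0\<close> is the coefficient of uv at \<open>h0\<close>.\<close>
  define W where "W h0 = wsum u (H_n n) (\<lambda>p. wsum v (H_n n) (\<lambda>q. if p \<circ> q = h0 then 1 else 0))" for h0
  have W: "W h0 = 0" if h0: "h0 \<in> H_n n" "h0 \<noteq> id" for h0
  proof -
    obtain g where g: "g \<in> sym_group (2 * n)" "sign g = 1" "inv g \<circ> h0 \<circ> g \<notin> H_n n"
      by (rule even_conj_outside_H[OF h0])
    show ?thesis unfolding W_def
      by (rule K.uv_coefficient_zero[OF ctx x(1) g(1) x(2)[OF g(1,2)] h0(1) g(3)])
  qed
  have "\<omega> \<alpha> sgn_char * \<omega> sgn_char \<alpha> = W id" if \<alpha>: "\<alpha> \<in> X" for \<alpha>
  proof -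
    have u: "wsum u (H_n n) \<alpha> = \<omega> \<alpha> sgn_char"
      unfolding wsum_J_char[OF \<alpha> sgn_char, symmetric]
      by (rule trans[OF K.wsum_u[OF ctx]], rule wsum_cong) (auto simp: \<tau>_def sgn_char_def)
    have v: "wsum v (H_n n) \<alpha> = \<omega> sgn_char \<alpha>"
      unfolding wsum_J_char[OF sgn_char \<alpha>, symmetric]
      by (rule trans[OF K.wsum_v[OF ctx]], rule wsum_cong) (auto simp: \<tau>_def sgn_char_def)
    have "\<omega> \<alpha> sgn_char * \<omega> sgn_char \<alpha> = wsum u (H_n n) (\<lambda>p. wsum v (H_n n) (\<lambda>q. \<alpha> p * \<alpha> q))"
      by (simp add: wsum_cmult wsum_multc u v)
    also have "\<dots> = wsum u (H_n n) (\<lambda>p. wsum v (H_n n) (\<lambda>q. \<Sum>h\<in>H_n n. \<alpha> h * (if p \<circ> q = h then 1 else 0)))"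
    proof (rule wsum_cong, rule wsum_cong)
      fix p q assume pq: "p \<in> H_n n" "q \<in> H_n n"
      have "(\<Sum>h\<in>H_n n. \<alpha> h * (if p \<circ> q = h then 1 else 0)) = (\<Sum>h\<in>H_n n. if p \<circ> q = h then \<alpha> h else 0)"
        by (intro sum.cong) auto
      then show "\<alpha> p * \<alpha> q = (\<Sum>h\<in>H_n n. \<alpha> h * (if p \<circ> q = h then 1 else 0))"
        using finite_H pq char_comp[OF \<alpha> pq] by (simp add: H_n_comp)
    qed
    also have "\<dots> = (\<Sum>h\<in>H_n n. \<alpha> h * W h)" by (simp add: wsum_sum W_def)
    also have "\<dots> = (\<Sum>h\<in>H_n n. if h = id then W id else 0)"
      by (intro sum.cong) (auto simp: W char_id[OF \<alpha>])
    finally show ?thesis using finite_H H_n_id by simp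
  qed
  note const = this
  have "\<omega> triv sgn_char * \<omega> sgn_char triv = 1" by (simp add: \<omega>_triv sgn_char)
  then have "W id = 1" using const[OF triv_char] by simp
  moreover have "W id = - 1" using const[of "a 1"] \<omega>_sgn a_char[of 1] n by simp
  ultimately show False by simp
qed

lemma simple: "simple_twisted (sym_group (2 * n)) J"
  unfolding simple_twisted_def
proof (intro allI impI)
  fix K :: "(perm \<Rightarrow> 'k) set"
  let ?G = "sym_group (2 * n)"
  assume K: "normal_hopf_subalg_tw ?G J K"
  interpret K: normal_subalgebra ?G "H_n n" J K by unfold_locales (rule K)
  show "K = {ga_smult c ga_one |c. True} \<or> K = ga_carrier ?G"
  proof (cases "\<forall>g\<in>?G. g \<noteq> id \<longrightarrow> (\<exists>f. invariant K f \<and> f g \<noteq> f id)")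
    case True
    then show ?thesis using K.K_scalar_if_separated by blast
  next
    case False
    then obtain \<sigma> where \<sigma>: "\<sigma> \<in> ?G" "\<sigma> \<noteq> id" "\<And>f. invariant K f \<Longrightarrow> f \<sigma> = f id" by blast
    \<comment> \<open>The points that no invariant function tells apart from the identity. Right
      translations make it a subgroup, left translations make it normal.\<close>
    define N where "N = {g \<in> ?G. \<forall>f. invariant K f \<longrightarrow> f g = f id}"
    have N: "f g = f id" if "g \<in> N" "invariant K f" for f g using that by (simp add: N_def)
    have even_N: "g \<in> N" if g: "g \<in> ?G" "sign g = 1" for g
    proof (rule normal_subgroup_contains_even[where S = "{1..2 * n}" and \<sigma> = \<sigma>])
      show "card {1..2 * n} \<ge> 5" using n by simp
      show "N \<subseteq> {p. p permutes {1..2 * n}}" by (auto simp: N_def sym_group_def)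
      show "id \<in> N" by (simp add: N_def id_in)
      show "x \<circ> y \<in> N" if xy: "x \<in> N" "y \<in> N" for x y
      proof -
        have G: "x \<in> ?G" "y \<in> ?G" using xy by (simp_all add: N_def)
        have "f (x \<circ> y) = f id" if f: "invariant K f" for f
          using N[OF xy(1) K.invariant_right[OF f G(2)]] N[OF xy(2) f] by simp
        then show ?thesis using G by (simp add: N_def comp_in)
      qed
      show "inv x \<in> N" if x: "x \<in> N" for x
      proof -
        have G: "x \<in> ?G" using x by (simp add: N_def)
        have "f (inv x) = f id" if f: "invariant K f" for f
          using N[OF x K.invariant_right[OF f inv_in[OF G]]] G by simp
        then show ?thesis using G by (simp add: N_def inv_in)
      qed
      show "h \<circ> x \<circ> inv h \<in> N" if x: "x \<in> N" and h: "h permutes {1..2 * n}" for x h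
      proof -
        have G: "x \<in> ?G" "h \<in> ?G" using x h by (simp_all add: N_def sym_group_def)
        have "f (h \<circ> x \<circ> inv h) = f id" if f: "invariant K f" for f
          using N[OF x K.invariant_left[OF K.invariant_right[OF f inv_in[OF G(2)]] G(2)]] G by simp
        then show ?thesis using G by (simp add: N_def comp_in inv_in)
      qed
      show "\<sigma> \<in> N" using \<sigma> by (simp add: N_def)
    qed (use \<sigma> g in \<open>auto simp: sym_group_def\<close>)
    obtain e where e: "e \<in> K" "\<And>k. k \<in> K \<Longrightarrow> wsum e ?G (\<lambda>g. k (inv g)) = wsum k ?G (\<lambda>_. 1)"
      by (rule K.integral_exists, rule that)
    \<comment> \<open>f has value 1 on all of N, hence on even permutations, and one common value
      \<open>f s\<close> on odd ones; the cases below ask whether that value is also 1.\<close>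
    define f where "f = (\<lambda>g. e (inv g))"
    have f: "invariant K f" unfolding f_def by (rule K.integral_invariant[OF e])
    have f_id: "f id = 1"
      using e(2)[OF K.K_one] K.form_commute[of e ga_one] by (simp add: wsum_ga_one f_def)
    define s :: perm where "s = transpose 1 2"
    have s: "s \<in> ?G" "sign s = - 1"
      using n by (auto simp: s_def sym_group_def sign_swap_id intro!: permutes_swap_id)
    have f_even: "f g = 1" if "g \<in> ?G" "sign g = 1" for g
      using N[OF even_N[OF that] f] f_id by simp
    have f_odd: "f g = f s" if g: "g \<in> ?G" "sign g \<noteq> 1" for g
    proof -
      have "sign g = - 1" using g(2) by (cases g rule: sign_cases) auto
      then have "sign (g \<circ> s) = 1" using g s permutation_sym_group by (simp add: sign_compose)
      then have "g \<circ> s \<in> N" using g s by (intro even_N comp_in)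
      then have "f (g \<circ> s \<circ> s) = f s" using N[OF _ K.invariant_right[OF f s(1)]] by simp
      then show ?thesis by (simp add: comp_assoc s_def)
    qed
    have sign_inv: "sign (inv g) = sign g" if "g \<in> ?G" for g
      using that by (intro sign_inverse permutation_sym_group)
    have e_f: "e g = f (inv g)" if "g \<in> ?G" for g using that by (simp add: f_def)
    show ?thesis
    proof (cases "f s = 1")
      case True
      have "e g = 1" if g: "g \<in> ?G" for g
        using f_even[of "inv g"] f_odd[of "inv g"] True g by (cases "sign (inv g) = 1") (auto simp: e_f inv_in)
      then show ?thesis using K.K_full_if_sum_in_K[OF e(1)] by blast
    next
      case False
      \<comment> \<open>With this constant the affine map in \<open>eq\<close> sends 1 to 1 and
        \<open>f s\<close> to -1, so it turns f into the sign.\<close>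
      let ?c = "inverse (1 - f s)"
      have eq: "of_int (sign g) = 2 * ?c * f g + - (1 + f s) * ?c" if g: "g \<in> ?G" for g
      proof (cases g rule: sign_cases)
        case even
        have "(1 - f s) * ?c = 1" using False by simp
        then show ?thesis using f_even[OF g even] even by (simp add: algebra_simps)
      next
        case odd
        have "(1 - f s) * ?c = 1" using False by simp
        then show ?thesis using f_odd[OF g] odd by (simp add: algebra_simps)
      qed
      have lin: "invariant K (\<lambda>g. 2 * ?c * f g + - (1 + f s) * ?c)"
        by (intro K.invariant_add K.invariant_mult K.invariant_const f)
      have "invariant K (\<lambda>g. of_int (sign g))"
        unfolding invariant_def
      proof (intro ballI)
        fix x b assume x: "x \<in> K" and b: "b \<in> ?G"
        have "wsum x ?G (\<lambda>h. of_int (sign (h \<circ> b))) = wsum x ?G (\<lambda>h. 2 * ?c * f (h \<circ> b) + - (1 + f s) * ?c)"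
          by (rule wsum_cong) (simp only: eq comp_in b)
        then show "wsum x ?G (\<lambda>h. of_int (sign (h \<circ> b))) = wsum x ?G (\<lambda>_. 1) * of_int (sign b)"
          using invariantD[OF lin x b] eq[OF b] by (simp only:)
      qed
      moreover have "e g \<noteq> 0" if "g \<in> ?G" "sign g = 1" for g
        using f_even[of "inv g"] that by (simp add: e_f inv_in sign_inv)
      ultimately have False using sign_not_invariant[OF K.normal_subalgebra_axioms e(1)] by blast
      then show ?thesis ..
    qed
  qed
qed

end

theorem theorem3p6:
  fixes n :: nat
    and a :: "nat \<Rightarrow> perm \<Rightarrow> 'k::field_char_0"
    and \<omega> :: "(perm \<Rightarrow> 'k) \<Rightarrow> (perm \<Rightarrow> 'k) \<Rightarrow> 'k"
  assumes "alg_closed TYPE('k)"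
    and "n \<ge> 3" and "even n"
    and "\<forall>i\<in>{1..n}. a i \<in> characters (H_n n)"
    and "\<forall>i\<in>{1..n}. \<forall>j\<in>{1..n}. a i (tt j) = (if i = j then -1 else 1)"
    and "bicharacter (H_n n) \<omega>"
    and "\<forall>i\<in>{1..n}. \<forall>j\<in>{1..n}. \<omega> (a i) (a j) = (if i < j then -1 else 1)"
  shows "simple_twisted (sym_group (2 * n)) (twist_J (H_n n) \<omega>)"
proof -
  interpret pair_twist n a \<omega>
    using assms(2-) by unfold_locales blast+
  show ?thesis by (rule simple)
qed

end
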